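(* Let $G/H$ be a connected, simply connected homogeneous space of a compact Lie group $G$ satisfying the monotypic condition (the irreducible summands $\mathfrak m_i,\mathfrak m_j$ of $\mathfrak m$ are non-isomorphic $\mathrm{Ad}(H)$-modules for $i\neq j$) and such that $\dim \mathfrak m_i\ge 2$ for every $i$. Fix $\lambda\in\mathbb R$, $h>0$, $m>0$ and $0<T<1$. Let $(g,u)$ be a singular cohomogeneity one quasi-Einstein metric on $G/H\times(0,T]$ with constant $\lambda$, i.e. $u$ is a smooth $G$-invariant function, $g=h^2\,dt\otimes dt+g_t$ is a smooth $G$-invariant Riemannian metric, $Ric(g)+Hess(u)-m\,du\otimes du=\lambda g$ on $G/H\times (0,T]$, and the associated solution $(y,\xi)$ of the ODE system $$\xi'=-\mathrm{tr}(y'^2)-m(\mathrm{tr}(y')-\xi)^2-h^2\lambda,\qquad y''=-\xi y'+h^2r(y)-h^2\lambda I$$ on $(0,T]$ cannot be smoothly extended to $[0,T]$. Then $$\sup_{t\in(0,T]}M(t)\,t<\infty .$$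
   Context: Setting. $\mathfrak g,\mathfrak h$ are the Lie algebras of $G,H$; $Q$ is a fixed $\mathrm{Ad}(G)$-invariant inner product on $\mathfrak g$; $\mathfrak m$ is the $Q$-orthogonal complement of $\mathfrak h$ in $\mathfrak g$, identified with the tangent space of $G/H$ at $H$; $\mathfrak m=\bigoplus_{i=1}^n\mathfrak m_i$ is a $Q$-orthogonal decomposition into irreducible $\mathrm{Ad}(H)$-modules; $d_i=\dim\mathfrak m_i$ and $d=\sum_i d_i$. Because of the monotypic condition, the $G$-invariant metrics $g_t$ on $G/H$ are given by smooth functions $y_1,\dots,y_n$ of $t$ via $g_t(X,Y)=\sum_{i=1}^n e^{2y_i(t)}Q(pr_{\mathfrak m_i}X,pr_{\mathfrak m_i}Y)$ for $X,Y\in\mathfrak m$, where $pr_{\mathfrak m_i}$ is $Q$-orthogonal projection. Put $\xi=\sum_i d_iy_i'-u'$. A vector $(v_1,\dots,v_n)$ is identified with the $d\times d$ diagonal matrix in which $v_i$ is repeated $d_i$ times; $I$ is the identity matrix. The quasi-Einstein equation for $(g,u)$ is equivalent to the stated ODE system for $(y,\xi)$. Structure constants: $\beta_i\ge0$ is defined by $B(X,Y)=-\beta_iQ(X,Y)$ for $X,Y\in\mathfrak m_i$, where $B$ is the Killing form of $\mathfrak g$; and $\gamma_{ik}^l=\frac1{d_i}\sum Q([e_a,e_b],e_c)^2\ge0$, where $e_a,e_b,e_c$ run over $Q$-orthonormal bases of $\mathfrak m_i,\mathfrak m_k,\mathfrak m_l$ respectively. The function $r=(r_1,\dots,r_n)$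 is $$r_i(y)=\frac{\beta_i}{2e^{2y_i}}+\sum_{k,l=1}^n\gamma_{ik}^l\,\frac{e^{4y_i}-2e^{4y_k}}{4e^{2y_i+2y_k+2y_l}},$$ and $R:\mathbb R^n\to\mathbb R$ is $$R(x)=\sum_{i=1}^n\beta_ie^{-2x_i}+\sum_{i,j,k=1}^n\gamma_{ij}^ke^{2x_i-2x_j-2x_k}.$$ $M(t)\ge0$ is defined by $$M(t)^2=\xi(t)^2+\sum_{i=1}^nd_iy_i'(t)^2+R(y(t)).$$ *)

theory Defs
  imports "HOL-Analysis.Analysis" "HOL-Algebra.Coset"
begin

section \<open>Smoothness\<close>

text \<open>\<open>C\<^sup>k\<close> maps on an \<^emph>\<open>open\<close> set of a normed space.\<close>

primrec Ck_on :: "nat \<Rightarrow> 'a::real_normed_vector set \<Rightarrow> ('a \<Rightarrow> 'b::real_normed_vector) \<Rightarrow> bool" where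
  "Ck_on 0 S f \<longleftrightarrow> continuous_on S f"
| "Ck_on (Suc k) S f \<longleftrightarrow> (\<forall>x\<in>S. f differentiable (at x)) \<and>
     (\<forall>v. Ck_on k S (\<lambda>x. frechet_derivative f (at x) v))"

definition smooth_on :: "'a::real_normed_vector set \<Rightarrow> ('a \<Rightarrow> 'b::real_normed_vector) \<Rightarrow> bool" where
  "smooth_on S f \<longleftrightarrow> (\<forall>k. Ck_on k S f)"

text \<open>Smooth curves on an interval that may contain endpoints, where derivatives are one-sided;
  \<open>D k\<close> is the \<open>k\<close>-th derivative.\<close>

definition smooth_on_interval :: "real set \<Rightarrow> (real \<Rightarrow> 'b::real_normed_vector) \<Rightarrow> bool" where
  "smooth_on_interval J f \<longleftrightarrow>
     (\<exists>D. (\<forall>t\<in>J. D 0 t = f t) \<and>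
          (\<forall>k. \<forall>t\<in>J. (D k has_vector_derivative D (Suc k) t) (at t within J)))"

section \<open>Lie groups\<close>

text \<open>A chart is a pair \<open>(U, \<phi>)\<close>; an atlas is a set of charts. \<open>smooth_into X A S f\<close> says that \<open>f\<close>,
  defined on the open set \<open>S\<close> of a normed space, is a smooth map into the manifold \<open>(X, A)\<close>.\<close>

type_synonym ('g, 'e) chart = "'g set \<times> ('g \<Rightarrow> 'e)"

definition chart_inv :: "('g, 'e) chart \<Rightarrow> 'e \<Rightarrow> 'g" where
  "chart_inv \<kappa> = inv_into (fst \<kappa>) (snd \<kappa>)"

definition smooth_into :: "'g topology \<Rightarrow> ('g, 'e::real_normed_vector) chart set \<Rightarrow>
    'a::real_normed_vector set \<Rightarrow> ('a \<Rightarrow> 'g) \<Rightarrow> bool" where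
  "smooth_into X A S f \<longleftrightarrow> open S \<and> continuous_map (top_of_set S) X f \<and>
     (\<forall>(U, \<phi>)\<in>A. smooth_on {x \<in> S. f x \<in> U} (\<lambda>x. \<phi> (f x)))"

text \<open>Second countability is not listed: it is automatic for the compact groups considered here.\<close>

locale lie_group = group G for G :: "'g monoid" (structure) +
  fixes X :: "'g topology" and A :: "('g, 'e::euclidean_space) chart set"
  assumes topspace_eq: "topspace X = carrier G"
    and hausdorff: "Hausdorff_space X"
    and atlas_cover: "(\<Union>\<kappa>\<in>A. fst \<kappa>) = carrier G"
    and chart: "(U, \<phi>) \<in> A \<Longrightarrow> openin X U \<and> open (\<phi> ` U) \<and>
        homeomorphic_map (subtopology X U) (top_of_set (\<phi> ` U)) \<phi>"
    and transition_smooth: "\<kappa> \<in> A \<Longrightarrow> smooth_into X A (snd \<kappa> ` fst \<kappa>) (chart_inv \<kappa>)"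
    and mult_smooth: "\<kappa> \<in> A \<Longrightarrow> \<kappa>' \<in> A \<Longrightarrow>
        smooth_into X A ((snd \<kappa> ` fst \<kappa>) \<times> (snd \<kappa>' ` fst \<kappa>'))
          (\<lambda>(x, y). chart_inv \<kappa> x \<otimes> chart_inv \<kappa>' y)"
    and inverse_smooth: "\<kappa> \<in> A \<Longrightarrow>
        smooth_into X A (snd \<kappa> ` fst \<kappa>) (\<lambda>x. inv (chart_inv \<kappa> x))"

text \<open>Throughout, \<open>\<kappa>\<close> is a chart whose domain contains the identity. It identifies the tangent space
  at the identity, i.e. the Lie algebra of \<open>G\<close>, with the model space \<open>'e\<close>.

  \<open>log_vel\<close> is the left-translated velocity \<open>c(0)\<^sup>-\<^sup>1 c'(0)\<close> of a curve \<open>c\<close> in \<open>G\<close>, and \<open>ray\<close> is a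
  curve through the identity with velocity \<open>Z\<close>.\<close>

definition log_vel :: "'g monoid \<Rightarrow> ('g, 'e::euclidean_space) chart \<Rightarrow> (real \<Rightarrow> 'g) \<Rightarrow> 'e" where
  "log_vel G \<kappa> c = vector_derivative (\<lambda>s. snd \<kappa> (inv\<^bsub>G\<^esub> (c 0) \<otimes>\<^bsub>G\<^esub> c s)) (at 0)"

definition ray :: "'g monoid \<Rightarrow> ('g, 'e::euclidean_space) chart \<Rightarrow> 'e \<Rightarrow> real \<Rightarrow> 'g" where
  "ray G \<kappa> Z s = chart_inv \<kappa> (snd \<kappa> \<one>\<^bsub>G\<^esub> + s *\<^sub>R Z)"

definition Ad :: "'g monoid \<Rightarrow> ('g, 'e::euclidean_space) chart \<Rightarrow> 'g \<Rightarrow> 'e \<Rightarrow> 'e" where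
  "Ad G \<kappa> a Z = log_vel G \<kappa> (\<lambda>s. a \<otimes>\<^bsub>G\<^esub> ray G \<kappa> Z s \<otimes>\<^bsub>G\<^esub> inv\<^bsub>G\<^esub> a)"

definition bracket :: "'g monoid \<Rightarrow> ('g, 'e::euclidean_space) chart \<Rightarrow> 'e \<Rightarrow> 'e \<Rightarrow> 'e" where
  "bracket G \<kappa> Y Z = vector_derivative (\<lambda>s. Ad G \<kappa> (ray G \<kappa> Y s) Z) (at 0)"

text \<open>The trace of \<open>ad Y \<circ> ad Z\<close>; the inner product of \<open>'e\<close> only serves to compute the trace.\<close>

definition killing_form :: "'g monoid \<Rightarrow> ('g, 'e::euclidean_space) chart \<Rightarrow> 'e \<Rightarrow> 'e \<Rightarrow> real" where
  "killing_form G \<kappa> Y Z = (\<Sum>b\<in>Basis. bracket G \<kappa> Y (bracket G \<kappa> Z b) \<bullet> b)"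

text \<open>The Lie algebra of a closed subgroup \<open>H\<close>: velocities of smooth curves of \<open>G\<close> contained in \<open>H\<close>.\<close>

definition lie_subalgebra ::
    "'g monoid \<Rightarrow> 'g topology \<Rightarrow> ('g, 'e::euclidean_space) chart set \<Rightarrow> ('g, 'e) chart \<Rightarrow>
     'g set \<Rightarrow> 'e set" where
  "lie_subalgebra G X A \<kappa> H =
     {log_vel G \<kappa> c | c. smooth_into X A (UNIV :: real set) c \<and> c 0 = \<one>\<^bsub>G\<^esub> \<and> (\<forall>s. c s \<in> H)}"

definition ad_invariant_inner_product ::
    "'g monoid \<Rightarrow> ('g, 'e::euclidean_space) chart \<Rightarrow> ('e \<Rightarrow> 'e \<Rightarrow> real) \<Rightarrow> bool" where
  "ad_invariant_inner_product G \<kappa> Q \<longleftrightarrow> bilinear Q \<and> (\<forall>Y Z. Q Y Z = Q Z Y) \<and>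
     (\<forall>Z. Z \<noteq> 0 \<longrightarrow> Q Z Z > 0) \<and>
     (\<forall>a\<in>carrier G. \<forall>Y Z. Q (Ad G \<kappa> a Y) (Ad G \<kappa> a Z) = Q Y Z)"

section \<open>Inner products and modules\<close>

definition Q_complement :: "('e \<Rightarrow> 'e \<Rightarrow> real) \<Rightarrow> 'e set \<Rightarrow> 'e set" where
  "Q_complement Q W = {Z. \<forall>Y\<in>W. Q Y Z = 0}"

definition Q_proj :: "('e \<Rightarrow> 'e \<Rightarrow> real) \<Rightarrow> 'e::real_vector set \<Rightarrow> 'e \<Rightarrow> 'e" where
  "Q_proj Q W Z = (THE P. P \<in> W \<and> (\<forall>Y\<in>W. Q Y (Z - P) = 0))"

definition Q_orthonormal_basis :: "('e \<Rightarrow> 'e \<Rightarrow> real) \<Rightarrow> 'e::real_vector set \<Rightarrow> 'e set \<Rightarrow> bool" where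
  "Q_orthonormal_basis Q W E \<longleftrightarrow>
     span E = W \<and> (\<forall>a\<in>E. \<forall>b\<in>E. Q a b = (if a = b then 1 else 0))"

definition Ad_submodule ::
    "'g monoid \<Rightarrow> ('g, 'e::euclidean_space) chart \<Rightarrow> 'g set \<Rightarrow> 'e set \<Rightarrow> bool" where
  "Ad_submodule G \<kappa> H W \<longleftrightarrow> subspace W \<and> (\<forall>a\<in>H. \<forall>Z\<in>W. Ad G \<kappa> a Z \<in> W)"

definition Ad_irreducible ::
    "'g monoid \<Rightarrow> ('g, 'e::euclidean_space) chart \<Rightarrow> 'g set \<Rightarrow> 'e set \<Rightarrow> bool" where
  "Ad_irreducible G \<kappa> H W \<longleftrightarrow> Ad_submodule G \<kappa> H W \<and> W \<noteq> {0} \<and>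
     (\<forall>V. Ad_submodule G \<kappa> H V \<and> V \<subseteq> W \<longrightarrow> V = {0} \<or> V = W)"

definition Ad_isomorphic ::
    "'g monoid \<Rightarrow> ('g, 'e::euclidean_space) chart \<Rightarrow> 'g set \<Rightarrow> 'e set \<Rightarrow> 'e set \<Rightarrow> bool" where
  "Ad_isomorphic G \<kappa> H V W \<longleftrightarrow>
     (\<exists>f. linear f \<and> bij_betw f V W \<and> (\<forall>a\<in>H. \<forall>Z\<in>V. f (Ad G \<kappa> a Z) = Ad G \<kappa> a (f Z)))"

section \<open>The homogeneous space\<close>

definition coset_space :: "'g monoid \<Rightarrow> 'g topology \<Rightarrow> 'g set \<Rightarrow> 'g set topology" where
  "coset_space G X H = topology (\<lambda>\<U>. \<U> \<subseteq> (\<lambda>a. a <#\<^bsub>G\<^esub> H) ` carrier G \<and>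
     openin X {a \<in> carrier G. a <#\<^bsub>G\<^esub> H \<in> \<U>})"

text \<open>The analogue of \<^const>\<open>simply_connected\<close> for abstract topologies.\<close>

definition simply_connected_space :: "'a topology \<Rightarrow> bool" where
  "simply_connected_space Y \<longleftrightarrow>
     (\<forall>p q. pathin Y p \<and> p 1 = p 0 \<and> pathin Y q \<and> q 1 = q 0 \<longrightarrow>
        homotopic_with (\<lambda>r. r 1 = r 0) (top_of_set {0..1}) Y p q)"

text \<open>Local coordinates on \<open>G/H\<close>, given through a smooth lift \<open>\<sigma>\<close> to \<open>G\<close>: the map \<open>x \<mapsto> \<sigma> x H\<close> is injective
  and an immersion between manifolds of the same dimension. Every chart of \<open>G/H\<close> is locally of this
  form, because \<open>G \<rightarrow> G/H\<close> has smooth local sections.\<close>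

definition coset_coordinates ::
    "'g monoid \<Rightarrow> 'g topology \<Rightarrow> ('g, 'e::euclidean_space) chart set \<Rightarrow> ('g, 'e) chart \<Rightarrow> 'g set \<Rightarrow>
     'c::euclidean_space set \<Rightarrow> ('c \<Rightarrow> 'g) \<Rightarrow> bool" where
  "coset_coordinates G X A \<kappa> H U \<sigma> \<longleftrightarrow> smooth_into X A U \<sigma> \<and> inj_on (\<lambda>x. \<sigma> x <#\<^bsub>G\<^esub> H) U \<and>
     (\<forall>x\<in>U. \<forall>v. log_vel G \<kappa> (\<lambda>s. \<sigma> (x + s *\<^sub>R v)) \<in> lie_subalgebra G X A \<kappa> H \<longrightarrow> v = 0)"

section \<open>Riemannian geometry in coordinates\<close>

text \<open>Here \<open>S\<close> is the coordinate domain (for the theorem \<open>U \<times> {0<..T}\<close>), on which \<open>g p\<close> is the metric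
  at \<open>p\<close>, and \<open>Basis\<close> provides the coordinate vector fields. The derivatives are taken within \<open>S\<close>, so
  that they are one-sided at boundary points.\<close>

definition partial :: "'a::euclidean_space set \<Rightarrow> ('a \<Rightarrow> 'b::real_normed_vector) \<Rightarrow> 'a \<Rightarrow> 'a \<Rightarrow> 'b" where
  "partial S f i p = vector_derivative (\<lambda>s. f (p + s *\<^sub>R i)) (at 0 within {s. p + s *\<^sub>R i \<in> S})"

text \<open>The vector \<open>\<nabla>\<^bsub>i\<^esub> \<partial>\<^bsub>j\<^esub>\<close> of the Levi-Civita connection, by the Koszul formula.\<close>

definition christoffel ::
    "'a::euclidean_space set \<Rightarrow> ('a \<Rightarrow> 'a \<Rightarrow> 'a \<Rightarrow> real) \<Rightarrow> 'a \<Rightarrow> 'a \<Rightarrow> 'a \<Rightarrow> 'a" where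
  "christoffel S g i j p = (THE Z. \<forall>w\<in>Basis. g p Z w =
     (partial S (\<lambda>q. g q j w) i p + partial S (\<lambda>q. g q i w) j p - partial S (\<lambda>q. g q i j) w p) / 2)"

text \<open>\<open>R(\<partial>\<^bsub>i\<^esub>, \<partial>\<^bsub>j\<^esub>) \<partial>\<^bsub>k\<^esub> = \<nabla>\<^bsub>i\<^esub> \<nabla>\<^bsub>j\<^esub> \<partial>\<^bsub>k\<^esub> - \<nabla>\<^bsub>j\<^esub> \<nabla>\<^bsub>i\<^esub> \<partial>\<^bsub>k\<^esub>\<close>, so that round spheres have positive Ricci curvature.\<close>

definition curvature ::
    "'a::euclidean_space set \<Rightarrow> ('a \<Rightarrow> 'a \<Rightarrow> 'a \<Rightarrow> real) \<Rightarrow> 'a \<Rightarrow> 'a \<Rightarrow> 'a \<Rightarrow> 'a \<Rightarrow> 'a" where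
  "curvature S g i j k p =
     partial S (christoffel S g j k) i p - partial S (christoffel S g i k) j p
     + (\<Sum>l\<in>Basis. (christoffel S g j k p \<bullet> l) *\<^sub>R christoffel S g i l p)
     - (\<Sum>l\<in>Basis. (christoffel S g i k p \<bullet> l) *\<^sub>R christoffel S g j l p)"

definition ricci ::
    "'a::euclidean_space set \<Rightarrow> ('a \<Rightarrow> 'a \<Rightarrow> 'a \<Rightarrow> real) \<Rightarrow> 'a \<Rightarrow> 'a \<Rightarrow> 'a \<Rightarrow> real" where
  "ricci S g j k p = (\<Sum>i\<in>Basis. curvature S g i j k p \<bullet> i)"

definition hessian ::
    "'a::euclidean_space set \<Rightarrow> ('a \<Rightarrow> 'a \<Rightarrow> 'a \<Rightarrow> real) \<Rightarrow> ('a \<Rightarrow> real) \<Rightarrow> 'a \<Rightarrow> 'a \<Rightarrow> 'a \<Rightarrow> real" where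
  "hessian S g f i j p = partial S (partial S f j) i p
     - (\<Sum>l\<in>Basis. (christoffel S g i j p \<bullet> l) * partial S f l p)"

definition quasi_einstein ::
    "'a::euclidean_space set \<Rightarrow> ('a \<Rightarrow> 'a \<Rightarrow> 'a \<Rightarrow> real) \<Rightarrow> ('a \<Rightarrow> real) \<Rightarrow> real \<Rightarrow> real \<Rightarrow> bool" where
  "quasi_einstein S g f m lam \<longleftrightarrow> (\<forall>p\<in>S. \<forall>i\<in>Basis. \<forall>j\<in>Basis.
     ricci S g i j p + hessian S g f i j p - m * (partial S f i p * partial S f j p) = lam * g p i j)"

text \<open>The metric \<open>h\<^sup>2 dt \<otimes> dt + g\<^bsub>t\<^esub>\<close> on \<open>G/H \<times> (0,T]\<close> in the coordinates given by a lift \<open>\<sigma>\<close>. By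
  \<open>G\<close>-invariance, \<open>g\<^bsub>t\<^esub>\<close> at the point \<open>aH\<close> is found by translating tangent vectors back to \<open>H\<close> by \<open>a\<^sup>-\<^sup>1\<close>;
  the projections to the summands \<open>\<mm> i\<close> annihilate the component along the Lie algebra of \<open>H\<close>.\<close>

definition cohom1_metric ::
    "'g monoid \<Rightarrow> ('g, 'e::euclidean_space) chart \<Rightarrow> ('e \<Rightarrow> 'e \<Rightarrow> real) \<Rightarrow> ('i::finite \<Rightarrow> 'e set) \<Rightarrow>
     real \<Rightarrow> (real \<Rightarrow> real ^ 'i) \<Rightarrow> ('c::euclidean_space \<Rightarrow> 'g) \<Rightarrow>
     'c \<times> real \<Rightarrow> 'c \<times> real \<Rightarrow> 'c \<times> real \<Rightarrow> real" where
  "cohom1_metric G \<kappa> Q \<mm> h y \<sigma> = (\<lambda>(x, t) (v, a) (w, b).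
     h^2 * (a * b) +
     (\<Sum>i\<in>UNIV. exp (2 * y t $ i) *
        Q (Q_proj Q (\<mm> i) (log_vel G \<kappa> (\<lambda>s. \<sigma> (x + s *\<^sub>R v))))
          (Q_proj Q (\<mm> i) (log_vel G \<kappa> (\<lambda>s. \<sigma> (x + s *\<^sub>R w))))))"

section \<open>Structure constants and the ODE system\<close>

text \<open>\<open>struct_const G \<kappa> Q E i k l\<close> is \<open>\<gamma>\<^bsub>ik\<^esub>\<^bsup>l\<^esup>\<close>, for orthonormal bases \<open>E i\<close> of the summands (so
  \<open>card (E i) = d\<^bsub>i\<^esub>\<close>).\<close>

definition struct_const ::
    "'g monoid \<Rightarrow> ('g, 'e::euclidean_space) chart \<Rightarrow> ('e \<Rightarrow> 'e \<Rightarrow> real) \<Rightarrow> ('i \<Rightarrow> 'e set) \<Rightarrow>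
     'i \<Rightarrow> 'i \<Rightarrow> 'i \<Rightarrow> real" where
  "struct_const G \<kappa> Q E i k l =
     (\<Sum>a\<in>E i. \<Sum>b\<in>E k. \<Sum>c\<in>E l. (Q (bracket G \<kappa> a b) c)^2) / card (E i)"

definition r_fun :: "('i::finite \<Rightarrow> real) \<Rightarrow> ('i \<Rightarrow> 'i \<Rightarrow> 'i \<Rightarrow> real) \<Rightarrow> real ^ 'i \<Rightarrow> real ^ 'i" where
  "r_fun \<beta> \<gamma> x = (\<chi> i. \<beta> i / (2 * exp (2 * x $ i)) +
     (\<Sum>k\<in>UNIV. \<Sum>l\<in>UNIV. \<gamma> i k l * (exp (4 * x $ i) - 2 * exp (4 * x $ k)) /
        (4 * exp (2 * x $ i + 2 * x $ k + 2 * x $ l))))"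

definition R_fun :: "('i::finite \<Rightarrow> real) \<Rightarrow> ('i \<Rightarrow> 'i \<Rightarrow> 'i \<Rightarrow> real) \<Rightarrow> real ^ 'i \<Rightarrow> real" where
  "R_fun \<beta> \<gamma> x = (\<Sum>i\<in>UNIV. \<beta> i * exp (- 2 * x $ i)) +
     (\<Sum>i\<in>UNIV. \<Sum>j\<in>UNIV. \<Sum>k\<in>UNIV. \<gamma> i j k * exp (2 * x $ i - 2 * x $ j - 2 * x $ k))"

text \<open>The trace of the \<open>d \<times> d\<close> diagonal matrix in which \<open>v $ i\<close> is repeated \<open>d i\<close> times.\<close>

definition tr :: "('i::finite \<Rightarrow> nat) \<Rightarrow> real ^ 'i \<Rightarrow> real" where
  "tr d v = (\<Sum>i\<in>UNIV. real (d i) * v $ i)"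

abbreviation derivative_on :: "real set \<Rightarrow> (real \<Rightarrow> 'b::real_normed_vector) \<Rightarrow> real \<Rightarrow> 'b" where
  "derivative_on J f t \<equiv> vector_derivative f (at t within J)"

definition ode_solution ::
    "real set \<Rightarrow> ('i::finite \<Rightarrow> nat) \<Rightarrow> (real ^ 'i \<Rightarrow> real ^ 'i) \<Rightarrow> real \<Rightarrow> real \<Rightarrow> real \<Rightarrow>
     (real \<Rightarrow> real ^ 'i) \<Rightarrow> (real \<Rightarrow> real) \<Rightarrow> bool" where
  "ode_solution J d r h m lam y \<xi> \<longleftrightarrow>
     smooth_on_interval J y \<and> smooth_on_interval J \<xi> \<and>
     (\<forall>t\<in>J. let y' = derivative_on J y; y'' = derivative_on J y' in
        derivative_on J \<xi> t =
          - tr d (\<chi> i. (y' t $ i)^2) - m * (tr d (y' t) - \<xi> t)^2 - h^2 * lam \<and>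
        y'' t = - \<xi> t *\<^sub>R y' t + h^2 *\<^sub>R r (y t) - (h^2 * lam) *\<^sub>R (\<chi> i. 1))"

definition smoothly_extendable ::
    "real \<Rightarrow> (real \<Rightarrow> real ^ 'i::finite) \<Rightarrow> (real \<Rightarrow> real) \<Rightarrow> bool" where
  "smoothly_extendable T y \<xi> \<longleftrightarrow>
     (\<exists>Y \<Xi>. smooth_on_interval {0..T} Y \<and> smooth_on_interval {0..T} \<Xi> \<and>
        (\<forall>t\<in>{0<..T}. Y t = y t \<and> \<Xi> t = \<xi> t))"

definition M_fun :: "real set \<Rightarrow> ('i::finite \<Rightarrow> nat) \<Rightarrow> (real ^ 'i \<Rightarrow> real) \<Rightarrow>
    (real \<Rightarrow> real ^ 'i) \<Rightarrow> (real \<Rightarrow> real) \<Rightarrow> real \<Rightarrow> real" where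
  "M_fun J d R y \<xi> t =
     sqrt ((\<xi> t)^2 + (\<Sum>i\<in>UNIV. real (d i) * (derivative_on J y t $ i)^2) + R (y t))"

end

theory Submission
  imports Defs
begin

text \<open>The geometry enters through three facts: the numbers \<open>d\<^sub>i \<gamma>\<^sub>i\<^sub>k\<^sup>l\<close> are symmetric in all indices,
  \<open>\<beta>\<^sub>i \<ge> \<Sum>\<^sub>k\<^sub>l \<gamma>\<^sub>i\<^sub>k\<^sup>l\<close>, and \<open>d\<^sub>i \<ge> 2\<close>. The Riccati inequality
  \<open>\<xi>' \<le> - c \<xi>\<^sup>2 + const\<close> gives \<open>\<bar>\<xi>\<bar> \<le> C / t\<close>; integrating \<open>y'\<^sup>2 \<le> - \<xi>' + const\<close> shows that every \<open>y\<^sub>i\<close> has bounded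
  oscillation on \<open>[t, 2t]\<close>.

  Write \<open>X\<^sub>i = e\<^bsup>2y\<^sub>i\<^esup>\<close>. For the largest eigenvalue all terms of \<open>r\<^sub>i\<close> are nonnegative, and in general the negative
  terms of \<open>r\<^sub>i\<close> are dominated by terms belonging to larger eigenvalues. Hence a sum of the \<open>r\<^sub>i\<close>, with weights
  increasing rapidly along the order of the \<open>X\<^sub>i\<close>, controls the absolute values of all these terms. Comparison
  of the correspondingly weighted sum of the \<open>y\<^sub>i\<close> with a parabola bounds them by \<open>C / t\<^sup>2\<close> somewhere in \<open>[t, 2t]\<close>.

  This controls \<open>R\<close> except when some \<open>\<mm>\<^sub>i\<close> spans a collapsing torus, where the positive part of \<open>r\<^sub>i\<close> is negligible. Then \<open>y\<^sub>i'\<close> behaves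
  as in a Kasner metric, and \<open>d\<^sub>i \<ge> 2\<close> prevents \<open>X\<^sub>i\<close> from decaying faster than \<open>t\<^sup>2\<close>.\<close>

text \<open>The order of the eigenvalues changes with time, so no fixed weighted sum of the
  \<open>y i\<close> works. The maximum over finitely many weight vectors, one for each order,
  selects the right one by itself. Wherever a weight vector attains it, a smooth sum touches it from
  below, and this suffices for a second derivative test. The resulting bound holds at a single time
  of each \<open>[t, 2t]\<close> only; bounded oscillation carries eigenvalue bounds, up to
  constants, to the whole interval. Terms quadratic in \<open>y'\<close> are absorbed by adding a
  multiple of \<xi> to the quantity under study, which leaves a monotone function. The torus case is
  critical in the dimension. With a = t y_i', the monotone quantity used there has derivative at
  least 1/2 - a + d_i a^2 / 2 in logarithmic time, up to small errors. For d_i = 1 this lower bound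
  is (1 - a)^2 / 2; it vanishes at a = 1, the rate of X_i = t^2, so no error can be absorbed. For
  d_i >= 2 it is at least 1/4.\<close>

section \<open>Eigenvalues of the Ricci curvature\<close>

text \<open>The numerator is (u + v - w) (u - v + w), two of the factors in Heron's formula for a
  triangle with sides \<open>u\<close>, \<open>v\<close>, \<open>w\<close>. This is what a triple of
  metric eigenvalues contributes to the Ricci eigenvalue belonging to its first entry; it is
  negative exactly when \<open>u\<close> is smaller than the difference of the other two.\<close>

definition heron :: "real \<Rightarrow> real \<Rightarrow> real \<Rightarrow> real" where
  "heron u v w = (u\<^sup>2 - (v - w)\<^sup>2) / (4 * u * v * w)"

lemma heron_commute: "heron u v w = heron u w v"
  by (simp add: heron_def power2_commute mult_ac)

text \<open>The difference and the sum of the two numerators factor as 2 (u - v) (u + v - w) and 2 w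
  (u + v - w), which are nonnegative when \<open>u\<close> is the largest entry; the denominators
  agree.\<close>

lemma heron_max_ge:
  assumes "0 < u" "0 < v" "0 < w" "v \<le> u" "w \<le> u"
  shows "\<bar>heron v u w\<bar> \<le> heron u v w"
proof -
  have "v\<^sup>2 - (u - w)\<^sup>2 \<le> u\<^sup>2 - (v - w)\<^sup>2"
  proof -
    have "u\<^sup>2 - (v - w)\<^sup>2 - (v\<^sup>2 - (u - w)\<^sup>2) = 2 * ((u - v) * (u + v - w))"
      by (simp add: power2_eq_square algebra_simps)
    moreover have "(u - v) * (u + v - w) \<ge> 0" using assms by simp
    ultimately show ?thesis by linarith
  qed
  moreover have "- (v\<^sup>2 - (u - w)\<^sup>2) \<le> u\<^sup>2 - (v - w)\<^sup>2"
  proof -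
    have "u\<^sup>2 - (v - w)\<^sup>2 + (v\<^sup>2 - (u - w)\<^sup>2) = 2 * (w * (u + v - w))"
      by (simp add: power2_eq_square algebra_simps)
    moreover have "w * (u + v - w) \<ge> 0" using assms by simp
    ultimately show ?thesis by linarith
  qed
  ultimately have "\<bar>v\<^sup>2 - (u - w)\<^sup>2\<bar> \<le> u\<^sup>2 - (v - w)\<^sup>2" by linarith
  moreover have "\<bar>heron v u w\<bar> = \<bar>v\<^sup>2 - (u - w)\<^sup>2\<bar> / (4 * u * v * w)"
    using assms by (simp add: heron_def abs_mult mult_ac)
  ultimately show ?thesis
    using assms by (simp add: heron_def divide_right_mono mult.commute mult.left_commute)
qed

text \<open>By \<open>heron_max_ge\<close> each of the other two terms costs at most p/4 times the
  leading one; in the tied case it equals the leading one and costs nothing. This leaves p/2 of the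
  leading term, which is at least a third of the sum of absolute values: hence p/6. Ties serve
  triples in which an index is repeated.\<close>

lemma weighted_heron:
  assumes pos: "0 < u" "0 < v" "0 < w" and le: "v \<le> u" "w \<le> u"
    and wt: "0 < p" "0 < q" "0 < r"
    and q: "q \<le> p / 4 \<or> q = p \<and> v = u" and r: "r \<le> p / 4 \<or> r = p \<and> w = u"
  shows "p * heron u v w + q * heron v u w + r * heron w u v
    \<ge> p / 6 * (\<bar>heron u v w\<bar> + \<bar>heron v u w\<bar> + \<bar>heron w u v\<bar>)"
proof -
  let ?a = "heron u v w"
  have b: "\<bar>heron v u w\<bar> \<le> ?a" and c: "\<bar>heron w u v\<bar> \<le> ?a"
    using heron_max_ge[of u v w] heron_max_ge[of u w v] assms by (simp_all add: heron_commute)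
  have a0: "0 \<le> ?a" using b by linarith
  have aux: "s * x \<ge> - (p / 4) * ?a"
    if "\<bar>x\<bar> \<le> ?a" "0 < s" "s \<le> p / 4 \<or> s = p \<and> x = ?a" for s x
  proof (cases "s \<le> p / 4")
    case True
    have "\<bar>s * x\<bar> \<le> (p / 4) * ?a"
      unfolding abs_mult using that True by (intro mult_mono) auto
    then show ?thesis by linarith
  next
    case False
    then have "s * x = p * ?a" using that by auto
    moreover have "0 \<le> p * ?a" using a0 wt by simp
    ultimately show ?thesis by linarith
  qed
  have "q * heron v u w \<ge> - (p / 4) * ?a"
    using aux[OF b \<open>0 < q\<close>] q by auto
  moreover have "r * heron w u v \<ge> - (p / 4) * ?a"
    using aux[OF c \<open>0 < r\<close>] r by (auto simp: heron_commute)
  moreover have "p / 6 * (\<bar>?a\<bar> + \<bar>heron v u w\<bar> + \<bar>heron w u v\<bar>) \<le> p / 6 * (3 * ?a)"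
    using a0 b c wt by (intro mult_left_mono) auto
  ultimately show ?thesis by (simp add: field_simps)
qed

text \<open>If w <= v <= u, then u^2 - (v - w)^2 >= u^2 - (u - w)^2 >= u w, so the term of the
  largest entry is at least 1 / (4 v), with \<open>v\<close> the median. The maximum of any two of
  three numbers is at least their median.\<close>

lemma inverse_mid_le_heron:
  assumes "0 < u" "0 < v" "0 < w"
  shows "1 / (4 * max u v) \<le> \<bar>heron u v w\<bar> + \<bar>heron v u w\<bar> + \<bar>heron w u v\<bar>"
proof -
  have base: "1 / (4 * v) \<le> heron u v w" if "0 < u" "0 < v" "0 < w" "w \<le> v" "v \<le> u" for u v w
  proof -
    have "(v - w)\<^sup>2 \<le> (u - w)\<^sup>2" using that by (intro power_mono) auto
    then have "u * w \<le> u\<^sup>2 - (v - w)\<^sup>2"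
    proof -
      have "u\<^sup>2 - (u - w)\<^sup>2 - u * w = w * (u - w)" by (simp add: power2_eq_square algebra_simps)
      moreover have "w * (u - w) \<ge> 0" using that by simp
      ultimately show ?thesis using \<open>(v - w)\<^sup>2 \<le> (u - w)\<^sup>2\<close> by linarith
    qed
    then have "u * w / (4 * u * v * w) \<le> heron u v w"
      unfolding heron_def using that by (intro divide_right_mono) auto
    then show ?thesis using that by simp
  qed
  have shrink: "1 / (4 * max u v) \<le> 1 / (4 * x)" if "0 < x" "x \<le> max u v" for x
    using that by (intro divide_left_mono) auto
  consider "w \<le> v \<and> v \<le> u" | "w \<le> u \<and> u \<le> v" | "v \<le> w \<and> w \<le> u" | "u \<le> w \<and> w \<le> v"
    | "v \<le> u \<and> u \<le> w" | "u \<le> v \<and> v \<le> w" by linarith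
  then show ?thesis
  proof cases
    case 1 then show ?thesis using base[of u v w] shrink[of v] assms by simp
  next
    case 2 then show ?thesis using base[of v u w] shrink[of u] assms by simp
  next
    case 3 then show ?thesis using base[of u w v] shrink[of w] assms by (simp add: heron_commute)
  next
    case 4 then show ?thesis using base[of v w u] shrink[of w] assms by (simp add: heron_commute)
  next
    case 5 then show ?thesis using base[of w u v] shrink[of u] assms by simp
  next
    case 6 then show ?thesis using base[of w v u] shrink[of v] assms by (simp add: heron_commute)
  qed
qed

text \<open>If \<open>u\<close> is the largest, u / (v w) exceeds 4 times \<open>heron u v w\<close>
  by (v - w)^2 / (u v w), and |v - w| is at most \<open>u\<close> and at most v + w. Otherwise u <=
  v + w.\<close>

lemma ratio_le_heron:
  assumes "0 < u" "0 < v" "0 < w"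
  shows "u / (v * w) \<le> 4 * \<bar>heron u v w\<bar> + 1 / v + 1 / w"
proof (cases "v \<le> u \<and> w \<le> u")
  case True
  have "u\<^sup>2 - (u\<^sup>2 - (v - w)\<^sup>2) \<le> u * (v + w)"
  proof -
    have "\<bar>v - w\<bar> * \<bar>v - w\<bar> \<le> u * (v + w)"
      using True assms by (intro mult_mono) auto
    then show ?thesis by (simp add: power2_eq_square flip: abs_mult)
  qed
  then have "u\<^sup>2 \<le> (u\<^sup>2 - (v - w)\<^sup>2) + u * (v + w)" by linarith
  then have "u\<^sup>2 / (u * v * w) \<le> ((u\<^sup>2 - (v - w)\<^sup>2) + u * (v + w)) / (u * v * w)"
    using assms by (intro divide_right_mono) auto
  also have "\<dots> = 4 * heron u v w + 1 / v + 1 / w"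
    using assms by (simp add: heron_def field_simps)
  also have "u\<^sup>2 / (u * v * w) = u / (v * w)" using assms by (simp add: power2_eq_square)
  finally show ?thesis by linarith
next
  case False
  have "u / (v * w) \<le> (v + w) / (v * w)"
    using False assms by (intro divide_right_mono) auto
  also have "\<dots> = 1 / v + 1 / w" using assms by (simp add: field_simps)
  finally show ?thesis by linarith
qed

section \<open>Ricci eigenvalues in terms of the structure constants\<close>

locale structure_constants =
  fixes d :: "'i::finite \<Rightarrow> nat" and \<beta> :: "'i \<Rightarrow> real" and \<gamma> :: "'i \<Rightarrow> 'i \<Rightarrow> 'i \<Rightarrow> real"
  assumes d_ge: "d i \<ge> 2"
    and gamma_nonneg: "\<gamma> i k l \<ge> 0"
    and gamma_swap: "d i * \<gamma> i k l = d k * \<gamma> k i l"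
    and gamma_commute: "\<gamma> i k l = \<gamma> i l k"
    and beta_ge: "\<beta> i \<ge> (\<Sum>k\<in>UNIV. \<Sum>l\<in>UNIV. \<gamma> i k l)"
begin

text \<open>By the classical identity \<open>\<beta>\<^sub>i = 2 c\<^sub>i + \<Sum>\<^sub>k\<^sub>l \<gamma>\<^sub>i\<^sub>k\<^sup>l\<close>, this is the eigenvalue \<open>c\<^sub>i\<close> of the Casimir operator of the
  isotropy algebra on \<open>\<mm>\<^sub>i\<close>.\<close>

definition casimir :: "'i \<Rightarrow> real" where
  "casimir i = (\<beta> i - (\<Sum>k\<in>UNIV. \<Sum>l\<in>UNIV. \<gamma> i k l)) / 2"

text \<open>The absolute values stand inside the sums, so that a bound controls every term of every
  \<open>ric X i\<close> separately.\<close>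

definition abs_ricci :: "('i \<Rightarrow> real) \<Rightarrow> real" where
  "abs_ricci X = (\<Sum>i\<in>UNIV. casimir i / X i) +
     (\<Sum>i\<in>UNIV. \<Sum>k\<in>UNIV. \<Sum>l\<in>UNIV. \<gamma> i k l * \<bar>heron (X i) (X k) (X l)\<bar>)"

definition ric :: "('i \<Rightarrow> real) \<Rightarrow> 'i \<Rightarrow> real" where
  "ric X i = casimir i / X i + (\<Sum>k\<in>UNIV. \<Sum>l\<in>UNIV. \<gamma> i k l * heron (X i) (X k) (X l))"

definition R_diag :: "('i \<Rightarrow> real) \<Rightarrow> real" where
  "R_diag X = (\<Sum>i\<in>UNIV. \<beta> i / X i) +
     (\<Sum>i\<in>UNIV. \<Sum>k\<in>UNIV. \<Sum>l\<in>UNIV. \<gamma> i k l * (X i / (X k * X l)))"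

lemma casimir_nonneg: "casimir i \<ge> 0"
  using beta_ge[of i] by (simp add: casimir_def)

text \<open>A summand of \<open>r_fun\<close> differs from its \<open>heron\<close> form by -1 / (2
  X_i), which turns \<beta> into twice the Casimir eigenvalue, and by a term antisymmetric in
  \<open>k\<close> and \<open>l\<close>, which cancels in the sum because \<gamma> is symmetric in
  them.\<close>

lemma r_fun_eq_ric: "r_fun \<beta> \<gamma> x $ i = ric (\<lambda>i. exp (2 * x $ i)) i"
proof -
  define X where "X = (\<lambda>i. exp (2 * x $ i))"
  have X: "X i > 0" for i by (simp add: X_def)
  have e4: "exp (4 * x $ i) = (X i)\<^sup>2" for i
    by (simp add: X_def power2_eq_square flip: exp_add)
  have e3: "exp (2 * x $ i + 2 * x $ k + 2 * x $ l) = X i * X k * X l" for k l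
    by (simp add: X_def exp_add)
  have X2: "2 * exp (2 * x $ i) = 2 * X i" for i by (simp add: X_def)
  have split: "\<gamma> i k l * ((X i)\<^sup>2 - 2 * (X k)\<^sup>2) / (4 * (X i * X k * X l))
      = \<gamma> i k l * heron (X i) (X k) (X l) - \<gamma> i k l / (2 * X i)
        + (\<gamma> i k l * ((X l)\<^sup>2 - (X k)\<^sup>2) / (4 * (X i * X k * X l)))" for k l
    using X[of i] X[of k] X[of l] by (simp add: heron_def field_simps power2_eq_square)
  have flip: "\<gamma> i l k * ((X k)\<^sup>2 - (X l)\<^sup>2) / (4 * (X i * X l * X k)) =
     - (\<gamma> i k l * ((X l)\<^sup>2 - (X k)\<^sup>2) / (4 * (X i * X k * X l)))" for k l
    by (simp add: gamma_commute[of i l k] minus_divide_left mult_ac right_diff_distrib)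
  have "(\<Sum>k\<in>UNIV. \<Sum>l\<in>UNIV. \<gamma> i k l * ((X l)\<^sup>2 - (X k)\<^sup>2) / (4 * (X i * X k * X l))) =
     (\<Sum>k\<in>UNIV. \<Sum>l\<in>UNIV. \<gamma> i l k * ((X k)\<^sup>2 - (X l)\<^sup>2) / (4 * (X i * X l * X k)))"
    by (rule sum.swap)
  also have "\<dots> = - (\<Sum>k\<in>UNIV. \<Sum>l\<in>UNIV. \<gamma> i k l * ((X l)\<^sup>2 - (X k)\<^sup>2) / (4 * (X i * X k * X l)))"
    unfolding sum_negf[symmetric] by (intro sum.cong refl flip)
  finally have zero: "(\<Sum>k\<in>UNIV. \<Sum>l\<in>UNIV. \<gamma> i k l * ((X l)\<^sup>2 - (X k)\<^sup>2) / (4 * (X i * X k * X l))) = 0"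
    by linarith
  have "r_fun \<beta> \<gamma> x $ i = \<beta> i / (2 * X i)
      + (\<Sum>k\<in>UNIV. \<Sum>l\<in>UNIV. \<gamma> i k l * ((X i)\<^sup>2 - 2 * (X k)\<^sup>2) / (4 * (X i * X k * X l)))"
    unfolding r_fun_def by (simp only: vec_lambda_beta e4 e3 X2)
  also have "\<dots> = \<beta> i / (2 * X i) + (\<Sum>k\<in>UNIV. \<Sum>l\<in>UNIV. \<gamma> i k l * heron (X i) (X k) (X l))
      - (\<Sum>k\<in>UNIV. \<Sum>l\<in>UNIV. \<gamma> i k l / (2 * X i))"
    unfolding split sum.distrib sum_subtractf zero by simp
  also have "\<dots> = ric X i"
    unfolding ric_def casimir_def sum_divide_distrib[symmetric] by (simp add: diff_divide_distrib)
  finally show ?thesis by (simp add: X_def)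
qed

text \<open>The weights decrease so fast along the order of the metric eigenvalues that the negative part of
  each summand is absorbed by the contribution of the largest eigenvalue of its triple.\<close>

lemma weighted_ric_ge:
  fixes D :: real
  assumes X: "\<And>i. X i > 0"
    and D: "\<And>i. d i \<le> D"
    and ge: "\<And>i. \<omega> i \<ge> 1"
    and sep: "\<And>i j. i \<noteq> j \<Longrightarrow> \<omega> i \<le> \<omega> j \<Longrightarrow> 4 * D * \<omega> i \<le> \<omega> j \<and> X i \<le> X j"
  shows "(\<Sum>i\<in>UNIV. \<omega> i * ric X i) \<ge> abs_ricci X / (6 * D)"
proof -
  have dpos: "real (d i) > 0" for i using d_ge[of i] by simp
  have d1: "real (d i) \<ge> 2" for i using d_ge[of i] by simp
  have D2: "D \<ge> 2" using order_trans[OF d1 D] .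
  \<comment> \<open>Dividing the weights by \<open>d i\<close> replaces \<gamma> by
    \<open>B\<close>, which is symmetric in all three indices. The sum can then be averaged over the
    three positions in a triple, where \<open>weighted_heron\<close> applies.\<close>
  define p where "p i = \<omega> i / d i" for i
  define B where "B i k l = d i * \<gamma> i k l" for i k l
  let ?h = "\<lambda>i k l. heron (X i) (X k) (X l)"
  have Bnn: "B i k l \<ge> 0" for i k l using gamma_nonneg[of i k l] by (simp add: B_def)
  have B1: "B i k l = B k i l" for i k l using gamma_swap[of i k l] by (simp add: B_def)
  have B2: "B i k l = B i l k" for i k l using gamma_commute[of i k l] by (simp add: B_def)
  have B3: "B i k l = B l i k" for i k l using B1[of i l k] B2[of i k l] by simp
  have p_pos: "p i > 0" for i using ge[of i] dpos[of i] by (simp add: p_def)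
  have p_ge: "p i \<ge> 1 / D" for i
  proof -
    have "1 / D \<le> 1 / d i" using D[of i] dpos[of i] by (intro divide_left_mono) auto
    also have "\<dots> \<le> p i" unfolding p_def using ge[of i] dpos[of i] by (intro divide_right_mono) auto
    finally show ?thesis .
  qed
  \<comment> \<open>The gap 4 D between weights leaves a gap of at least 4 after the division by
    \<open>d i <= D\<close>. Equality of weights arises here from i = j.\<close>
  have p_sep: "(p j \<le> p i / 4 \<or> p j = p i \<and> X j = X i) \<and> X j \<le> X i" if "\<omega> j \<le> \<omega> i" for i j
  proof (cases "i = j")
    case False
    have "4 * d i * \<omega> j \<le> 4 * D * \<omega> j" using D[of i] ge[of j] by simp
    also have "\<dots> \<le> \<omega> i" using sep[of j i] that False by auto
    finally have "\<omega> j \<le> p i / 4" using dpos[of i] by (simp add: p_def field_simps)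
    moreover have "p j \<le> \<omega> j" unfolding p_def using d1[of j] ge[of j]
      by (simp add: field_simps)
    ultimately show ?thesis using sep[of j i] that False by auto
  qed auto
  define tri where "tri i k l = p i * ?h i k l + p k * ?h k i l + p l * ?h l i k" for i k l
  define mass where "mass i k l = \<bar>?h i k l\<bar> + \<bar>?h k i l\<bar> + \<bar>?h l i k\<bar>" for i k l
  have top: "tri i k l \<ge> mass i k l / (6 * D)" if "\<omega> k \<le> \<omega> i" "\<omega> l \<le> \<omega> i" for i k l
  proof -
    have "tri i k l \<ge> p i / 6 * mass i k l"
      unfolding tri_def mass_def using p_sep[OF that(1)] p_sep[OF that(2)] X p_pos
      by (intro weighted_heron) auto
    moreover have "(1 / D) / 6 * mass i k l \<le> p i / 6 * mass i k l"
      using p_ge[of i] by (intro mult_right_mono divide_right_mono) (auto simp: mass_def)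
    ultimately show ?thesis by simp
  qed
  have tri: "tri i k l \<ge> mass i k l / (6 * D)" for i k l
  proof -
    have s1: "tri i k l = tri k i l" "mass i k l = mass k i l"
      by (simp_all add: tri_def mass_def heron_commute)
    have s2: "tri i k l = tri l i k" "mass i k l = mass l i k"
      by (simp_all add: tri_def mass_def heron_commute)
    consider "\<omega> k \<le> \<omega> i \<and> \<omega> l \<le> \<omega> i" | "\<omega> i \<le> \<omega> k \<and> \<omega> l \<le> \<omega> k" | "\<omega> i \<le> \<omega> l \<and> \<omega> k \<le> \<omega> l"
      by linarith
    then show ?thesis
    proof cases
      case 1 then show ?thesis using top[of k i l] by simp
    next
      case 2 then show ?thesis unfolding s1 using top[of i k l] by simp
    next
      case 3 then show ?thesis unfolding s2 using top[of i l k] by simp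
    qed
  qed
  let ?S = "\<lambda>f. \<Sum>i\<in>UNIV. \<Sum>k\<in>UNIV. \<Sum>l\<in>(UNIV::'i set). f i k l"
  have perm1: "?S f = ?S (\<lambda>i k l. f k i l)" for f :: "'i \<Rightarrow> 'i \<Rightarrow> 'i \<Rightarrow> real"
    by (rule sum.swap)
  have perm2: "?S f = ?S (\<lambda>i k l. f i l k)" for f :: "'i \<Rightarrow> 'i \<Rightarrow> 'i \<Rightarrow> real"
    by (rule sum.cong[OF refl], rule sum.swap)
  have perm3: "?S f = ?S (\<lambda>i k l. f l i k)" for f :: "'i \<Rightarrow> 'i \<Rightarrow> 'i \<Rightarrow> real"
    using perm1[of f] perm2[of "\<lambda>i k l. f k i l"] by (simp only:)
  have sym3: "?S (\<lambda>i k l. B i k l * (f i k l + f k i l + f l i k)) = 3 * ?S (\<lambda>i k l. B i k l * f i k l)"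
    for f :: "'i \<Rightarrow> 'i \<Rightarrow> 'i \<Rightarrow> real"
  proof -
    have "?S (\<lambda>i k l. B i k l * f k i l) = ?S (\<lambda>i k l. B i k l * f i k l)"
      by (subst perm1) (simp add: B1)
    moreover have "?S (\<lambda>i k l. B i k l * f l i k) = ?S (\<lambda>i k l. B l i k * f l i k)"
      by (simp only: B3)
    then have "?S (\<lambda>i k l. B i k l * f l i k) = ?S (\<lambda>i k l. B i k l * f i k l)"
      using perm3[of "\<lambda>i k l. B i k l * f i k l"] by simp
    ultimately show ?thesis by (simp add: distrib_left sum.distrib)
  qed
  have tri_sum: "3 * ?S (\<lambda>i k l. B i k l * (p i * ?h i k l)) = ?S (\<lambda>i k l. B i k l * tri i k l)"
    using sym3[of "\<lambda>i k l. p i * ?h i k l"] by (simp add: tri_def)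
  have mass_sum: "3 * ?S (\<lambda>i k l. B i k l * \<bar>?h i k l\<bar>) = ?S (\<lambda>i k l. B i k l * mass i k l)"
    using sym3[of "\<lambda>i k l. \<bar>?h i k l\<bar>"] by (simp add: mass_def)
  have "?S (\<lambda>i k l. B i k l * (mass i k l / (6 * D))) \<le> ?S (\<lambda>i k l. B i k l * tri i k l)"
    by (intro sum_mono mult_left_mono tri Bnn)
  then have main: "?S (\<lambda>i k l. B i k l * \<bar>?h i k l\<bar>) / (6 * D) \<le> ?S (\<lambda>i k l. B i k l * (p i * ?h i k l))"
  proof -
    have "?S (\<lambda>i k l. B i k l * (mass i k l / (6 * D))) = ?S (\<lambda>i k l. B i k l * mass i k l) / (6 * D)"
      by (simp add: sum_divide_distrib)
    then have "3 * ?S (\<lambda>i k l. B i k l * \<bar>?h i k l\<bar>) / (6 * D) \<le> 3 * ?S (\<lambda>i k l. B i k l * (p i * ?h i k l))"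
      using \<open>?S (\<lambda>i k l. B i k l * (mass i k l / (6 * D))) \<le> _\<close> unfolding tri_sum mass_sum by simp
    then show ?thesis by linarith
  qed
  have Bp: "B i k l * (p i * ?h i k l) = \<omega> i * (\<gamma> i k l * ?h i k l)" for i k l
    using dpos[of i] by (simp add: B_def p_def)
  have "\<gamma> i k l \<le> B i k l" for i k l
    unfolding B_def using mult_right_mono[of 1 "real (d i)" "\<gamma> i k l"] d1[of i] gamma_nonneg[of i k l] by simp
  then have "?S (\<lambda>i k l. \<gamma> i k l * \<bar>?h i k l\<bar>) / (6 * D) \<le> ?S (\<lambda>i k l. B i k l * \<bar>?h i k l\<bar>) / (6 * D)"
    using D2 by (intro divide_right_mono sum_mono mult_right_mono) auto
  also note main
  also have "?S (\<lambda>i k l. B i k l * (p i * ?h i k l))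
      = (\<Sum>i\<in>UNIV. \<omega> i * (\<Sum>k\<in>UNIV. \<Sum>l\<in>UNIV. \<gamma> i k l * ?h i k l))"
    unfolding sum_distrib_left by (simp only: Bp)
  finally have part2: "?S (\<lambda>i k l. \<gamma> i k l * \<bar>?h i k l\<bar>) / (6 * D) \<le>
    (\<Sum>i\<in>UNIV. \<omega> i * (\<Sum>k\<in>UNIV. \<Sum>l\<in>UNIV. \<gamma> i k l * ?h i k l))" .
  have "casimir i / X i / (6 * D) \<le> \<omega> i * (casimir i / X i)" for i
  proof -
    have c: "casimir i / X i \<ge> 0" using X[of i] casimir_nonneg[of i] by simp
    have "casimir i / X i / (6 * D) \<le> casimir i / X i / 1" using D2 c by (intro divide_left_mono) auto
    also have "\<dots> \<le> \<omega> i * (casimir i / X i)" using mult_right_mono[OF ge[of i] c] by simp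
    finally show ?thesis .
  qed
  then have "(\<Sum>i\<in>UNIV. casimir i / X i) / (6 * D) \<le> (\<Sum>i\<in>UNIV. \<omega> i * (casimir i / X i))"
    unfolding sum_divide_distrib by (intro sum_mono)
  then show ?thesis using part2
    by (simp add: abs_ricci_def ric_def distrib_left sum.distrib add_divide_distrib)
qed

lemma R_fun_eq_R_diag: "R_fun \<beta> \<gamma> x = R_diag (\<lambda>i. exp (2 * x $ i))"
  unfolding R_fun_def R_diag_def
  by (simp add: exp_diff exp_minus divide_inverse mult.assoc)

lemma beta_nonneg: "\<beta> i \<ge> 0"
  using beta_ge[of i] gamma_nonneg by (meson order_trans sum_nonneg)

lemma triple_le_sum:
  fixes f :: "'i \<Rightarrow> 'i \<Rightarrow> 'i \<Rightarrow> real"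
  assumes "\<And>i k l. f i k l \<ge> 0"
  shows "f i k l \<le> (\<Sum>i\<in>UNIV. \<Sum>k\<in>UNIV. \<Sum>l\<in>UNIV. f i k l)"
proof -
  have "f i k l \<le> (\<Sum>l\<in>UNIV. f i k l)"
    by (rule member_le_sum) (use assms in auto)
  also have "\<dots> \<le> (\<Sum>k\<in>UNIV. \<Sum>l\<in>UNIV. f i k l)"
    by (rule member_le_sum[where f = "\<lambda>k. \<Sum>l\<in>UNIV. f i k l"]) (use assms in \<open>auto intro!: sum_nonneg\<close>)
  also have "\<dots> \<le> (\<Sum>i\<in>UNIV. \<Sum>k\<in>UNIV. \<Sum>l\<in>UNIV. f i k l)"
    by (rule member_le_sum[where f = "\<lambda>i. \<Sum>k\<in>UNIV. \<Sum>l\<in>UNIV. f i k l"])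
       (use assms in \<open>auto intro!: sum_nonneg\<close>)
  finally show ?thesis .
qed

lemma gamma_le_beta: "\<gamma> i k l \<le> \<beta> i"
proof -
  have "\<gamma> i k l \<le> (\<Sum>l\<in>UNIV. \<gamma> i k l)"
    by (rule member_le_sum) (use gamma_nonneg in auto)
  also have "\<dots> \<le> (\<Sum>k\<in>UNIV. \<Sum>l\<in>UNIV. \<gamma> i k l)"
    by (rule member_le_sum[where f = "\<lambda>k. \<Sum>l\<in>UNIV. \<gamma> i k l"]) (use gamma_nonneg in \<open>auto intro!: sum_nonneg\<close>)
  finally show ?thesis using beta_ge[of i] by simp
qed

text \<open>Since \<open>d i * \<gamma> i k l\<close> is symmetric and 1 <= d i <= D, permuting the
  indices of \<gamma> costs at most the factor D.\<close>

lemma gamma_le_swap: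
  fixes D :: real
  assumes "\<And>i. d i \<le> D"
  shows "\<gamma> i k l \<le> D * \<gamma> k i l" "\<gamma> i k l \<le> D * \<gamma> l i k"
proof -
  have *: "\<gamma> i k l \<le> D * \<gamma> k i l" for i k l
  proof -
    have "1 * \<gamma> i k l \<le> d i * \<gamma> i k l"
      using d_ge[of i] gamma_nonneg by (intro mult_right_mono) auto
    also have "\<dots> = d k * \<gamma> k i l" by (rule gamma_swap)
    also have "\<dots> \<le> D * \<gamma> k i l" using assms gamma_nonneg by (intro mult_right_mono) auto
    finally show ?thesis by simp
  qed
  show "\<gamma> i k l \<le> D * \<gamma> k i l" by (rule *)
  show "\<gamma> i k l \<le> D * \<gamma> l i k" using *[of i l k] gamma_commute[of i k l] by simp
qed

lemma casimir_le_abs_ricci: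
  assumes "\<And>i. X i > 0"
  shows "casimir i / X i \<le> abs_ricci X"
proof -
  have "casimir i / X i \<le> (\<Sum>i\<in>UNIV. casimir i / X i)"
    by (rule member_le_sum) (use assms casimir_nonneg in \<open>auto intro!: divide_nonneg_nonneg intro: less_imp_le\<close>)
  moreover have "0 \<le> (\<Sum>i\<in>UNIV. \<Sum>k\<in>UNIV. \<Sum>l\<in>UNIV. \<gamma> i k l * \<bar>heron (X i) (X k) (X l)\<bar>)"
    using gamma_nonneg by (intro sum_nonneg) auto
  ultimately show ?thesis by (simp add: abs_ricci_def)
qed

lemma heron_le_abs_ricci:
  assumes "\<And>i. X i > 0"
  shows "\<gamma> i k l * \<bar>heron (X i) (X k) (X l)\<bar> \<le> abs_ricci X"
proof -
  have "\<gamma> i k l * \<bar>heron (X i) (X k) (X l)\<bar>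
      \<le> (\<Sum>i\<in>UNIV. \<Sum>k\<in>UNIV. \<Sum>l\<in>UNIV. \<gamma> i k l * \<bar>heron (X i) (X k) (X l)\<bar>)"
    by (rule triple_le_sum) (use gamma_nonneg in auto)
  moreover have "0 \<le> (\<Sum>i\<in>UNIV. casimir i / X i)"
    using casimir_nonneg assms by (intro sum_nonneg) (auto intro!: divide_nonneg_nonneg intro: less_imp_le)
  ultimately show ?thesis by (simp add: abs_ricci_def)
qed

lemma abs_ricci_nonneg:
  assumes "\<And>i. X i > 0"
  shows "0 \<le> abs_ricci X"
  using heron_le_abs_ricci[OF assms] gamma_nonneg by (meson abs_ge_zero mult_nonneg_nonneg order_trans)

text \<open>Two small eigenvalues in a triple with positive coefficient force a large
  \<open>abs_ricci\<close>. The constant is 4 from \<open>inverse_mid_le_heron\<close>, times 3 for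
  the positions in the triple, times D for permuting indices.\<close>

lemma inverse_max_le_abs_ricci:
  fixes D :: real
  assumes X: "\<And>i. X i > 0" and D: "\<And>i. d i \<le> D"
  shows "\<gamma> i k l / max (X i) (X k) \<le> 12 * D * abs_ricci X"
proof -
  have D1: "D \<ge> 1" using D[of i] d_ge[of i] by simp
  let ?h = "\<lambda>i k l. \<bar>heron (X i) (X k) (X l)\<bar>"
  have swap: "\<gamma> i k l * \<bar>h\<bar> \<le> D * abs_ricci X" if "\<gamma> i k l \<le> D * g" "g * \<bar>h\<bar> \<le> abs_ricci X" for g h
  proof -
    have "\<gamma> i k l * \<bar>h\<bar> \<le> D * (g * \<bar>h\<bar>)" using mult_right_mono[OF that(1), of "\<bar>h\<bar>"] by (simp add: mult_ac)
    also have "\<dots> \<le> D * abs_ricci X" using that D1 by (intro mult_left_mono) auto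
    finally show ?thesis .
  qed
  have "\<gamma> i k l * ?h i k l \<le> D * abs_ricci X"
    using heron_le_abs_ricci[of X i k l, OF X] mult_right_mono[OF D1 abs_ricci_nonneg[of X, OF X]] by simp
  moreover have "\<gamma> i k l * ?h k i l \<le> D * abs_ricci X"
    by (rule swap[OF gamma_le_swap(1)[OF D] heron_le_abs_ricci[OF X]])
  moreover have "\<gamma> i k l * ?h l i k \<le> D * abs_ricci X"
    by (rule swap[OF gamma_le_swap(2)[OF D] heron_le_abs_ricci[OF X]])
  ultimately have "\<gamma> i k l * (?h i k l + ?h k i l + ?h l i k) \<le> 3 * D * abs_ricci X"
    by (simp add: distrib_left)
  moreover have "\<gamma> i k l * (1 / (4 * max (X i) (X k))) \<le> \<gamma> i k l * (?h i k l + ?h k i l + ?h l i k)"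
    by (intro mult_left_mono inverse_mid_le_heron X gamma_nonneg)
  ultimately show ?thesis by simp
qed

text \<open>As u^2 - (v - w)^2 is at most u^2 + v^2 + w^2 in absolute value, a \<open>heron\<close>
  term is bounded by the three ratios of its triple, and these occur in \<open>R_diag\<close> with
  permuted coefficients. A bound for \<open>R_diag\<close> thus bounds the curvature term in the
  equation for \<open>y''\<close>.\<close>

lemma abs_ric_le_R_diag: "\<exists>C>0. \<forall>X i. (\<forall>i. X i > 0) \<longrightarrow> \<bar>ric X i\<bar> \<le> C * R_diag X"
proof -
  define D where "D = real (\<Sum>i\<in>UNIV. d i)"
  have D: "d i \<le> D" for i unfolding D_def of_nat_le_iff by (rule member_le_sum) auto
  have D1: "D \<ge> 1" using D d_ge by (meson numeral_le_real_of_nat_iff one_le_numeral order_trans)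
  define n where "n = real CARD('i)"
  have "\<bar>ric X i\<bar> \<le> (1 + n * (n * (3 * D))) * R_diag X" if X: "\<forall>i. X i > 0" for X i
  proof -
    let ?q = "\<lambda>i k l. X i / (X k * X l)"
    have sb: "0 \<le> (\<Sum>i\<in>UNIV. \<beta> i / X i)"
      using beta_nonneg X by (intro sum_nonneg) (auto intro!: divide_nonneg_nonneg intro: less_imp_le)
    have sg: "0 \<le> (\<Sum>i\<in>UNIV. \<Sum>k\<in>UNIV. \<Sum>l\<in>UNIV. \<gamma> i k l * ?q i k l)"
      using gamma_nonneg X by (intro sum_nonneg mult_nonneg_nonneg) (auto intro!: divide_nonneg_nonneg intro: less_imp_le)
    have r0: "R_diag X \<ge> 0" using sb sg by (simp add: R_diag_def)
    have b: "\<beta> i / X i \<le> R_diag X" for i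
    proof -
      have "\<beta> i / X i \<le> (\<Sum>i\<in>UNIV. \<beta> i / X i)"
        by (rule member_le_sum) (use beta_nonneg X in \<open>auto intro!: divide_nonneg_nonneg intro: less_imp_le\<close>)
      then show ?thesis using sg by (simp add: R_diag_def)
    qed
    have g: "\<gamma> i k l * ?q i k l \<le> R_diag X" for i k l
    proof -
      have "\<gamma> i k l * ?q i k l \<le> (\<Sum>i\<in>UNIV. \<Sum>k\<in>UNIV. \<Sum>l\<in>UNIV. \<gamma> i k l * ?q i k l)"
        by (rule triple_le_sum) (use gamma_nonneg X in \<open>auto intro!: mult_nonneg_nonneg divide_nonneg_nonneg intro: less_imp_le\<close>)
      then show ?thesis using sb by (simp add: R_diag_def)
    qed
    have h: "\<gamma> i k l * \<bar>heron (X i) (X k) (X l)\<bar> \<le> 3 * D * R_diag X" for k l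
    proof -
      have pos: "0 < X i" "0 < X k" "0 < X l" using X by auto
      have "\<bar>(X i)\<^sup>2 - (X k - X l)\<^sup>2\<bar> \<le> (X i)\<^sup>2 + (X k)\<^sup>2 + (X l)\<^sup>2"
      proof -
        have "(X k - X l)\<^sup>2 \<le> (X k)\<^sup>2 + (X l)\<^sup>2" using pos by (simp add: power2_diff)
        moreover have "0 \<le> (X i)\<^sup>2" "0 \<le> (X k - X l)\<^sup>2" by auto
        ultimately show ?thesis by linarith
      qed
      then have "\<bar>heron (X i) (X k) (X l)\<bar> \<le> ((X i)\<^sup>2 + (X k)\<^sup>2 + (X l)\<^sup>2) / (4 * X i * X k * X l)"
        unfolding heron_def abs_divide using pos by (simp add: abs_mult divide_right_mono)
      also have "\<dots> \<le> ((X i)\<^sup>2 + (X k)\<^sup>2 + (X l)\<^sup>2) / (X i * X k * X l)"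
        using pos by (intro divide_left_mono) auto
      also have "\<dots> = ?q i k l + ?q k i l + ?q l i k"
        using pos by (simp add: field_simps power2_eq_square)
      finally have "\<gamma> i k l * \<bar>heron (X i) (X k) (X l)\<bar> \<le> \<gamma> i k l * (?q i k l + ?q k i l + ?q l i k)"
        by (intro mult_left_mono gamma_nonneg)
      moreover have swap: "\<gamma> i k l * q \<le> D * R_diag X" if "\<gamma> i k l \<le> D * c" "c * q \<le> R_diag X" "0 \<le> q" for c q
      proof -
        have "\<gamma> i k l * q \<le> D * (c * q)" using mult_right_mono[OF that(1,3)] by (simp add: mult_ac)
        also have "\<dots> \<le> D * R_diag X" using that D1 by (intro mult_left_mono) auto
        finally show ?thesis .
      qed
      have "\<gamma> i k l * ?q k i l \<le> D * R_diag X"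
        by (rule swap[OF gamma_le_swap(1)[OF D] g]) (use pos in auto)
      moreover have "\<gamma> i k l * ?q l i k \<le> D * R_diag X"
        by (rule swap[OF gamma_le_swap(2)[OF D] g]) (use pos in auto)
      moreover have "\<gamma> i k l * ?q i k l \<le> D * R_diag X"
        using g[of i k l] mult_right_mono[OF D1 r0] by simp
      ultimately show ?thesis by (simp add: distrib_left)
    qed
    have "\<bar>casimir i / X i\<bar> \<le> R_diag X"
    proof -
      have "0 \<le> (\<Sum>k\<in>UNIV. \<Sum>l\<in>UNIV. \<gamma> i k l)" by (intro sum_nonneg gamma_nonneg)
      then have "casimir i \<le> \<beta> i" using beta_nonneg[of i] by (simp add: casimir_def)
      then have "casimir i / X i \<le> \<beta> i / X i" using X by (intro divide_right_mono) (auto intro!: divide_nonneg_nonneg intro: less_imp_le)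
      moreover have "0 \<le> casimir i / X i" using casimir_nonneg X by (auto intro!: divide_nonneg_nonneg intro: less_imp_le)
      ultimately show ?thesis using b[of i] by simp
    qed
    moreover have "\<bar>\<Sum>k\<in>UNIV. \<Sum>l\<in>UNIV. \<gamma> i k l * heron (X i) (X k) (X l)\<bar>
        \<le> (\<Sum>k\<in>(UNIV::'i set). \<Sum>l\<in>(UNIV::'i set). 3 * D * R_diag X)"
      by (rule order_trans[OF sum_abs], rule sum_mono, rule order_trans[OF sum_abs], rule sum_mono)
         (use h gamma_nonneg in \<open>simp add: abs_mult\<close>)
    moreover have "\<dots> = n * (n * (3 * D * R_diag X))" by (simp add: n_def)
    moreover have "\<bar>ric X i\<bar> \<le> \<bar>casimir i / X i\<bar> + \<bar>\<Sum>k\<in>UNIV. \<Sum>l\<in>UNIV. \<gamma> i k l * heron (X i) (X k) (X l)\<bar>"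
      unfolding ric_def by (rule abs_triangle_ineq)
    ultimately have "\<bar>ric X i\<bar> \<le> R_diag X + n * (n * (3 * D * R_diag X))" by linarith
    then show ?thesis by (simp add: algebra_simps)
  qed
  moreover have "1 + n * (n * (3 * D)) > 0" using D1 by (simp add: n_def add_pos_nonneg)
  ultimately show ?thesis by blast
qed

text \<open>Take the powers (4 D) ^ \<pi> i for all bijections \<pi> onto {0, ..., n-1}. By the
  rearrangement principle a maximizing weight vector is ordered like \<open>x\<close>: exchanging
  two wrongly ordered weights would increase the sum. The base 4 D is the gap that
  \<open>weighted_ric_ge\<close> requires.\<close>

lemma exists_weights:
  fixes D :: real
  assumes D: "D \<ge> 1"
  shows "\<exists>\<Omega> K. finite \<Omega> \<and> \<Omega> \<noteq> {} \<and> (\<forall>\<omega>\<in>\<Omega>. \<forall>i. 1 \<le> \<omega> i \<and> \<omega> i \<le> K) \<and>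
    (\<forall>\<omega>\<in>\<Omega>. \<forall>x::'i \<Rightarrow> real. (\<forall>\<omega>'\<in>\<Omega>. (\<Sum>i\<in>UNIV. \<omega>' i * x i) \<le> (\<Sum>i\<in>UNIV. \<omega> i * x i)) \<longrightarrow>
       (\<forall>i j. i \<noteq> j \<longrightarrow> \<omega> i \<le> \<omega> j \<longrightarrow> 4 * D * \<omega> i \<le> \<omega> j \<and> x i \<le> x j))"
proof -
  define n where "n = CARD('i)"
  define P where "P = {\<pi>::'i \<Rightarrow> nat. inj \<pi> \<and> range \<pi> \<subseteq> {..<n}}"
  define W where "W = (\<lambda>\<pi> (i::'i). (4 * D) ^ \<pi> i)"
  have "finite {\<pi>::'i \<Rightarrow> nat. range \<pi> \<subseteq> {..<n}}"
    using finite_set_of_finite_funs[of "UNIV::'i set" "{..<n}" undefined]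
    by (auto elim!: rev_finite_subset)
  then have fin: "finite P" by (rule rev_finite_subset) (auto simp: P_def)
  obtain \<pi>0 :: "'i \<Rightarrow> nat" where "bij_betw \<pi>0 UNIV {0..<n}"
    using ex_bij_betw_finite_nat[of "UNIV::'i set"] by (auto simp: n_def)
  then have "\<pi>0 \<in> P" by (auto simp: P_def bij_betw_def atLeast0LessThan)
  then have ne: "P \<noteq> {}" by auto
  have bounds: "1 \<le> W \<pi> i \<and> W \<pi> i \<le> (4 * D) ^ n" if "\<pi> \<in> P" for \<pi> i
  proof -
    have "\<pi> i < n" using that by (auto simp: P_def)
    moreover have "1 \<le> 4 * D" using D by simp
    ultimately show ?thesis
      using one_le_power[of "4 * D" "\<pi> i"] power_increasing[of "\<pi> i" n "4 * D"]
      unfolding W_def by simp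
  qed
  have sep: "4 * D * W \<pi> i \<le> W \<pi> j \<and> x i \<le> x j"
    if \<pi>: "\<pi> \<in> P" and mx: "\<And>\<pi>'. \<pi>' \<in> P \<Longrightarrow> (\<Sum>i\<in>UNIV. W \<pi>' i * x i) \<le> (\<Sum>i\<in>UNIV. W \<pi> i * x i)"
      and ij: "i \<noteq> j" "W \<pi> i \<le> W \<pi> j" for \<pi> i j and x :: "'i \<Rightarrow> real"
  proof -
    have "1 < 4 * D" using D by simp
    then have "\<pi> i \<le> \<pi> j" using ij(2) unfolding W_def by (rule power_le_imp_le_exp)
    moreover have "\<pi> i \<noteq> \<pi> j" using \<pi> ij(1) by (auto simp: P_def inj_def)
    ultimately have "Suc (\<pi> i) \<le> \<pi> j" by simp
    then have "(4 * D) ^ Suc (\<pi> i) \<le> (4 * D) ^ \<pi> j" using D by (intro power_increasing) auto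
    then have gap: "4 * D * W \<pi> i \<le> W \<pi> j" by (simp add: W_def)
    have "W \<pi> i > 0" using bounds[OF \<pi>, of i] by simp
    then have "W \<pi> i < 4 * D * W \<pi> i" using D by simp
    then have strict: "W \<pi> i < W \<pi> j" using gap by simp
    define \<pi>' where "\<pi>' = \<pi>(i := \<pi> j, j := \<pi> i)"
    have "\<pi> k < n" for k using \<pi> by (auto simp: P_def)
    then have "\<pi>' \<in> P" using \<pi> by (auto simp: P_def \<pi>'_def inj_def)
    then have "(\<Sum>k\<in>UNIV. W \<pi>' k * x k) \<le> (\<Sum>k\<in>UNIV. W \<pi> k * x k)" by (rule mx)
    then have "(\<Sum>k\<in>UNIV. (W \<pi>' k - W \<pi> k) * x k) \<le> 0"
      by (simp add: left_diff_distrib sum_subtractf)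
    also have "(\<Sum>k\<in>UNIV. (W \<pi>' k - W \<pi> k) * x k) = (\<Sum>k\<in>{i, j}. (W \<pi>' k - W \<pi> k) * x k)"
      by (rule sum.mono_neutral_right) (auto simp: W_def \<pi>'_def)
    also have "\<dots> = (W \<pi> j - W \<pi> i) * (x i - x j)"
      using ij(1) by (simp add: W_def \<pi>'_def algebra_simps)
    finally have "x i \<le> x j" using strict by (simp add: mult_le_0_iff)
    then show ?thesis using gap by simp
  qed
  have sep': "4 * D * \<omega> i \<le> \<omega> j \<and> x i \<le> x j"
    if "\<omega> \<in> W ` P" "\<forall>\<omega>'\<in>W ` P. (\<Sum>i\<in>UNIV. \<omega>' i * x i) \<le> (\<Sum>i\<in>UNIV. \<omega> i * x i)"
      "i \<noteq> j" "\<omega> i \<le> \<omega> j" for \<omega> i j and x :: "'i \<Rightarrow> real"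
    using that(1) by (rule imageE) (use that sep in blast)
  have "\<forall>\<omega>\<in>W ` P. \<forall>i. 1 \<le> \<omega> i \<and> \<omega> i \<le> (4 * D) ^ n"
    unfolding ball_simps using bounds by blast
  moreover have "finite (W ` P)" "W ` P \<noteq> {}" using fin ne by auto
  ultimately show ?thesis using sep' by (intro exI[of _ "W ` P"] exI[of _ "(4 * D) ^ n"]) blast
qed

end

section \<open>Estimates for the flow\<close>

lemma second_derivative_at_max:
  fixes f f1 :: "real \<Rightarrow> real"
  assumes c: "a < c" "c < b"
    and f: "\<And>x. a < x \<Longrightarrow> x < b \<Longrightarrow> (f has_real_derivative f1 x) (at x)"
    and f1: "(f1 has_real_derivative f2) (at c)"
    and max: "\<And>x. a < x \<Longrightarrow> x < b \<Longrightarrow> f x \<le> f c"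
  shows "f1 c = 0" "f2 \<le> 0"
proof -
  define e where "e = min (c - a) (b - c)"
  have e: "0 < e" using c by (simp add: e_def)
  show zero: "f1 c = 0"
  proof (rule DERIV_local_max[OF f[OF c] e], intro allI impI)
    fix x assume "\<bar>c - x\<bar> < e"
    then show "f x \<le> f c" using max[of x] by (auto simp: e_def abs_if split: if_splits)
  qed
  show "f2 \<le> 0"
  proof (rule ccontr)
    assume "\<not> f2 \<le> 0"
    then obtain r where r: "0 < r" "\<And>h. 0 < h \<Longrightarrow> h < r \<Longrightarrow> f1 c < f1 (c + h)"
      using DERIV_pos_inc_right[OF f1] by auto
    define x where "x = c + min r e / 2"
    have "0 < min r e" "min r e \<le> r" "min r e \<le> e" "e \<le> b - c" using r(1) e by (auto simp: e_def)
    then have x: "c < x" "x < c + r" "x < b" by (auto simp: x_def)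
    obtain z where z: "c < z" "z < x" "f x - f c = (x - c) * f1 z"
      using MVT2[of c x f f1] f c x by (metis less_trans order.strict_trans1 order.strict_trans2)
    have "f1 z > 0" using r(2)[of "z - c"] z x zero by simp
    then have "f x > f c" using z x by (smt (verit) mult_pos_pos)
    then show False using max[of x] x c by simp
  qed
qed

text \<open>\<open>H\<close> and \<open>\<Lambda>\<close> stand for \<open>h\<^sup>2\<close> and \<open>h\<^sup>2 \<lambda>\<close>.\<close>

locale quasi_einstein_flow = structure_constants d \<beta> \<gamma>
  for d :: "'i::finite \<Rightarrow> nat" and \<beta> \<gamma> +
  fixes y y1 :: "'i \<Rightarrow> real \<Rightarrow> real" and \<xi> :: "real \<Rightarrow> real" and T H \<Lambda> m :: real
  assumes T: "0 < T" "T \<le> 1" and H: "0 < H" and m: "0 < m"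
    and y: "0 < t \<Longrightarrow> t < T \<Longrightarrow> (y i has_real_derivative y1 i t) (at t)"
    and y1: "0 < t \<Longrightarrow> t < T \<Longrightarrow>
      (y1 i has_real_derivative - \<xi> t * y1 i t + H * ric (\<lambda>j. exp (2 * y j t)) i - \<Lambda>) (at t)"
    and xi: "0 < t \<Longrightarrow> t < T \<Longrightarrow> (\<xi> has_real_derivative
      - (\<Sum>i\<in>UNIV. d i * (y1 i t)\<^sup>2) - m * ((\<Sum>i\<in>UNIV. d i * y1 i t) - \<xi> t)\<^sup>2 - \<Lambda>) (at t)"
begin

abbreviation X :: "real \<Rightarrow> 'i \<Rightarrow> real" where
  "X t \<equiv> \<lambda>j. exp (2 * y j t)"

definition xi1 :: "real \<Rightarrow> real" where
  "xi1 t = - (\<Sum>i\<in>UNIV. d i * (y1 i t)\<^sup>2) - m * ((\<Sum>i\<in>UNIV. d i * y1 i t) - \<xi> t)\<^sup>2 - \<Lambda>"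

lemma xi': "0 < t \<Longrightarrow> t < T \<Longrightarrow> (\<xi> has_real_derivative xi1 t) (at t)"
  using xi by (simp add: xi1_def)

definition dim_total :: real where
  "dim_total = (\<Sum>i\<in>UNIV. d i)"

lemma d_le_total: "d i \<le> dim_total"
  unfolding dim_total_def of_nat_le_iff by (rule member_le_sum) auto

lemma total_ge: "dim_total \<ge> 2"
  using d_ge d_le_total by (meson numeral_le_real_of_nat_iff order_trans)

section \<open>Consequences of the equation for \<xi>\<close>

lemma xi1_le: "xi1 t \<le> - (d i * (y1 i t)\<^sup>2) + \<bar>\<Lambda>\<bar>"
proof -
  have "d i * (y1 i t)\<^sup>2 \<le> (\<Sum>i\<in>UNIV. d i * (y1 i t)\<^sup>2)"
    by (rule member_le_sum) auto
  moreover have "m * ((\<Sum>i\<in>UNIV. d i * y1 i t) - \<xi> t)\<^sup>2 \<ge> 0" using m by simp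
  ultimately show ?thesis unfolding xi1_def by linarith
qed

text \<open>A multiple of \<xi> added to a test function pays for a quadratic term in
  \<open>y1\<close>, as in \<open>y_osc\<close> and \<open>y1_bound\<close>. The precise factor 2
  matters in \<open>collapse_bound_casimir_zero\<close>.\<close>

lemma xi1_le': "xi1 t \<le> - 2 * (y1 i t)\<^sup>2 + \<bar>\<Lambda>\<bar>"
proof -
  have "2 * (y1 i t)\<^sup>2 \<le> d i * (y1 i t)\<^sup>2"
    using d_ge[of i] by (intro mult_right_mono) auto
  then show ?thesis using xi1_le[of t i] by simp
qed

lemma xi_almost_decreasing:
  assumes "0 < s" "s \<le> t" "t < T"
  shows "\<xi> t - \<bar>\<Lambda>\<bar> * t \<le> \<xi> s - \<bar>\<Lambda>\<bar> * s"
proof (rule DERIV_nonpos_imp_nonincreasing[of s t "\<lambda>t. \<xi> t - \<bar>\<Lambda>\<bar> * t"])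
  fix x assume x: "s \<le> x" "x \<le> t"
  have "((\<lambda>t. \<xi> t - \<bar>\<Lambda>\<bar> * t) has_real_derivative xi1 x - \<bar>\<Lambda>\<bar>) (at x)"
    using assms x by (auto intro!: derivative_eq_intros xi')
  \<comment> \<open>Any index will do, because the term it contributes is only discarded by its
    sign.\<close>
  moreover have "xi1 x - \<bar>\<Lambda>\<bar> \<le> 0" using xi1_le[of x undefined] by (smt (verit) mult_nonneg_nonneg of_nat_0_le_iff zero_le_power2)
  ultimately show "\<exists>z. ((\<lambda>t. \<xi> t - \<bar>\<Lambda>\<bar> * t) has_real_derivative z) (at x) \<and> z \<le> 0" by blast
qed fact

text \<open>The value at T/2 bounds \<xi> from below, by almost monotonicity. Unlike a bound of
  order 1/t, this makes t \<xi> greater than -1/2 for small t, as the torus argument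
  requires.\<close>

lemma xi_lower: "\<exists>C>0. \<forall>t. 0 < t \<longrightarrow> t \<le> T / 2 \<longrightarrow> - C \<le> \<xi> t"
proof -
  have "\<xi> t \<ge> \<xi> (T / 2) - \<bar>\<Lambda>\<bar>" if "0 < t" "t \<le> T / 2" for t
  proof -
    have "\<bar>\<Lambda>\<bar> * (T / 2 - t) \<le> \<bar>\<Lambda>\<bar> * 1"
      using that T by (intro mult_left_mono) auto
    then show ?thesis using xi_almost_decreasing[of t "T / 2"] that T by (simp add: algebra_simps)
  qed
  then show ?thesis
    by (intro exI[of _ "\<bar>\<xi> (T / 2)\<bar> + \<bar>\<Lambda>\<bar> + 1"]) (force simp: abs_if split: if_splits)
qed

text \<open>With s = tr y', the Cauchy-Schwarz inequality gives s^2 / dim_total for the first square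
  term, and \<xi>^2 / 2 <= s^2 + (s - \<xi>)^2. The positivity of \<open>m\<close> supplies the
  second square.\<close>

lemma riccati: "\<exists>c>0. \<forall>t. xi1 t \<le> - c * (\<xi> t)\<^sup>2 + \<bar>\<Lambda>\<bar>"
proof (intro exI conjI allI)
  define \<kappa> where "\<kappa> = min (1 / dim_total) m"
  have \<kappa>: "\<kappa> > 0" "\<kappa> \<le> 1 / dim_total" "\<kappa> \<le> m" using m total_ge by (auto simp: \<kappa>_def)
  show "\<kappa> / 2 > 0" using \<kappa> by simp
  fix t
  define s where "s = (\<Sum>i\<in>UNIV. d i * y1 i t)"
  have "s\<^sup>2 = (\<Sum>i\<in>UNIV. sqrt (d i) * (sqrt (d i) * y1 i t))\<^sup>2"
    by (simp add: s_def flip: mult.assoc)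
  also have "\<dots> \<le> (\<Sum>i\<in>UNIV. (sqrt (d i))\<^sup>2) * (\<Sum>i\<in>UNIV. (sqrt (d i) * y1 i t)\<^sup>2)"
    by (rule Cauchy_Schwarz_ineq_sum)
  also have "\<dots> = dim_total * (\<Sum>i\<in>UNIV. d i * (y1 i t)\<^sup>2)"
    by (simp add: power_mult_distrib dim_total_def)
  finally have "s\<^sup>2 / dim_total \<le> (\<Sum>i\<in>UNIV. d i * (y1 i t)\<^sup>2)"
    using total_ge by (simp add: divide_simps mult.commute)
  moreover have "\<kappa> * s\<^sup>2 \<le> (1 / dim_total) * s\<^sup>2" using \<kappa> by (intro mult_right_mono) auto
  moreover have "\<kappa> * (s - \<xi> t)\<^sup>2 \<le> m * (s - \<xi> t)\<^sup>2" using \<kappa> by (intro mult_right_mono) auto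
  moreover have "\<kappa> * ((\<xi> t)\<^sup>2 / 2) \<le> \<kappa> * (s\<^sup>2 + (s - \<xi> t)\<^sup>2)"
  proof (intro mult_left_mono)
    have "0 \<le> (2 * s - \<xi> t)\<^sup>2" by simp
    then show "(\<xi> t)\<^sup>2 / 2 \<le> s\<^sup>2 + (s - \<xi> t)\<^sup>2" by (simp add: power2_eq_square algebra_simps)
  qed (use \<kappa> in auto)
  ultimately show "xi1 t \<le> - (\<kappa> / 2) * (\<xi> t)\<^sup>2 + \<bar>\<Lambda>\<bar>"
    unfolding xi1_def s_def by (simp add: algebra_simps)
qed

lemma xi_bound: "\<exists>C>0. \<forall>t. 0 < t \<longrightarrow> t \<le> T / 2 \<longrightarrow> \<bar>t * \<xi> t\<bar> \<le> C"
proof -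
  obtain c where c: "c > 0" "\<And>t. xi1 t \<le> - c * (\<xi> t)\<^sup>2 + \<bar>\<Lambda>\<bar>" using riccati by blast
  obtain C0 where C0: "C0 > 0" "\<And>t. 0 < t \<Longrightarrow> t \<le> T / 2 \<Longrightarrow> - C0 \<le> \<xi> t" using xi_lower by blast
  \<comment> \<open>Where \<xi> >= C1, half of c \<xi>^2 absorbs |\<Lambda>|, so that 1 / \<xi>
    grows at rate at least c/2.\<close>
  define C1 where "C1 = 1 + 2 * \<bar>\<Lambda>\<bar> / c"
  have C1: "C1 \<ge> 1" using c by (simp add: C1_def)
  have upper: "t * \<xi> t \<le> C1 + \<bar>\<Lambda>\<bar> + 4 / c" if t: "0 < t" "t \<le> T / 2" for t
  proof (cases "\<xi> t \<ge> C1 + \<bar>\<Lambda>\<bar>")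
    case True
    \<comment> \<open>Backwards in time \<xi> can drop by at most |\<Lambda>|, so a large value at t
      keeps the reciprocal well defined on all of [t/2, t]. Integration over that interval gives 1 /
      \<xi> t >= c t / 4.\<close>
    have big: "\<xi> s \<ge> C1" if "t / 2 \<le> s" "s \<le> t" for s
    proof -
      have "\<bar>\<Lambda>\<bar> * (t - s) \<le> \<bar>\<Lambda>\<bar> * 1" using that t T by (intro mult_left_mono) auto
      then show ?thesis using xi_almost_decreasing[of s t] that t T True by (simp add: algebra_simps)
    qed
    have "1 / \<xi> (t / 2) - c / 2 * (t / 2) \<le> 1 / \<xi> t - c / 2 * t"
    proof (rule DERIV_nonneg_imp_nondecreasing[of "t / 2" t "\<lambda>s. 1 / \<xi> s - c / 2 * s"])
      fix s assume s: "t / 2 \<le> s" "s \<le> t"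
      have pos: "\<xi> s \<ge> 1" using big[OF s] C1 by simp
      have "((\<lambda>s. 1 / \<xi> s - c / 2 * s) has_real_derivative - xi1 s / (\<xi> s)\<^sup>2 - c / 2) (at s)"
        using pos s t T by (auto intro!: derivative_eq_intros xi' simp: power2_eq_square)
      moreover have "- xi1 s / (\<xi> s)\<^sup>2 \<ge> c / 2"
      proof -
        have "C1 \<le> \<xi> s * \<xi> s"
          using mult_mono[of C1 "\<xi> s" 1 "\<xi> s"] big[OF s] pos C1 by simp
        then have "c / 2 * C1 \<le> c / 2 * (\<xi> s)\<^sup>2" using c by (simp add: power2_eq_square)
        moreover have "c / 2 * C1 \<ge> \<bar>\<Lambda>\<bar>" using c by (simp add: C1_def field_simps)
        ultimately have "c / 2 * (\<xi> s)\<^sup>2 \<le> - xi1 s" using c(2)[of s] by simp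
        then show ?thesis using pos by (subst pos_le_divide_eq) auto
      qed
      ultimately show "\<exists>z. ((\<lambda>s. 1 / \<xi> s - c / 2 * s) has_real_derivative z) (at s) \<and> 0 \<le> z"
        by (intro exI[of _ "- xi1 s / (\<xi> s)\<^sup>2 - c / 2"]) simp
    qed (use t in auto)
    moreover have "1 / \<xi> (t / 2) > 0" using big[of "t / 2"] t C1 by simp
    moreover have "c / 2 * (t / 2) = c * t / 4" "c / 2 * t = c * t / 2" by simp_all
    ultimately have "c * t / 4 \<le> 1 / \<xi> t" by linarith
    moreover have "\<xi> t > 0" using True C1 by simp
    ultimately have "t * \<xi> t \<le> 4 / c" using c t by (simp add: field_simps)
    then show ?thesis using C1 by simp
  next
    case False
    have "t * \<xi> t \<le> t * (C1 + \<bar>\<Lambda>\<bar>)" using False t by simp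
    also have "\<dots> \<le> 1 * (C1 + \<bar>\<Lambda>\<bar>)" using t T C1 by (intro mult_right_mono) auto
    finally show ?thesis using c by (simp add: add_increasing2)
  qed
  have lower: "- C0 \<le> t * \<xi> t" if t: "0 < t" "t \<le> T / 2" for t
  proof -
    have "1 * - C0 \<le> t * - C0" using t T C0 by (simp add: mult_le_cancel_right1)
    also have "\<dots> \<le> t * \<xi> t" using C0(2)[OF t] t by (intro mult_left_mono) auto
    finally show ?thesis by simp
  qed
  show ?thesis
  proof (intro exI conjI allI impI)
    show "C1 + \<bar>\<Lambda>\<bar> + 4 / c + C0 > 0" using c C0 C1 by (simp add: add_pos_pos add_nonneg_pos)
    fix t assume t: "0 < t" "t \<le> T / 2"
    have "4 / c > 0" using c by simp
    then show "\<bar>t * \<xi> t\<bar> \<le> C1 + \<bar>\<Lambda>\<bar> + 4 / c + C0"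
      using upper[OF t] lower[OF t] C0 C1 by linarith
  qed
qed

text \<open>In |y'| <= t y'^2 + 1 / (2 t) the square is absorbed by adding (t/2) \<xi>. The
  resulting monotone function differs from \<open>e * y i\<close> by terms whose variation on
  [t, 2t] is bounded, because t \<xi> is bounded there; both signs \<open>e\<close> give both
  inequalities.\<close>

lemma y_osc:
  "\<exists>C>0. \<forall>t s s' i. 0 < t \<longrightarrow> t \<le> T / 4 \<longrightarrow> s \<in> {t..2*t} \<longrightarrow> s' \<in> {t..2*t} \<longrightarrow> \<bar>y i s - y i s'\<bar> \<le> C"
proof -
  obtain C where C: "C > 0" "\<And>t. 0 < t \<Longrightarrow> t \<le> T / 2 \<Longrightarrow> \<bar>t * \<xi> t\<bar> \<le> C" using xi_bound by blast
  have one: "e * y i s' - e * y i s \<le> C + \<bar>\<Lambda>\<bar> + 1"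
    if t: "0 < t" "t \<le> T / 4" and s: "t \<le> s" "s \<le> s'" "s' \<le> 2 * t" and e: "\<bar>e\<bar> = 1" for t s s' i e
  proof -
    define L where "L = t / 2 * \<bar>\<Lambda>\<bar> + 1 / (2 * t)"
    have "e * y i s' + t / 2 * \<xi> s' - L * s' \<le> e * y i s + t / 2 * \<xi> s - L * s"
    proof (rule DERIV_nonpos_imp_nonincreasing[of s s' "\<lambda>x. e * y i x + t / 2 * \<xi> x - L * x"])
      fix x assume x: "s \<le> x" "x \<le> s'"
      have "((\<lambda>x. e * y i x + t / 2 * \<xi> x - L * x) has_real_derivative
          e * y1 i x + t / 2 * xi1 x - L) (at x)"
        using x s t T by (auto intro!: derivative_eq_intros xi' y)
      moreover have "e * y1 i x + t / 2 * xi1 x - L \<le> 0"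
      proof -
        have "e * y1 i x \<le> \<bar>y1 i x\<bar>" using e by (metis abs_ge_self abs_mult mult_1)
        also have "\<dots> \<le> t * (y1 i x)\<^sup>2 + 1 / (2 * t)"
        proof -
          have "0 \<le> (t * \<bar>y1 i x\<bar> - 1 / 2)\<^sup>2 + 1/4" by simp
          then have "t * \<bar>y1 i x\<bar> \<le> t * (t * (y1 i x)\<^sup>2 + 1 / (2 * t))"
            using t by (simp add: power2_eq_square algebra_simps)
          then show ?thesis using t by simp
        qed
        finally have 1: "e * y1 i x \<le> t * (y1 i x)\<^sup>2 + 1 / (2 * t)" .
        have "t / 2 * xi1 x \<le> t / 2 * (- 2 * (y1 i x)\<^sup>2 + \<bar>\<Lambda>\<bar>)"
          using xi1_le'[of x i] t by (intro mult_left_mono) auto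
        then show ?thesis using 1 unfolding L_def by (simp add: algebra_simps)
      qed
      ultimately show "\<exists>z. ((\<lambda>x. e * y i x + t / 2 * \<xi> x - L * x) has_real_derivative z) (at x) \<and> z \<le> 0"
        by blast
    qed (use s in auto)
    then have "e * y i s' - e * y i s \<le> t / 2 * (\<xi> s - \<xi> s') + L * (s' - s)"
      unfolding right_diff_distrib by linarith
    moreover have "t / 2 * (\<xi> s - \<xi> s') \<le> C"
    proof -
      have b: "t * \<bar>\<xi> r\<bar> \<le> C" if "t \<le> r" "r \<le> 2 * t" for r
      proof -
        have "t * \<bar>\<xi> r\<bar> \<le> r * \<bar>\<xi> r\<bar>" using that by (intro mult_right_mono) auto
        then show ?thesis using C(2)[of r] that t by (simp add: abs_mult)
      qed
      have "t * (\<xi> s - \<xi> s') \<le> t * (\<bar>\<xi> s\<bar> + \<bar>\<xi> s'\<bar>)" using t by (intro mult_left_mono) auto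
      then show ?thesis using b[of s] b[of s'] s by (simp add: algebra_simps)
    qed
    moreover have "L * (s' - s) \<le> \<bar>\<Lambda>\<bar> + 1"
    proof -
      have "L * (s' - s) \<le> L * t" using s t by (intro mult_left_mono) (auto simp: L_def)
      also have "\<dots> = t * t / 2 * \<bar>\<Lambda>\<bar> + 1 / 2" using t by (simp add: L_def algebra_simps)
      also have "t * t / 2 * \<bar>\<Lambda>\<bar> \<le> 1 * \<bar>\<Lambda>\<bar>"
        using t T mult_mono[of t 1 t 1] by (intro mult_right_mono) auto
      finally show ?thesis by simp
    qed
    ultimately show ?thesis by linarith
  qed
  show ?thesis
  proof (intro exI conjI allI impI)
    show "C + \<bar>\<Lambda>\<bar> + 1 > 0" using C by simp
    fix t s s' i assume t: "0 < t" "t \<le> T / 4" and s: "s \<in> {t..2*t}" "s' \<in> {t..2*t}"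
    show "\<bar>y i s - y i s'\<bar> \<le> C + \<bar>\<Lambda>\<bar> + 1"
      using one[OF t, of s s' 1 i] one[OF t, of s s' "-1" i] one[OF t, of s' s 1 i]
        one[OF t, of s' s "-1" i] s
      by (cases "s \<le> s'") auto
  qed
qed

text \<open>The mean value theorem turns bounded oscillation into a derivative of order 1/t at some
  time. Such times are the starting points for pointwise estimates of \<open>y1\<close>.\<close>

lemma slow_point: "\<exists>C>0. \<forall>t i. 0 < t \<longrightarrow> t \<le> T / 4 \<longrightarrow> (\<exists>s\<in>{t..2*t}. \<bar>t * y1 i s\<bar> \<le> C)"
proof -
  obtain C where C: "C > 0" "\<And>t s s' i. 0 < t \<Longrightarrow> t \<le> T / 4 \<Longrightarrow> s \<in> {t..2*t} \<Longrightarrow> s' \<in> {t..2*t}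
    \<Longrightarrow> \<bar>y i s - y i s'\<bar> \<le> C" using y_osc by blast
  show ?thesis
  proof (intro exI[of _ C] conjI allI impI)
    fix t i assume t: "0 < t" "t \<le> T / 4"
    obtain s where s: "t < s" "s < 2 * t" "y i (2 * t) - y i t = (2 * t - t) * y1 i s"
      using MVT2[of t "2 * t" "y i" "y1 i"] y t T by auto
    then show "\<exists>s\<in>{t..2*t}. \<bar>t * y1 i s\<bar> \<le> C" using C(2)[OF t, of "2 * t" t i] t
      by (intro bexI[of _ s]) auto
  qed (use C in auto)
qed

lemma continuous_on_y: "{a..b} \<subseteq> {0<..<T} \<Longrightarrow> continuous_on {a..b} (y i)"
  by (intro continuous_at_imp_continuous_on ballI DERIV_isCont[OF y]) auto

section \<open>Ricci terms at a favourable time\<close>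

text \<open>The largest weighted sum of the \<open>y i\<close> is a convex function of \<open>y\<close>. As it varies by a
  bounded amount over \<open>[t, 2t]\<close>, it cannot be too convex there.\<close>

lemma abs_ricci_bounded_somewhere:
  "\<exists>C>0. \<forall>t. 0 < t \<longrightarrow> t \<le> T / 4 \<longrightarrow> (\<exists>s\<in>{t..2*t}. s\<^sup>2 * abs_ricci (X s) \<le> C)"
proof -
  obtain B where B: "B > 0" "\<And>t. 0 < t \<Longrightarrow> t \<le> T / 2 \<Longrightarrow> \<bar>t * \<xi> t\<bar> \<le> B" using xi_bound by blast
  obtain Co where Co: "Co > 0" "\<And>t s s' i. 0 < t \<Longrightarrow> t \<le> T / 4 \<Longrightarrow> s \<in> {t..2*t} \<Longrightarrow>
    s' \<in> {t..2*t} \<Longrightarrow> \<bar>y i s - y i s'\<bar> \<le> Co" using y_osc by blast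
  have D1: "dim_total \<ge> 1" using total_ge by simp
  obtain \<Omega> :: "('i \<Rightarrow> real) set" and K where \<Omega>: "finite \<Omega>" "\<Omega> \<noteq> {}"
    and \<Omega>K0: "\<forall>\<omega>\<in>\<Omega>. \<forall>i. 1 \<le> \<omega> i \<and> \<omega> i \<le> K"
    and \<Omega>sep: "\<forall>\<omega>\<in>\<Omega>. \<forall>x. (\<forall>\<omega>'\<in>\<Omega>. (\<Sum>i\<in>UNIV. \<omega>' i * x i) \<le> (\<Sum>i\<in>UNIV. \<omega> i * x i)) \<longrightarrow>
      (\<forall>i j. i \<noteq> j \<longrightarrow> \<omega> i \<le> \<omega> j \<longrightarrow> 4 * dim_total * \<omega> i \<le> \<omega> j \<and> x i \<le> x j)"
    using exists_weights[OF D1] by (elim exE conjE) (rule that)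
  have \<Omega>K: "1 \<le> \<omega> i \<and> \<omega> i \<le> K" if "\<omega> \<in> \<Omega>" for \<omega> i
    using \<Omega>K0 that by blast
  define W where "W = real CARD('i) * K"
  have K: "K \<ge> 1" using \<Omega>K \<Omega>(2) by fastforce
  have W: "W > 0" unfolding W_def using K by simp
  have Wsum: "(\<Sum>i\<in>UNIV. \<omega> i) \<le> W" if "\<omega> \<in> \<Omega>" for \<omega>
    using sum_bounded_above[of UNIV \<omega> K] \<Omega>K[OF that] by (simp add: W_def)
  define f where "f \<omega> s = (\<Sum>i\<in>UNIV. \<omega> i * y i s)" for \<omega> s
  define \<Psi> where "\<Psi> s = Max ((\<lambda>\<omega>. f \<omega> s) ` \<Omega>)" for s
  have le_\<Psi>: "f \<omega> s \<le> \<Psi> s" if "\<omega> \<in> \<Omega>" for \<omega> s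
    unfolding \<Psi>_def using \<Omega> that by simp
  have ex_\<Psi>: "\<exists>\<omega>\<in>\<Omega>. \<Psi> s = f \<omega> s" for s
  proof -
    have "\<Psi> s \<in> (\<lambda>\<omega>. f \<omega> s) ` \<Omega>" unfolding \<Psi>_def using \<Omega> by (intro Max_in) auto
    then show ?thesis by blast
  qed
  define A where "A = 4 * (W * Co) + 4"
  have A: "A > 0" using W Co by (simp add: A_def add_pos_pos)
  define C where "C = 4 * ((2 * A + B * A + \<bar>\<Lambda>\<bar> * W) / H * (6 * dim_total))"
  have "s\<^sup>2 * abs_ricci (X s) \<le> C \<Longrightarrow> s\<^sup>2 * abs_ricci (X s) \<le> \<bar>C\<bar> + 1" for s by simp
  moreover have "\<exists>s\<in>{t..2*t}. s\<^sup>2 * abs_ricci (X s) \<le> C" if t: "0 < t" "t \<le> T / 4" for t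
  proof -
    \<comment> \<open>The parabola vanishes at both ends and is -A/4 in the middle, with A/4 = W Co
      + 1 exceeding the possible variation of \<Psi>. Hence \<Psi> - q has its maximum in the
      interior.\<close>
    define q where "q s = A / t\<^sup>2 * ((s - t) * (s - 2 * t))" for s
    define G where "G s = \<Psi> s - q s" for s
    have sub: "{t..2*t} \<subseteq> {0<..<T}" using t T by auto
    have contf: "continuous_on {t..2*t} (f \<omega>)" for \<omega>
      unfolding f_def by (intro continuous_intros continuous_on_y sub)
    have "continuous_on {t..2*t} \<Psi>"
      unfolding \<Psi>_def using \<Omega>
    proof (induction \<Omega> rule: finite_ne_induct)
      case (singleton \<omega>)
      then show ?case using contf by simp
    next
      case (insert \<omega> F)
      then have "(\<lambda>s. Max ((\<lambda>\<omega>. f \<omega> s) ` insert \<omega> F)) =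
          (\<lambda>s. max (f \<omega> s) (Max ((\<lambda>\<omega>. f \<omega> s) ` F)))" by (intro ext) simp
      then show ?case using insert contf by (auto intro!: continuous_intros)
    qed
    then have "continuous_on {t..2*t} G"
      unfolding G_def q_def by (intro continuous_intros)
    moreover have "{t..2*t} \<noteq> {}" using t by simp
    ultimately obtain s0 where s0: "s0 \<in> {t..2*t}" "\<And>s. s \<in> {t..2*t} \<Longrightarrow> G s \<le> G s0"
      using continuous_attains_sup[of "{t..2*t}" G] by auto
    have osc: "\<Psi> s \<le> \<Psi> s' + W * Co" if s: "s \<in> {t..2*t}" "s' \<in> {t..2*t}" for s s'
    proof -
      obtain \<omega> where \<omega>: "\<omega> \<in> \<Omega>" "\<Psi> s = f \<omega> s" using ex_\<Psi> by blast
      have "f \<omega> s - f \<omega> s' = (\<Sum>i\<in>UNIV. \<omega> i * (y i s - y i s'))"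
        by (simp add: f_def sum_subtractf right_diff_distrib)
      also have "\<dots> \<le> (\<Sum>i\<in>UNIV. \<omega> i * Co)"
        using Co(2)[OF t s] \<Omega>K[OF \<omega>(1)]
        by (intro sum_mono mult_left_mono) (auto simp: abs_le_iff intro: order_trans[OF zero_le_one])
      also have "\<dots> \<le> W * Co"
        using Wsum[OF \<omega>(1)] Co(1) by (simp flip: sum_distrib_right)
      finally show ?thesis using le_\<Psi>[OF \<omega>(1), of s'] \<omega>(2) by simp
    qed
    have mid: "G (3 / 2 * t) = \<Psi> (3 / 2 * t) + A / 4"
      using t by (simp add: G_def q_def power2_eq_square field_simps)
    have interior: "t < s0" "s0 < 2 * t"
    proof -
      have "s0 \<noteq> r" if "r = t \<or> r = 2 * t" for r
      proof
        assume "s0 = r"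
        then have "G s0 = \<Psi> r" using that by (auto simp: G_def q_def)
        moreover have "\<Psi> r \<le> \<Psi> (3 / 2 * t) + W * Co" using that t by (intro osc) auto
        moreover have "G (3 / 2 * t) \<le> G s0" using t by (intro s0) auto
        moreover have "A / 4 = W * Co + 1" by (simp add: A_def)
        ultimately show False using mid by linarith
      qed
      then show "t < s0" "s0 < 2 * t" using s0(1) by (auto simp: less_le)
    qed
    obtain \<omega> where \<omega>: "\<omega> \<in> \<Omega>" "\<Psi> s0 = f \<omega> s0" using ex_\<Psi> by blast
    define f1 where "f1 s = (\<Sum>i\<in>UNIV. \<omega> i * y1 i s)" for s
    define q1 where "q1 s = A / t\<^sup>2 * (2 * s - 3 * t)" for s
    define y2 where "y2 i = - \<xi> s0 * y1 i s0 + H * ric (X s0) i - \<Lambda>" for i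
    have s0T: "0 < s0" "s0 < T" "s0 \<le> T / 2" using interior t T by auto
    have y2: "(y1 i has_real_derivative y2 i) (at s0)" for i
      unfolding y2_def using y1[OF s0T(1,2)] .
    note test = second_derivative_at_max[of t s0 "2 * t" "\<lambda>s. f \<omega> s - q s" "\<lambda>s. f1 s - q1 s"
        "(\<Sum>i\<in>UNIV. \<omega> i * y2 i) - 2 * A / t\<^sup>2"]
    have d1: "((\<lambda>s. f \<omega> s - q s) has_real_derivative f1 s - q1 s) (at s)" if "t < s" "s < 2 * t" for s
    proof (rule DERIV_diff)
      show "(f \<omega> has_real_derivative f1 s) (at s)"
        unfolding f_def f1_def using that t T by (auto intro!: derivative_eq_intros y simp: mult.commute)
      have "((\<lambda>s. \<alpha> * ((s - t) * (s - 2 * t))) has_real_derivative \<alpha> * (2 * s - 3 * t)) (at s)" for \<alpha>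
        by (auto intro!: derivative_eq_intros simp: algebra_simps)
      then show "(q has_real_derivative q1 s) (at s)" unfolding q_def q1_def .
    qed
    have d2: "((\<lambda>s. f1 s - q1 s) has_real_derivative (\<Sum>i\<in>UNIV. \<omega> i * y2 i) - 2 * A / t\<^sup>2) (at s0)"
    proof (rule DERIV_diff)
      show "(f1 has_real_derivative (\<Sum>i\<in>UNIV. \<omega> i * y2 i)) (at s0)"
        unfolding f1_def by (auto intro!: derivative_eq_intros y2 simp: mult.commute)
      have "((\<lambda>s. \<alpha> * (2 * s - 3 * t)) has_real_derivative \<alpha> * 2) (at s0)" for \<alpha>
        by (auto intro!: derivative_eq_intros)
      from this[of "A / t\<^sup>2"] show "(q1 has_real_derivative 2 * A / t\<^sup>2) (at s0)"
        unfolding q1_def by (simp add: mult.commute)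
    qed
    \<comment> \<open>\<Psi> need not be differentiable, but \<open>f \<omega>\<close> lies below it
      and agrees with it at \<open>s0\<close>; so the smooth function \<open>f \<omega> - q\<close>
      has a maximum there as well.\<close>
    have mx: "f \<omega> s - q s \<le> f \<omega> s0 - q s0" if "t < s" "s < 2 * t" for s
      using s0(2)[of s] le_\<Psi>[OF \<omega>(1), of s] \<omega>(2) that by (simp add: G_def)
    have zero: "f1 s0 = q1 s0" and neg: "(\<Sum>i\<in>UNIV. \<omega> i * y2 i) \<le> 2 * A / t\<^sup>2"
      using test[OF interior d1 d2 mx] by auto
    \<comment> \<open>Since \<omega> attains the maximum at \<open>s0\<close>, its weights are
      ordered like the eigenvalues at this very time.\<close>
    have "4 * dim_total * \<omega> i \<le> \<omega> j \<and> X s0 i \<le> X s0 j" if "i \<noteq> j" "\<omega> i \<le> \<omega> j" for i j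
    proof -
      have "\<forall>\<omega>'\<in>\<Omega>. (\<Sum>i\<in>UNIV. \<omega>' i * y i s0) \<le> (\<Sum>i\<in>UNIV. \<omega> i * y i s0)"
        using le_\<Psi>[of _ s0] \<omega>(2) by (simp add: f_def)
      from \<Omega>sep[rule_format, OF \<omega>(1), of "\<lambda>i. y i s0", OF _ that] this show ?thesis by auto
    qed
    then have "abs_ricci (X s0) / (6 * dim_total) \<le> (\<Sum>i\<in>UNIV. \<omega> i * ric (X s0) i)"
      using \<Omega>K[OF \<omega>(1)] d_le_total by (intro weighted_ric_ge) auto
    then have "H * (abs_ricci (X s0) / (6 * dim_total)) \<le> H * (\<Sum>i\<in>UNIV. \<omega> i * ric (X s0) i)"
      using H by (intro mult_left_mono) auto
    \<comment> \<open>The equation for \<open>y''\<close> is solved for the curvature. The second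
      derivative test bounds the first term, and the first order condition f1 = q1 bounds the
      damping term, which would otherwise contain an uncontrolled \<open>y'\<close>.\<close>
    also have "\<dots> = (\<Sum>i\<in>UNIV. \<omega> i * y2 i) + \<xi> s0 * f1 s0 + \<Lambda> * (\<Sum>i\<in>UNIV. \<omega> i)"
      unfolding y2_def f1_def sum_distrib_left sum.distrib[symmetric]
      by (intro sum.cong) (auto simp: algebra_simps)
    also have "\<dots> \<le> (2 * A + B * A + \<bar>\<Lambda>\<bar> * W) / t\<^sup>2"
    proof -
      have "\<xi> s0 * f1 s0 \<le> B * A / t\<^sup>2"
      proof -
        have "\<bar>q1 s0\<bar> = A / t\<^sup>2 * \<bar>2 * s0 - 3 * t\<bar>" using A by (simp add: q1_def abs_mult)
        also have "\<dots> \<le> A / t\<^sup>2 * t" using interior A by (intro mult_left_mono) auto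
        also have "\<dots> = A / t" using t by (simp add: power2_eq_square)
        finally have "\<bar>q1 s0\<bar> \<le> A / t" .
        moreover have "t * \<bar>\<xi> s0\<bar> \<le> B"
        proof -
          have "t * \<bar>\<xi> s0\<bar> \<le> s0 * \<bar>\<xi> s0\<bar>" using interior by (intro mult_right_mono) auto
          then show ?thesis using B(2)[OF s0T(1,3)] s0T by (simp add: abs_mult)
        qed
        then have "\<bar>\<xi> s0\<bar> \<le> B / t" using t by (simp add: field_simps)
        ultimately have "\<bar>\<xi> s0\<bar> * \<bar>q1 s0\<bar> \<le> B / t * (A / t)" using B t by (intro mult_mono) auto
        then show ?thesis unfolding zero using abs_ge_self[of "\<xi> s0 * q1 s0"]
          by (simp add: abs_mult power2_eq_square)
      qed
      moreover have "\<Lambda> * (\<Sum>i\<in>UNIV. \<omega> i) \<le> \<bar>\<Lambda>\<bar> * W / t\<^sup>2"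
      proof -
        have "0 \<le> (\<Sum>i\<in>UNIV. \<omega> i)"
          using \<Omega>K[OF \<omega>(1)] by (intro sum_nonneg) (auto intro: order_trans[OF zero_le_one])
        then have "\<Lambda> * (\<Sum>i\<in>UNIV. \<omega> i) \<le> \<bar>\<Lambda>\<bar> * W"
          using Wsum[OF \<omega>(1)] by (intro mult_mono) auto
        also have "\<dots> \<le> \<bar>\<Lambda>\<bar> * W / t\<^sup>2"
        proof -
          have "t\<^sup>2 \<le> 1" using t T by (simp add: power_le_one)
          then have "\<bar>\<Lambda>\<bar> * W * t\<^sup>2 \<le> \<bar>\<Lambda>\<bar> * W * 1" using W by (intro mult_left_mono) auto
          then show ?thesis using t by (simp add: pos_le_divide_eq)
        qed
        finally show ?thesis .
      qed
      ultimately show ?thesis using neg by (simp add: add_divide_distrib)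
    qed
    finally have "H * (abs_ricci (X s0) / (6 * dim_total)) \<le> (2 * A + B * A + \<bar>\<Lambda>\<bar> * W) / t\<^sup>2" .
    then have "t\<^sup>2 * abs_ricci (X s0) \<le> (2 * A + B * A + \<bar>\<Lambda>\<bar> * W) / H * (6 * dim_total)"
      using t H total_ge by (simp add: field_simps)
    moreover have "s0\<^sup>2 * abs_ricci (X s0) \<le> (2 * t)\<^sup>2 * abs_ricci (X s0)"
    proof (intro mult_right_mono power_mono)
      show "0 \<le> abs_ricci (X s0)"
        unfolding abs_ricci_def using casimir_nonneg gamma_nonneg by (intro add_nonneg_nonneg sum_nonneg) auto
    qed (use interior s0T in auto)
    ultimately have "s0\<^sup>2 * abs_ricci (X s0) \<le> C" by (simp add: C_def power2_eq_square)
    then show ?thesis using s0(1) by blast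
  qed
  ultimately show ?thesis by (intro exI[of _ "\<bar>C\<bar> + 1"]) (meson abs_ge_zero add_nonneg_pos zero_less_one)
qed

section \<open>From favourable times to all times\<close>

lemma X_ratio:
  "\<exists>C\<ge>1. \<forall>t s s' i. 0 < t \<longrightarrow> t \<le> T / 4 \<longrightarrow> s \<in> {t..2*t} \<longrightarrow> s' \<in> {t..2*t} \<longrightarrow> X s i \<le> C * X s' i"
proof -
  obtain C where C: "C > 0" "\<And>t s s' i. 0 < t \<Longrightarrow> t \<le> T / 4 \<Longrightarrow> s \<in> {t..2*t} \<Longrightarrow> s' \<in> {t..2*t}
    \<Longrightarrow> \<bar>y i s - y i s'\<bar> \<le> C" using y_osc by blast
  show ?thesis
  proof (intro exI[of _ "exp (2 * C)"] conjI allI impI)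
    fix t s s' i assume "0 < t" "t \<le> T / 4" "s \<in> {t..2*t}" "s' \<in> {t..2*t}"
    then have "\<bar>y i s - y i s'\<bar> \<le> C" by (rule C(2))
    then have "2 * y i s \<le> 2 * C + 2 * y i s'" by linarith
    then show "X s i \<le> exp (2 * C) * X s' i" by (simp flip: exp_add)
  qed (use C in simp)
qed

text \<open>A Casimir term is bounded at some time of [t, 2t], being part of
  \<open>abs_ricci\<close>; it involves one eigenvalue, so \<open>X_ratio\<close> moves the bound to
  t.\<close>

lemma casimir_bound: "\<exists>C>0. \<forall>t i. 0 < t \<longrightarrow> t \<le> T / 4 \<longrightarrow> t\<^sup>2 * (casimir i / X t i) \<le> C"
proof -
  obtain C where C: "C \<ge> 1" "\<And>t s s' i. 0 < t \<Longrightarrow> t \<le> T / 4 \<Longrightarrow> s \<in> {t..2*t} \<Longrightarrow> s' \<in> {t..2*t}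
    \<Longrightarrow> X s i \<le> C * X s' i" using X_ratio by blast
  obtain P where P: "P > 0" "\<And>t. 0 < t \<Longrightarrow> t \<le> T / 4 \<Longrightarrow> \<exists>s\<in>{t..2*t}. s\<^sup>2 * abs_ricci (X s) \<le> P"
    using abs_ricci_bounded_somewhere by blast
  show ?thesis
  proof (intro exI[of _ "C * P"] conjI allI impI)
    show "C * P > 0" using C P by simp
    fix t i assume t: "0 < t" "t \<le> T / 4"
    obtain s where s: "s \<in> {t..2*t}" "s\<^sup>2 * abs_ricci (X s) \<le> P" using P(2)[OF t] by blast
    have "casimir i / X t i \<le> casimir i / (X s i / C)"
      using C(2)[OF t s(1), of t i] C(1) t casimir_nonneg[of i]
      by (intro divide_left_mono) (auto simp: pos_divide_le_eq mult.commute)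
    also have "\<dots> = C * (casimir i / X s i)" by simp
    finally have "t\<^sup>2 * (casimir i / X t i) \<le> s\<^sup>2 * (C * abs_ricci (X s))"
    proof (intro mult_mono power_mono)
      assume "casimir i / X t i \<le> C * (casimir i / X s i)"
      also have "\<dots> \<le> C * abs_ricci (X s)" using C(1) by (intro mult_left_mono casimir_le_abs_ricci) auto
      finally show "casimir i / X t i \<le> C * abs_ricci (X s)" .
    qed (use s t casimir_nonneg in auto)
    also have "\<dots> \<le> C * P" using s(2) C(1) by (simp add: mult.left_commute)
    finally show "t\<^sup>2 * (casimir i / X t i) \<le> C * P" .
  qed
qed

text \<open>As \<gamma> can be permuted, this applies to any two indices of a triple with positive
  coefficient: at most one of its three eigenvalues can be small compared with t^2. A maximum of two
  eigenvalues, like a single one, can be moved between times by \<open>X_ratio\<close>.\<close>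

lemma two_large:
  "\<exists>C>0. \<forall>t i k l. 0 < t \<longrightarrow> t \<le> T / 4 \<longrightarrow> t\<^sup>2 * \<gamma> i k l \<le> C * max (X t i) (X t k)"
proof -
  obtain C where C: "C \<ge> 1" "\<And>t s s' i. 0 < t \<Longrightarrow> t \<le> T / 4 \<Longrightarrow> s \<in> {t..2*t} \<Longrightarrow> s' \<in> {t..2*t}
    \<Longrightarrow> X s i \<le> C * X s' i" using X_ratio by blast
  obtain P where P: "P > 0" "\<And>t. 0 < t \<Longrightarrow> t \<le> T / 4 \<Longrightarrow> \<exists>s\<in>{t..2*t}. s\<^sup>2 * abs_ricci (X s) \<le> P"
    using abs_ricci_bounded_somewhere by blast
  define K where "K = 12 * dim_total * P"
  have K: "K > 0" using P total_ge by (simp add: K_def)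
  show ?thesis
  proof (intro exI[of _ "K * C"] conjI allI impI)
    show "K * C > 0" using C K by simp
    fix t i k l assume t: "0 < t" "t \<le> T / 4"
    obtain s where s: "s \<in> {t..2*t}" "s\<^sup>2 * abs_ricci (X s) \<le> P" using P(2)[OF t] by blast
    have pos: "0 < max (X s i) (X s k)" by (simp add: less_max_iff_disj)
    have "\<gamma> i k l / max (X s i) (X s k) \<le> 12 * dim_total * abs_ricci (X s)"
      by (intro inverse_max_le_abs_ricci d_le_total) auto
    then have "\<gamma> i k l \<le> 12 * dim_total * abs_ricci (X s) * max (X s i) (X s k)"
      using pos by (simp add: pos_divide_le_eq)
    then have "s\<^sup>2 * \<gamma> i k l \<le> s\<^sup>2 * (12 * dim_total * abs_ricci (X s) * max (X s i) (X s k))"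
      by (intro mult_left_mono) auto
    also have "\<dots> = 12 * dim_total * (s\<^sup>2 * abs_ricci (X s)) * max (X s i) (X s k)" by simp
    also have "\<dots> \<le> K * max (X s i) (X s k)"
      unfolding K_def using s(2) pos total_ge by (intro mult_right_mono mult_left_mono) auto
    also have "\<dots> \<le> K * (C * max (X t i) (X t k))"
    proof (intro mult_left_mono)
      have "X s i \<le> C * X t i" "X s k \<le> C * X t k" using C(2)[OF t s(1), of t] t by auto
      moreover have "C * X t i \<le> C * max (X t i) (X t k)" "C * X t k \<le> C * max (X t i) (X t k)"
        using C(1) by (auto intro!: mult_left_mono)
      ultimately show "max (X s i) (X s k) \<le> C * max (X t i) (X t k)" by simp
    qed (use K in simp)
    finally have "s\<^sup>2 * \<gamma> i k l \<le> K * C * max (X t i) (X t k)" by simp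
    moreover have "t\<^sup>2 * \<gamma> i k l \<le> s\<^sup>2 * \<gamma> i k l"
      using s t gamma_nonneg by (intro mult_right_mono power_mono) auto
    ultimately show "t\<^sup>2 * \<gamma> i k l \<le> K * C * max (X t i) (X t k)" by simp
  qed
qed

text \<open>When \<open>X t i\<close> is small against t^2, \<open>two_large\<close> makes both
  partners in every interacting triple at least c t^2. The positive part X_i / (4 X_k X_l) of the
  triple's contribution is then of order X_i / t^4, negligible against 1/t^2.\<close>

lemma small_ric:
  assumes casimir: "casimir i = 0"
  shows "\<exists>C K0. 0 < C \<and> 0 < K0 \<and> (\<forall>t. 0 < t \<longrightarrow> t \<le> T / 4 \<longrightarrow> K0 * X t i \<le> t\<^sup>2 \<longrightarrow>
    ric (X t) i \<le> C * X t i / t ^ 4)"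
proof -
  obtain C where C: "C > 0" "\<And>t i k l. 0 < t \<Longrightarrow> t \<le> T / 4 \<Longrightarrow> t\<^sup>2 * \<gamma> i k l \<le> C * max (X t i) (X t k)"
    using two_large by blast
  \<comment> \<open>The least positive coefficient involving \<open>i\<close>; the inserted 1 keeps
    the minimum meaningful when all of them vanish.\<close>
  define g where "g = Min (insert 1 ((\<lambda>(k, l). \<gamma> i k l) ` {(k, l). \<gamma> i k l > 0}))"
  have g_le: "g \<le> \<gamma> i k l" if "\<gamma> i k l > 0" for k l
    unfolding g_def using that by (intro Min_le) auto
  have g: "g > 0" unfolding g_def by (subst Min_gr_iff) auto
  define c where "c = g / C"
  have c: "c > 0" using g C by (simp add: c_def)
  define n where "n = real CARD('i)"
  define G where "G = \<beta> i / (4 * c\<^sup>2) + 1"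
  have ric: "ric (X t) i \<le> n * (n * (\<beta> i / (4 * c\<^sup>2))) * X t i / t ^ 4"
    if t: "0 < t" "t \<le> T / 4" and K: "(1 / c + 1) * X t i \<le> t\<^sup>2" for t
  proof -
    \<comment> \<open>The constant 1/c + 1 makes \<open>X t i\<close> strictly smaller than c t^2,
      so the maximum in \<open>two_large\<close> must be the partner's eigenvalue.\<close>
    have small: "X t i < c * t\<^sup>2"
    proof -
      have "X t i < (1 + c) * X t i" using c by (simp add: distrib_right)
      also have "\<dots> = c * ((1 / c + 1) * X t i)" using c by (simp add: field_simps)
      also have "\<dots> \<le> c * t\<^sup>2" using K c by (intro mult_left_mono) auto
      finally show ?thesis .
    qed
    have other: "c * t\<^sup>2 \<le> X t k" if "\<gamma> i k l > 0" for k l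
    proof -
      have "g * t\<^sup>2 \<le> t\<^sup>2 * \<gamma> i k l" using mult_right_mono[OF g_le[OF that], of "t\<^sup>2"] by (simp add: mult.commute)
      also have "\<dots> \<le> C * max (X t i) (X t k)" by (rule C(2)[OF t])
      finally have "c * t\<^sup>2 \<le> max (X t i) (X t k)" using C by (simp add: c_def field_simps)
      then show ?thesis using small by simp
    qed
    have bd: "\<gamma> i k l * heron (X t i) (X t k) (X t l) \<le> \<beta> i / (4 * c\<^sup>2) * X t i / t ^ 4" for k l
    proof (cases "\<gamma> i k l > 0")
      case True
      have k: "c * t\<^sup>2 \<le> X t k" by (rule other[OF True])
      have l: "c * t\<^sup>2 \<le> X t l" using other[of l k] True by (simp add: gamma_commute[of i l k])
      have ct: "c * t\<^sup>2 > 0" using c t by simp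
      have "heron (X t i) (X t k) (X t l) \<le> (X t i)\<^sup>2 / (4 * X t i * X t k * X t l)"
        unfolding heron_def by (intro divide_right_mono) auto
      also have "\<dots> = X t i / (4 * (X t k * X t l))" by (simp add: power2_eq_square)
      also have "\<dots> \<le> X t i / (4 * (c * t\<^sup>2 * (c * t\<^sup>2)))"
        using k l ct c t by (intro divide_left_mono mult_left_mono mult_mono) auto
      also have "\<dots> = 1 / (4 * c\<^sup>2) * X t i / t ^ 4" by (simp add: power2_eq_square power4_eq_xxxx mult_ac)
      finally have "\<gamma> i k l * heron (X t i) (X t k) (X t l) \<le> \<gamma> i k l * (1 / (4 * c\<^sup>2) * X t i / t ^ 4)"
        by (intro mult_left_mono gamma_nonneg)
      also have "\<dots> \<le> \<beta> i * (1 / (4 * c\<^sup>2) * X t i / t ^ 4)"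
        using gamma_le_beta[of i k l] t by (intro mult_right_mono) auto
      finally have "\<gamma> i k l * heron (X t i) (X t k) (X t l) \<le> \<beta> i * (1 / (4 * c\<^sup>2) * X t i / t ^ 4)" .
      then show ?thesis by simp
    next
      case False
      then have "\<gamma> i k l = 0" using gamma_nonneg[of i k l] by simp
      then show ?thesis using beta_nonneg[of i] t by simp
    qed
    have "ric (X t) i = (\<Sum>k\<in>UNIV. \<Sum>l\<in>UNIV. \<gamma> i k l * heron (X t i) (X t k) (X t l))"
      by (simp add: ric_def casimir)
    also have "\<dots> \<le> (\<Sum>k\<in>(UNIV::'i set). \<Sum>l\<in>(UNIV::'i set). \<beta> i / (4 * c\<^sup>2) * X t i / t ^ 4)"
      by (intro sum_mono bd)
    also have "\<dots> = n * (n * (\<beta> i / (4 * c\<^sup>2))) * X t i / t ^ 4" by (simp add: n_def)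
    finally show ?thesis .
  qed
  show ?thesis
  proof (intro exI conjI allI impI)
    show "n * (n * (\<beta> i / (4 * c\<^sup>2))) + 1 > 0"
      using beta_nonneg[of i] by (simp add: n_def add_nonneg_pos)
    show "1 / c + 1 > 0" using c by (simp add: add_pos_pos)
    fix t assume t: "0 < t" "t \<le> T / 4" and K: "(1 / c + 1) * X t i \<le> t\<^sup>2"
    have "n * (n * (\<beta> i / (4 * c\<^sup>2))) * (X t i / t ^ 4) \<le> (n * (n * (\<beta> i / (4 * c\<^sup>2))) + 1) * (X t i / t ^ 4)"
      using t by (intro mult_right_mono) auto
    then show "ric (X t) i \<le> (n * (n * (\<beta> i / (4 * c\<^sup>2))) + 1) * X t i / t ^ 4"
      using ric[OF t K] by simp
  qed
qed

section \<open>Exclusion of fast collapse along a torus\<close>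

text \<open>With \<open>a = t y\<^sub>i'\<close>, \<open>b = t \<xi>\<close> and \<open>z = ln (t\<^sup>2 / X\<^sub>i)\<close>, and derivatives with respect to \<open>ln t\<close>,
  the flow satisfies up to small errors \<open>a' \<le> a (1 - b)\<close>, \<open>b' \<le> b - 2 a\<^sup>2\<close> and \<open>z' = 2 (1 - a)\<close>
  where \<open>z\<close> is large. Then \<open>\<Theta> = (z - ln a - b) / 2\<close> has derivative at least
  \<open>1 / 2 - a + a\<^sup>2 \<ge> 1 / 4\<close>; the cutoff of \<open>a\<close> from below makes \<open>\<Theta>\<close> comparable to \<open>z / 2\<close>. The
  factor 2 is the lower bound for \<open>d\<^sub>i\<close>.\<close>

lemma collapse_bound_casimir_zero:
  assumes casimir: "casimir i = 0"
  shows "\<exists>C>0. \<forall>t. 0 < t \<longrightarrow> t \<le> T / 4 \<longrightarrow> t\<^sup>2 / X t i \<le> C"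
proof -
  obtain G K0 where G: "G > 0" and K0: "K0 > 0"
    and ricG: "\<And>t. 0 < t \<Longrightarrow> t \<le> T / 4 \<Longrightarrow> K0 * X t i \<le> t\<^sup>2 \<Longrightarrow> ric (X t) i \<le> G * X t i / t ^ 4"
    using small_ric[OF casimir] by blast
  obtain B where B: "B > 0" "\<And>t. 0 < t \<Longrightarrow> t \<le> T / 2 \<Longrightarrow> \<bar>t * \<xi> t\<bar> \<le> B" using xi_bound by blast
  obtain C0 where C0: "C0 > 0" "\<And>t. 0 < t \<Longrightarrow> t \<le> T / 2 \<Longrightarrow> - C0 \<le> \<xi> t" using xi_lower by blast
  obtain Co where Co: "Co > 0" "\<And>t s s' i. 0 < t \<Longrightarrow> t \<le> T / 4 \<Longrightarrow> s \<in> {t..2*t} \<Longrightarrow>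
    s' \<in> {t..2*t} \<Longrightarrow> \<bar>y i s - y i s'\<bar> \<le> Co" using y_osc by blast
  obtain A1 where A1: "A1 > 0" "\<And>t i. 0 < t \<Longrightarrow> t \<le> T / 4 \<Longrightarrow> \<exists>s\<in>{t..2*t}. \<bar>t * y1 i s\<bar> \<le> A1"
    using slow_point by blast
  \<comment> \<open>The bound of \<open>slow_point\<close> is for t y'(s); passing to s y'(s) with s
    <= 2t doubles it.\<close>
  define A0 where "A0 = 2 * A1"
  have A0: "A0 > 0" using A1 by (simp add: A0_def)
  \<comment> \<open>\<eta> is a lower bound for the cutoff exp (-1 - b), because b <= B. Above the
    cutoff, an error \<delta> = \<eta>/8 is at most a/8 and survives division by
    \<open>a\<close>.\<close>
  define \<eta> where "\<eta> = exp (- 1 - B)"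
  have \<eta>: "0 < \<eta>" "\<eta> \<le> 1" using B by (auto simp: \<eta>_def)
  define \<delta> where "\<delta> = \<eta> / 8"
  have \<delta>: "0 < \<delta>" "\<delta> \<le> 1 / 8" using \<eta> by (auto simp: \<delta>_def)
  \<comment> \<open>Where z >= ln K1, that is t^2 / X_i >= K1, \<open>small_ric\<close> applies and
    the curvature error t^2 H ric is at most \<delta>/2.\<close>
  define K1 where "K1 = K0 + 2 * H * G / \<delta>"
  have K1: "K1 > 0" "K1 \<ge> K0" "K1 * \<delta> \<ge> 2 * H * G"
  proof -
    have "2 * H * G / \<delta> > 0" using H G \<delta> by simp
    then show "K1 > 0" "K1 \<ge> K0" using K0 by (auto simp: K1_def)
    show "K1 * \<delta> \<ge> 2 * H * G" using \<delta> K0 by (simp add: K1_def distrib_right)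
  qed
  \<comment> \<open>For times up to \<open>tt\<close>, the lower bound of \<xi> gives b >= -1/2 and
    the \<Lambda> terms are at most \<delta>/2.\<close>
  define tt where "tt = min (T / 4) (min (1 / (2 * C0)) (\<delta> / (2 * (\<bar>\<Lambda>\<bar> + 1))))"
  have tt: "0 < tt" "tt \<le> T / 4" "C0 * tt \<le> 1 / 2" "\<bar>\<Lambda>\<bar> * tt \<le> \<delta> / 2"
  proof -
    show "0 < tt" using T C0 \<delta> by (simp add: tt_def)
    show "tt \<le> T / 4" unfolding tt_def by (rule min.cobounded1)
    have "C0 * tt \<le> C0 * (1 / (2 * C0))" using C0 by (intro mult_left_mono) (auto simp: tt_def)
    then show "C0 * tt \<le> 1 / 2" using C0 by simp
    have "\<bar>\<Lambda>\<bar> * tt \<le> (\<bar>\<Lambda>\<bar> + 1) * (\<delta> / (2 * (\<bar>\<Lambda>\<bar> + 1)))"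
      using \<open>0 < tt\<close> by (intro mult_mono) (auto simp: tt_def)
    also have "\<dots> = \<delta> / 2" by (simp add: field_simps)
    finally show "\<bar>\<Lambda>\<bar> * tt \<le> \<delta> / 2" .
  qed
  define a where "a t = t * y1 i t" for t
  define b where "b t = t * \<xi> t" for t
  define z where "z t = 2 * ln t - 2 * y i t" for t
  \<comment> \<open>The term b is added because it cancels the -b in the bound for the logarithmic
    derivative of \<open>a\<close>. The cutoff is exp (-1 - b) so that \<Theta> is exactly z/2 + 1/2
    below it; as b >= -1/2, there a < 1 and z still increases.\<close>
  define \<Theta> where "\<Theta> t = z t / 2 - (ln (max (a t) (exp (- 1 - b t))) + b t) / 2" for t
  define a1 where "a1 t = y1 i t + t * (- \<xi> t * y1 i t + H * ric (X t) i - \<Lambda>)" for t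
  define b1 where "b1 t = \<xi> t + t * xi1 t" for t
  have der: "(a has_real_derivative a1 t) (at t)" "(b has_real_derivative b1 t) (at t)"
    "(z has_real_derivative 2 * (1 - a t) / t) (at t)" if t: "0 < t" "t \<le> tt" for t
  proof -
    have tT: "0 < t" "t < T" using t tt T by auto
    show "(a has_real_derivative a1 t) (at t)" unfolding a_def a1_def
      by (rule DERIV_cong[OF DERIV_mult[OF DERIV_ident y1[OF tT]]]) simp
    show "(b has_real_derivative b1 t) (at t)" unfolding b_def b1_def
      by (rule DERIV_cong[OF DERIV_mult[OF DERIV_ident xi'[OF tT]]]) simp
    show "(z has_real_derivative 2 * (1 - a t) / t) (at t)" unfolding z_def a_def
      using t by (auto intro!: derivative_eq_intros y[OF tT] simp: field_simps)
  qed
  have cont: "continuous_on S a" "continuous_on S b" "continuous_on S z" if "S \<subseteq> {0<..tt}" for S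
    using that by (auto intro!: continuous_at_imp_continuous_on DERIV_isCont[OF der(1)]
        DERIV_isCont[OF der(2)] DERIV_isCont[OF der(3)])
  have bB: "b t \<le> B" "- (1 / 2) \<le> b t" "- B \<le> b t" if t: "0 < t" "t \<le> tt" for t
  proof -
    have "\<bar>b t\<bar> \<le> B" unfolding b_def using t tt T by (intro B) auto
    then show "b t \<le> B" "- B \<le> b t" by auto
    have "t * C0 \<le> tt * C0" using t C0 by (intro mult_right_mono) auto
    moreover have "t * - C0 \<le> b t" unfolding b_def using t tt T C0 by (intro mult_left_mono) auto
    ultimately show "- (1 / 2) \<le> b t" using tt by (simp add: mult.commute)
  qed
  have small: "t\<^sup>2 * \<bar>\<Lambda>\<bar> \<le> \<delta> / 2" if t: "0 < t" "t \<le> tt" for t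
  proof -
    have "t * (t * \<bar>\<Lambda>\<bar>) \<le> 1 * (tt * \<bar>\<Lambda>\<bar>)" using t tt T by (intro mult_mono mult_right_mono) auto
    then show ?thesis using tt by (simp add: power2_eq_square mult.commute mult.left_commute)
  qed
  have b1: "t * b1 t \<le> b t - 2 * (a t)\<^sup>2 + \<delta>" if t: "0 < t" "t \<le> tt" for t
  proof -
    have "t * b1 t = b t + t\<^sup>2 * xi1 t" by (simp add: b1_def b_def power2_eq_square algebra_simps)
    also have "t\<^sup>2 * xi1 t \<le> t\<^sup>2 * (- 2 * (y1 i t)\<^sup>2 + \<bar>\<Lambda>\<bar>)"
      by (intro mult_left_mono xi1_le') auto
    also have "\<dots> = - 2 * (a t)\<^sup>2 + t\<^sup>2 * \<bar>\<Lambda>\<bar>" by (simp add: a_def power2_eq_square algebra_simps)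
    finally show ?thesis using small[OF t] \<delta> by linarith
  qed
  have exp_z: "exp (z t) = t\<^sup>2 / X t i" if "0 < t" for t
    using that exp_double[of "ln t"] by (simp add: z_def exp_diff)
  have a1: "t * a1 t \<le> a t * (1 - b t) + \<delta>" if t: "0 < t" "t \<le> tt" and z: "z t \<ge> ln K1" for t
  proof -
    have "exp (ln K1) \<le> exp (z t)" using z by simp
    also have "exp (z t) = t\<^sup>2 / X t i" by (rule exp_z[OF t(1)])
    finally have K: "K1 * X t i \<le> t\<^sup>2" using K1 by (simp add: field_simps)
    have "K0 * X t i \<le> K1 * X t i" by (intro mult_right_mono K1) auto
    then have K0X: "K0 * X t i \<le> t\<^sup>2" using K by (rule order_trans)
    have "ric (X t) i \<le> G * X t i / t ^ 4" using t tt by (intro ricG K0X) auto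
    then have "t\<^sup>2 * H * ric (X t) i \<le> t\<^sup>2 * H * (G * X t i / t ^ 4)"
      using H by (intro mult_left_mono) auto
    also have "\<dots> = H * G * X t i / t\<^sup>2" using t by (simp add: power2_eq_square power4_eq_xxxx)
    also have "\<dots> \<le> \<delta> / 2"
    proof -
      have "2 * H * G * X t i \<le> K1 * \<delta> * X t i" using K1 by (intro mult_right_mono) auto
      also have "\<dots> = \<delta> * (K1 * X t i)" by simp
      also have "\<dots> \<le> \<delta> * t\<^sup>2" using K \<delta> by (intro mult_left_mono) auto
      finally show ?thesis using t by (simp add: pos_divide_le_eq)
    qed
    finally have "t\<^sup>2 * H * ric (X t) i \<le> \<delta> / 2" .
    moreover have "t\<^sup>2 * \<Lambda> \<ge> - (\<delta> / 2)"
    proof -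
      have "t\<^sup>2 * - \<bar>\<Lambda>\<bar> \<le> t\<^sup>2 * \<Lambda>" by (intro mult_left_mono) auto
      then show ?thesis using small[OF t] by simp
    qed
    moreover have "t * a1 t = a t * (1 - b t) + t\<^sup>2 * H * ric (X t) i - t\<^sup>2 * \<Lambda>"
      by (simp add: a1_def a_def b_def power2_eq_square algebra_simps)
    ultimately show ?thesis by linarith
  qed
  have max_nz: "max (a t) (exp (- 1 - b t)) \<noteq> 0" for t
  proof -
    have "0 < max (a t) (exp (- 1 - b t))" by (simp add: less_max_iff_disj)
    then show ?thesis by simp
  qed
  have mono: "\<Theta> p \<le> \<Theta> q"
    if pq: "0 < p" "p \<le> q" "q \<le> tt" and z: "\<And>t. p \<le> t \<Longrightarrow> t \<le> q \<Longrightarrow> z t \<ge> ln K1" for p q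
  proof -
    have "continuous_on {p..q} \<Theta>"
      unfolding \<Theta>_def using pq
      by (intro continuous_intros cont) (auto simp: max_nz)
    then obtain s where s: "s \<in> {p..q}" "\<And>t. t \<in> {p..q} \<Longrightarrow> \<Theta> s \<le> \<Theta> t"
      using continuous_attains_inf[of "{p..q}" \<Theta>] pq by auto
    have s0: "0 < s" "s \<le> tt" using s pq by auto
    have "s = p"
    proof (rule ccontr)
      assume "s \<noteq> p"
      then have ps: "p < s" using s by simp
      \<comment> \<open>The maximum makes \<Theta> possibly nondifferentiable. Instead, a minimum at
        s > p is refuted by a differentiable function that lies above \<Theta> to the left of s,
        touches it at s and has positive derivative. Each branch of the maximum provides
        one.\<close>
      have no: False if der: "(g has_real_derivative g1) (at s)" and pos: "g1 > 0"
        and r: "r > 0" and ge: "\<And>t. s - r < t \<Longrightarrow> t < s \<Longrightarrow> 0 < t \<Longrightarrow> \<Theta> t \<le> g t" and eq: "\<Theta> s = g s" for g g1 r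
      proof -
        obtain e where e: "e > 0" "\<And>h. 0 < h \<Longrightarrow> h < e \<Longrightarrow> g (s - h) < g s"
          using DERIV_pos_inc_left[OF der pos] by auto
        define h where "h = min e (min r (s - p)) / 2"
        have "0 < min e (min r (s - p))" using e r ps by simp
        moreover have "min e (min r (s - p)) \<le> e" "min e (min r (s - p)) \<le> r"
          "min e (min r (s - p)) \<le> s - p" by auto
        ultimately have h: "0 < h" "h < e" "h < r" "h < s - p" by (auto simp: h_def)
        have "\<Theta> (s - h) \<le> g (s - h)" using h pq by (intro ge) auto
        also have "\<dots> < \<Theta> s" using e(2)[OF h(1,2)] eq by simp
        finally show False using s(2)[of "s - h"] h s(1) by simp
      qed
      have "2 * (1 - a s) / s / 2 = (1 - a s) / s" using s0 by (simp add: field_simps)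
      then have dz: "((\<lambda>t. z t / 2) has_real_derivative (1 - a s) / s) (at s)"
        using DERIV_cdivide[OF der(3)[OF s0], of 2] by (simp only:)
      show False
      proof (cases "a s \<le> exp (- 1 - b s)")
        case True
        have "a s < 1"
        proof -
          have "exp (- 1 - b s) < 1" using bB(2)[OF s0] by simp
          with True show ?thesis by (rule order.strict_trans1)
        qed
        show False
        proof (rule no[of "\<lambda>t. z t / 2 + 1 / 2" "(1 - a s) / s" 1])
          show "((\<lambda>t. z t / 2 + 1 / 2) has_real_derivative (1 - a s) / s) (at s)"
            using DERIV_add[OF dz DERIV_const[of "1 / 2"]] by simp
          show "(1 - a s) / s > 0" using \<open>a s < 1\<close> s0 by simp
          show "\<Theta> s = z s / 2 + 1 / 2" using True by (simp add: \<Theta>_def max_def)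
          fix t
          have "ln (exp (- 1 - b t)) \<le> ln (max (a t) (exp (- 1 - b t)))"
            by (subst ln_le_cancel_iff) (auto simp: less_max_iff_disj)
          then show "\<Theta> t \<le> z t / 2 + 1 / 2" by (simp add: \<Theta>_def)
        qed simp
      next
        case False
        have "exp (- 1 - b s) \<ge> \<eta>" unfolding \<eta>_def using bB(1)[OF s0] by simp
        then have as: "a s > \<eta>" using False by simp
        then have apos: "a s > 0" using \<eta> by simp
        have "isCont a s" using der(1)[OF s0] by (rule DERIV_isCont)
        then have "eventually (\<lambda>t. a t > 0) (at s)"
          using apos by (simp add: isCont_def order_tendstoD)
        then obtain r where r: "r > 0" "\<And>t. t \<noteq> s \<Longrightarrow> dist t s < r \<Longrightarrow> a t > 0"
          by (auto simp: eventually_at)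
        let ?g1 = "(1 - a s) / s - (a1 s / a s + b1 s) / 2"
        show False
        proof (rule no[of "\<lambda>t. z t / 2 - (ln (a t) + b t) / 2" ?g1 r])
          show "((\<lambda>t. z t / 2 - (ln (a t) + b t) / 2) has_real_derivative ?g1) (at s)"
            using apos by (auto intro!: DERIV_diff dz DERIV_cdivide DERIV_add DERIV_cong[OF DERIV_chain2[OF DERIV_ln_divide]] der[OF s0])
          show "r > 0" by (rule r)
          show "\<Theta> s = z s / 2 - (ln (a s) + b s) / 2" using False by (simp add: \<Theta>_def max_def)
          show "\<Theta> t \<le> z t / 2 - (ln (a t) + b t) / 2" if "s - r < t" "t < s" for t
          proof -
            have "a t > 0" using that by (intro r(2)) (auto simp: dist_real_def)
            then have "ln (a t) \<le> ln (max (a t) (exp (- 1 - b t)))" by (subst ln_le_cancel_iff) auto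
            then show ?thesis by (simp add: \<Theta>_def)
          qed
          \<comment> \<open>The two errors 1/8 enter with the factor 1/2, so they reduce the lower
            bound 1/4 for 1/2 - a + a^2 to 1/8, which is still positive.\<close>
          have "s * (a1 s / a s) \<le> 1 - b s + 1 / 8"
          proof -
            have "s * a1 s \<le> a s * (1 - b s) + \<delta>" using s(1) by (intro a1 s0 z) auto
            moreover have "\<delta> \<le> a s * (1 / 8)" using as by (simp add: \<delta>_def)
            ultimately have "s * a1 s \<le> a s * (1 - b s + 1 / 8)" unfolding distrib_left by linarith
            then show ?thesis using apos by (simp add: pos_divide_le_eq mult.commute)
          qed
          moreover have "s * b1 s \<le> b s - 2 * (a s)\<^sup>2 + 1 / 8" using b1[OF s0] \<delta> by linarith
          moreover have "s * ?g1 = 1 - a s - (s * (a1 s / a s) + s * b1 s) / 2"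
          proof -
            have "s * ((1 - a s) / s) = 1 - a s" using s0 by simp
            moreover have "s * ((a1 s / a s + b1 s) / 2) = (s * (a1 s / a s) + s * b1 s) / 2"
              by (simp add: distrib_left)
            ultimately show ?thesis by (simp only: right_diff_distrib[of s "(1 - a s) / s"])
          qed
          moreover have "0 \<le> (a s - 1 / 2)\<^sup>2" by simp
          then have "1 / 2 - a s + (a s)\<^sup>2 \<ge> 1 / 4" by (simp add: power2_eq_square algebra_simps)
          moreover have "0 < E" if "P \<le> 1 - v + 1 / 8" "R \<le> v - 2 * w + 1 / 8"
            "E = 1 - u - (P + R) / 2" "1 / 4 \<le> 1 / 2 - u + w" for E P R u v w :: real
            using that by (simp add: field_simps)
          ultimately have "s * ?g1 > 0" by blast
          then show "?g1 > 0" using s0 by (simp add: zero_less_mult_iff)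
        qed
      qed
    qed
    then show ?thesis using s(2)[of q] pq by simp
  qed
  \<comment> \<open>The loss when \<Theta> is translated back into z: \<open>a <= A0\<close> and |b|
    <= B at the start, and \<Theta> <= z/2 + 1/2 at the end, doubled.\<close>
  define M where "M = ln (A0 + exp B) + B + 1"
  define Z where "Z = max (ln K1) (z tt) + \<bar>M\<bar>"
  have good: "z p \<le> Z" if p: "0 < p" "p \<le> tt" and ap: "a p \<le> A0" for p
  proof -
    have stop: "z p \<le> z q + M" if "p \<le> q" "q \<le> tt" "\<And>t. p \<le> t \<Longrightarrow> t \<le> q \<Longrightarrow> z t \<ge> ln K1" for q
    proof -
      have "\<Theta> p \<le> \<Theta> q" using that p by (intro mono) auto
      moreover have "\<Theta> q \<le> z q / 2 + 1 / 2"
      proof -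
        have "ln (exp (- 1 - b q)) \<le> ln (max (a q) (exp (- 1 - b q)))"
          by (subst ln_le_cancel_iff) (auto simp: less_max_iff_disj)
        then show ?thesis by (simp add: \<Theta>_def)
      qed
      moreover have "\<Theta> p \<ge> z p / 2 - (ln (A0 + exp B) + B) / 2"
      proof -
        have "exp (- 1 - b p) \<le> exp B" using bB[OF p] by simp
        then have "max (a p) (exp (- 1 - b p)) \<le> A0 + exp B"
          using ap A0 by (auto intro: add_increasing add_increasing2)
        then have "ln (max (a p) (exp (- 1 - b p))) \<le> ln (A0 + exp B)"
          by (subst ln_le_cancel_iff) (auto simp: less_max_iff_disj A0 add_pos_pos)
        then show ?thesis using bB[OF p] by (simp add: \<Theta>_def)
      qed
      ultimately show ?thesis by (simp add: M_def field_simps)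
    qed
    consider "z p \<le> ln K1" | "\<forall>t\<in>{p..tt}. z t > ln K1" | "z p > ln K1" "\<exists>t\<in>{p..tt}. z t \<le> ln K1"
      by (metis not_le)
    then show ?thesis
    proof cases
      case 1 then show ?thesis by (simp add: Z_def)
    next
      case 2
      then have "z p \<le> z tt + M" using p by (intro stop) (auto intro: less_imp_le)
      then show ?thesis by (simp add: Z_def)
    next
      case 3
      \<comment> \<open>Its least element is the first time at which z comes down to ln K1. Up to
        that time \<Theta> is monotone, and z is known there.\<close>
      define S where "S = {t \<in> {p..tt}. z t \<le> ln K1}"
      have contz: "continuous_on {p..tt} z" using p by (intro cont) auto
      have S: "S = {p..tt} \<inter> z -` {..ln K1}" by (auto simp: S_def)
      have "closed S" unfolding S by (rule continuous_closed_preimage[OF contz]) auto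
      then have "compact ({p..tt} \<inter> S)" by (intro compact_Int_closed) auto
      moreover have "{p..tt} \<inter> S = S" by (auto simp: S_def)
      ultimately have cpt: "compact S" by simp
      have ne: "S \<noteq> {}" using 3 by (auto simp: S_def)
      obtain q where q: "q \<in> S" "\<And>t. t \<in> S \<Longrightarrow> q \<le> t"
        using compact_attains_inf[OF cpt ne] by auto
      have zq: "z q \<ge> ln K1"
      proof (rule ccontr)
        assume "\<not> z q \<ge> ln K1"
        moreover have "continuous_on {p..q} z" using q by (intro continuous_on_subset[OF contz]) (auto simp: S_def)
        ultimately obtain t where t: "p \<le> t" "t \<le> q" "z t = ln K1"
          using IVT2'[of z q "ln K1" p] 3 q by (auto simp: S_def)
        then have "t \<in> S" using q by (auto simp: S_def)
        then have "t = q" using q(2)[of t] t by simp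
        then show False using t \<open>\<not> z q \<ge> ln K1\<close> by simp
      qed
      have "z p \<le> z q + M"
      proof (rule stop)
        fix t assume t: "p \<le> t" "t \<le> q"
        show "z t \<ge> ln K1"
        proof (cases "t = q")
          case False
          then have "t \<notin> S" using q(2)[of t] t by auto
          then show ?thesis using t q(1) by (auto simp: S_def)
        qed (use zq in simp)
      qed (use q in \<open>auto simp: S_def\<close>)
      then show ?thesis using q(1) by (auto simp: Z_def S_def)
    qed
  qed
  have z_bound: "z t \<le> Z + 2 * Co" if t: "0 < t" "t \<le> tt / 2" for t
  proof -
    have tT: "t \<le> T / 4" using t tt by simp
    obtain s where s: "s \<in> {t..2*t}" "\<bar>t * y1 i s\<bar> \<le> A1" using A1(2)[OF t(1) tT] by blast
    have "a s \<le> A0"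
    proof -
      have "a s \<le> s * \<bar>y1 i s\<bar>" unfolding a_def using s t by (intro mult_left_mono) auto
      also have "\<dots> \<le> 2 * t * \<bar>y1 i s\<bar>" using s by (intro mult_right_mono) auto
      also have "\<dots> \<le> A0" using s(2) t by (simp add: A0_def abs_mult)
      finally show ?thesis .
    qed
    then have "z s \<le> Z" using s t by (intro good) auto
    moreover have "\<bar>y i t - y i s\<bar> \<le> Co" using s t by (intro Co(2)[OF t(1) tT]) auto
    moreover have "ln t \<le> ln s" using s t by simp
    ultimately show ?thesis unfolding z_def by linarith
  qed
  \<comment> \<open>Times bounded away from 0 are settled by compactness.\<close>
  have "continuous_on {tt / 2..T / 4} (y i)" using tt T by (intro continuous_on_y) auto
  moreover have "{tt / 2..T / 4} \<noteq> {}" using tt by simp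
  ultimately obtain s where "\<forall>t\<in>{tt / 2..T / 4}. y i s \<le> y i t"
    using continuous_attains_inf[of "{tt / 2..T / 4}" "y i"] by blast
  then have s: "y i s \<le> y i t" if "t \<in> {tt / 2..T / 4}" for t using that by blast
  show ?thesis
  proof (intro exI[of _ "exp (max (Z + 2 * Co) (- 2 * y i s))"] conjI allI impI)
    fix t assume t: "0 < t" "t \<le> T / 4"
    have "t\<^sup>2 / X t i = exp (z t)" by (rule exp_z[OF t(1), symmetric])
    moreover have "z t \<le> max (Z + 2 * Co) (- 2 * y i s)"
    proof (cases "t \<le> tt / 2")
      case True
      then show ?thesis using z_bound[OF t(1)] by simp
    next
      case False
      then have "y i s \<le> y i t" using t by (intro s) auto
      moreover have "ln t \<le> 0" using t T by simp
      ultimately have "z t \<le> - 2 * y i s" unfolding z_def by linarith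
      then show ?thesis by simp
    qed
    ultimately show "t\<^sup>2 / X t i \<le> exp (max (Z + 2 * Co) (- 2 * y i s))" by simp
  qed simp
qed

text \<open>A positive Casimir eigenvalue prevents collapse through \<open>casimir_bound\<close>;
  when it vanishes, the monotone quantity above is needed. The constants for the finitely many
  indices are summed to get one for all.\<close>

lemma collapse_bound: "\<exists>C>0. \<forall>t i. 0 < t \<longrightarrow> t \<le> T / 4 \<longrightarrow> t\<^sup>2 / X t i \<le> C"
proof -
  have "\<exists>C>0. \<forall>t. 0 < t \<longrightarrow> t \<le> T / 4 \<longrightarrow> t\<^sup>2 / X t i \<le> C" for i
  proof (cases "casimir i = 0")
    case False
    then have c: "casimir i > 0" using casimir_nonneg[of i] by simp
    obtain C where C: "C > 0" "\<And>t i. 0 < t \<Longrightarrow> t \<le> T / 4 \<Longrightarrow> t\<^sup>2 * (casimir i / X t i) \<le> C"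
      using casimir_bound by blast
    show ?thesis
    proof (intro exI[of _ "C / casimir i"] conjI allI impI)
      fix t assume t: "0 < t" "t \<le> T / 4"
      show "t\<^sup>2 / X t i \<le> C / casimir i" using C(2)[OF t, of i] c by (simp add: pos_le_divide_eq mult.commute)
    qed (use C c in simp)
  qed (rule collapse_bound_casimir_zero)
  then have "\<forall>i. \<exists>C>0. \<forall>t. 0 < t \<longrightarrow> t \<le> T / 4 \<longrightarrow> t\<^sup>2 / X t i \<le> C" by blast
  from choice[OF this] obtain C where "\<forall>i. C i > 0 \<and> (\<forall>t. 0 < t \<longrightarrow> t \<le> T / 4 \<longrightarrow> t\<^sup>2 / X t i \<le> C i)"
    by blast
  then have C: "\<And>i. C i > 0" "\<And>i t. 0 < t \<Longrightarrow> t \<le> T / 4 \<Longrightarrow> t\<^sup>2 / X t i \<le> C i" by blast+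
  show ?thesis
  proof (intro exI[of _ "\<Sum>i\<in>UNIV. C i"] conjI allI impI)
    show "0 < (\<Sum>i\<in>UNIV. C i)" by (intro sum_pos C) auto
    fix t i assume "0 < t" "t \<le> T / 4"
    then have "t\<^sup>2 / X t i \<le> C i" by (rule C)
    also have "\<dots> \<le> (\<Sum>i\<in>UNIV. C i)" by (rule member_le_sum) (use C(1) in \<open>auto intro: less_imp_le\<close>)
    finally show "t\<^sup>2 / X t i \<le> (\<Sum>i\<in>UNIV. C i)" .
  qed
qed

section \<open>Bounds for R, y' and M near the singular time\<close>

lemma R_diag_bound: "\<exists>C>0. \<forall>t. 0 < t \<longrightarrow> t \<le> T / 4 \<longrightarrow> t\<^sup>2 * R_diag (X t) \<le> C"
proof -
  obtain K where K: "K > 0" "\<And>t i. 0 < t \<Longrightarrow> t \<le> T / 4 \<Longrightarrow> t\<^sup>2 / X t i \<le> K" using collapse_bound by blast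
  obtain C where C: "C \<ge> 1" "\<And>t s s' i. 0 < t \<Longrightarrow> t \<le> T / 4 \<Longrightarrow> s \<in> {t..2*t} \<Longrightarrow> s' \<in> {t..2*t}
    \<Longrightarrow> X s i \<le> C * X s' i" using X_ratio by blast
  obtain P where P: "P > 0" "\<And>t. 0 < t \<Longrightarrow> t \<le> T / 4 \<Longrightarrow> \<exists>s\<in>{t..2*t}. s\<^sup>2 * abs_ricci (X s) \<le> P"
    using abs_ricci_bounded_somewhere by blast
  define n where "n = real CARD('i)"
  define b where "b = (\<Sum>i\<in>UNIV. \<beta> i)"
  have b: "\<beta> i \<le> b" for i unfolding b_def by (rule member_le_sum) (use beta_nonneg in auto)
  have b0: "0 \<le> b" unfolding b_def by (intro sum_nonneg beta_nonneg)
  \<comment> \<open>One factor C for each of the three eigenvalues moved from s to t, 4 P for the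
    \<open>heron\<close> term and 4 C K for each of the two inverse eigenvalues in
    \<open>ratio_le_heron\<close>.\<close>
  define L where "L = C ^ 3 * (4 * P + 8 * b * C * K)"
  have L: "L \<ge> 0" using C P b0 K by (simp add: L_def)
  have tri: "t\<^sup>2 * (\<gamma> i k l * (X t i / (X t k * X t l))) \<le> L" if t: "0 < t" "t \<le> T / 4" for t i k l
  proof -
    obtain s where s: "s \<in> {t..2*t}" "s\<^sup>2 * abs_ricci (X s) \<le> P" using P(2)[OF t] by blast
    \<comment> \<open>The favourable time s may exceed T/4, where \<open>collapse_bound\<close> is
      silent, so the bound is taken at t and transported.\<close>
    have inv: "s\<^sup>2 / X s j \<le> 4 * C * K" for j
    proof -
      have "s\<^sup>2 / X s j \<le> (2 * t)\<^sup>2 / (X t j / C)"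
      proof (intro frac_le power_mono)
        show "X t j / C \<le> X s j" using C(2)[OF t _ s(1), of t j] C(1) t by (simp add: pos_divide_le_eq mult.commute)
      qed (use s t C in auto)
      also have "\<dots> = 4 * C * (t\<^sup>2 / X t j)" by (simp add: power2_eq_square)
      also have "\<dots> \<le> 4 * C * K" using C(1) K(2)[OF t] by (intro mult_left_mono) auto
      finally show ?thesis .
    qed
    have "X t i / (X t k * X t l) \<le> (C * X s i) / ((X s k / C) * (X s l / C))"
    proof (intro frac_le mult_mono)
      show "X t i \<le> C * X s i" "X s k / C \<le> X t k" "X s l / C \<le> X t l"
        using C(2)[OF t _ s(1), of t] C(2)[OF t s(1), of t] C(1) t
        by (auto simp: pos_divide_le_eq mult.commute)
    qed (use C(1) in auto)
    also have "\<dots> = C ^ 3 * (X s i / (X s k * X s l))" using C(1) by (simp add: power3_eq_cube)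
    finally have "t\<^sup>2 * (\<gamma> i k l * (X t i / (X t k * X t l))) \<le> s\<^sup>2 * (\<gamma> i k l * (C ^ 3 * (X s i / (X s k * X s l))))"
      using s t gamma_nonneg C(1) by (intro mult_mono power_mono) auto
    also have "\<dots> = C ^ 3 * (s\<^sup>2 * (\<gamma> i k l * (X s i / (X s k * X s l))))" by simp
    also have "\<dots> \<le> L" unfolding L_def
    proof (intro mult_left_mono)
      have "X s i / (X s k * X s l) \<le> 4 * \<bar>heron (X s i) (X s k) (X s l)\<bar> + 1 / X s k + 1 / X s l"
        by (intro ratio_le_heron) auto
      then have "\<gamma> i k l * (X s i / (X s k * X s l))
          \<le> \<gamma> i k l * (4 * \<bar>heron (X s i) (X s k) (X s l)\<bar> + 1 / X s k + 1 / X s l)"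
        by (intro mult_left_mono gamma_nonneg)
      also have "\<dots> = 4 * (\<gamma> i k l * \<bar>heron (X s i) (X s k) (X s l)\<bar>) + \<gamma> i k l * (1 / X s k + 1 / X s l)"
        by (simp add: distrib_left)
      also have "\<dots> \<le> 4 * abs_ricci (X s) + b * (1 / X s k + 1 / X s l)"
        using gamma_le_beta[of i k l] b[of i]
        by (intro add_mono mult_left_mono mult_right_mono heron_le_abs_ricci) auto
      finally have "s\<^sup>2 * (\<gamma> i k l * (X s i / (X s k * X s l))) \<le> s\<^sup>2 * (4 * abs_ricci (X s) + b * (1 / X s k + 1 / X s l))"
        by (intro mult_left_mono) auto
      also have "\<dots> = 4 * (s\<^sup>2 * abs_ricci (X s)) + b * (s\<^sup>2 / X s k + s\<^sup>2 / X s l)"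
        by (simp add: algebra_simps)
      also have "\<dots> \<le> 4 * P + b * (4 * C * K + 4 * C * K)"
        using s(2) b0 by (intro add_mono mult_left_mono inv) auto
      also have "\<dots> = 4 * P + 8 * b * C * K" by simp
      finally show "s\<^sup>2 * (\<gamma> i k l * (X s i / (X s k * X s l))) \<le> 4 * P + 8 * b * C * K" .
    qed (use C(1) in auto)
    finally show ?thesis .
  qed
  have "t\<^sup>2 * R_diag (X t) \<le> b * K + n * (n * (n * L))" if t: "0 < t" "t \<le> T / 4" for t
  proof -
    have "t\<^sup>2 * R_diag (X t) = (\<Sum>i\<in>UNIV. \<beta> i * (t\<^sup>2 / X t i)) +
        (\<Sum>i\<in>UNIV. \<Sum>k\<in>UNIV. \<Sum>l\<in>UNIV. t\<^sup>2 * (\<gamma> i k l * (X t i / (X t k * X t l))))"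
      by (simp add: R_diag_def distrib_left sum_distrib_left mult_ac)
    also have "\<dots> \<le> (\<Sum>i\<in>UNIV. \<beta> i * K) + (\<Sum>i\<in>(UNIV::'i set). \<Sum>k\<in>(UNIV::'i set). \<Sum>l\<in>(UNIV::'i set). L)"
      by (intro add_mono sum_mono mult_left_mono K(2) tri t beta_nonneg)
    also have "\<dots> = b * K + n * (n * (n * L))" by (simp add: n_def b_def sum_distrib_right)
    finally show ?thesis .
  qed
  then have "t\<^sup>2 * R_diag (X t) \<le> b * K + n * (n * (n * L)) + 1" if "0 < t" "t \<le> T / 4" for t
    using that by (meson less_add_one less_imp_le order_trans)
  moreover have "b * K + n * (n * (n * L)) + 1 > 0" using b0 K L by (simp add: n_def add_nonneg_pos)
  ultimately show ?thesis by blast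
qed

text \<open>The derivative is bounded at a slow point s of [t, 2t] and is carried back to t. In
  \<open>y''\<close> the product \<xi> y' is at most B (y'^2 + 1/t^2); adding B \<xi> absorbs the
  square, and all other terms are of order 1/t^2. T/8 keeps [t, 2t] inside the range of
  \<open>R_diag_bound\<close>.\<close>

lemma y1_bound: "\<exists>C>0. \<forall>t i. 0 < t \<longrightarrow> t \<le> T / 8 \<longrightarrow> \<bar>t * y1 i t\<bar> \<le> C"
proof -
  obtain R where R: "R > 0" "\<And>t. 0 < t \<Longrightarrow> t \<le> T / 4 \<Longrightarrow> t\<^sup>2 * R_diag (X t) \<le> R" using R_diag_bound by blast
  obtain Q where Q: "Q > 0" "\<And>X i. \<forall>i. X i > 0 \<Longrightarrow> \<bar>ric X i\<bar> \<le> Q * R_diag X" using abs_ric_le_R_diag by blast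
  obtain B where B: "B > 0" "\<And>t. 0 < t \<Longrightarrow> t \<le> T / 2 \<Longrightarrow> \<bar>t * \<xi> t\<bar> \<le> B" using xi_bound by blast
  obtain A where A: "A > 0" "\<And>t i. 0 < t \<Longrightarrow> t \<le> T / 4 \<Longrightarrow> \<exists>s\<in>{t..2*t}. \<bar>t * y1 i s\<bar> \<le> A"
    using slow_point by blast
  define N where "N = B + H * Q * R + B * \<bar>\<Lambda>\<bar> + \<bar>\<Lambda>\<bar>"
  have N: "N > 0" using B H Q R by (simp add: N_def add_pos_pos add_pos_nonneg)
  have bound: "\<bar>t * y1 i t\<bar> \<le> A + 2 * B * B + N" if t: "0 < t" "t \<le> T / 8" for t i
  proof -
    obtain s where s: "s \<in> {t..2*t}" "\<bar>t * y1 i s\<bar> \<le> A" using A(2)[of t i] t T by auto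
    define L where "L = N / t\<^sup>2"
    have step: "e * y1 i s + B * \<xi> s - L * s \<le> e * y1 i t + B * \<xi> t - L * t" if e: "\<bar>e\<bar> = 1" for e
    proof (rule DERIV_nonpos_imp_nonincreasing[of t s "\<lambda>x. e * y1 i x + B * \<xi> x - L * x"])
      fix x assume x: "t \<le> x" "x \<le> s"
      have xT: "0 < x" "x < T" "x \<le> T / 4" "x \<le> T / 2" using x s t T by auto
      let ?y2 = "- \<xi> x * y1 i x + H * ric (X x) i - \<Lambda>"
      have "((\<lambda>x. e * y1 i x + B * \<xi> x - L * x) has_real_derivative
          e * ?y2 + B * xi1 x - L) (at x)"
        using xT by (auto intro!: derivative_eq_intros xi' y1)
      moreover have "e * ?y2 + B * xi1 x - L \<le> 0"
      proof -
        have "e * ?y2 \<le> \<bar>?y2\<bar>" using abs_ge_self[of "e * ?y2"] unfolding abs_mult e by simp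
        also have "\<dots> \<le> \<bar>\<xi> x\<bar> * \<bar>y1 i x\<bar> + H * \<bar>ric (X x) i\<bar> + \<bar>\<Lambda>\<bar>"
        proof -
          have "\<bar>- \<xi> x * y1 i x\<bar> = \<bar>\<xi> x\<bar> * \<bar>y1 i x\<bar>" "\<bar>H * ric (X x) i\<bar> = H * \<bar>ric (X x) i\<bar>"
            using H by (simp_all add: abs_mult)
          then show ?thesis by linarith
        qed
        also have "\<bar>\<xi> x\<bar> * \<bar>y1 i x\<bar> \<le> B * ((y1 i x)\<^sup>2 + 1 / t\<^sup>2)"
        proof -
          have "t * \<bar>\<xi> x\<bar> \<le> x * \<bar>\<xi> x\<bar>" using x by (intro mult_right_mono) auto
          also have "\<dots> \<le> B" using B(2)[OF xT(1,4)] xT by (simp add: abs_mult)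
          finally have "\<bar>\<xi> x\<bar> \<le> B / t" using t by (simp add: field_simps)
          then have "\<bar>\<xi> x\<bar> * \<bar>y1 i x\<bar> \<le> B / t * \<bar>y1 i x\<bar>" by (intro mult_right_mono) auto
          also have "\<dots> = B * (1 / t * \<bar>y1 i x\<bar>)" by simp
          also have "\<dots> \<le> B * ((y1 i x)\<^sup>2 + 1 / t\<^sup>2)"
          proof (intro mult_left_mono)
            have "2 * (1 / t * \<bar>y1 i x\<bar>) \<le> (1 / t)\<^sup>2 + \<bar>y1 i x\<bar>\<^sup>2"
              using sum_squares_bound[of "1 / t" "\<bar>y1 i x\<bar>"] by (simp add: mult.assoc)
            moreover have "1 / t * \<bar>y1 i x\<bar> \<ge> 0" using t by simp
            ultimately show "1 / t * \<bar>y1 i x\<bar> \<le> (y1 i x)\<^sup>2 + 1 / t\<^sup>2"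
              unfolding power2_abs power_one_over by linarith
          qed (use B in simp)
          finally show ?thesis .
        qed
        also have "H * \<bar>ric (X x) i\<bar> \<le> H * Q * R / t\<^sup>2"
        proof -
          have "t\<^sup>2 * R_diag (X x) \<le> R"
          proof (cases "R_diag (X x) \<ge> 0")
            case True
            then have "t\<^sup>2 * R_diag (X x) \<le> x\<^sup>2 * R_diag (X x)" using x t by (intro mult_right_mono power_mono) auto
            then show ?thesis using R(2)[OF xT(1,3)] by simp
          next
            case False
            then have "t\<^sup>2 * R_diag (X x) \<le> 0" by (simp add: mult_nonneg_nonpos)
            then show ?thesis using R(1) by linarith
          qed
          then have "R_diag (X x) \<le> R / t\<^sup>2" using t by (simp add: pos_le_divide_eq mult.commute)
          then have "H * (Q * R_diag (X x)) \<le> H * (Q * (R / t\<^sup>2))" using H Q by (intro mult_left_mono) auto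
          moreover have "H * \<bar>ric (X x) i\<bar> \<le> H * (Q * R_diag (X x))" using H by (intro mult_left_mono Q) auto
          ultimately show ?thesis by simp
        qed
        finally have 1: "e * ?y2 \<le> B * ((y1 i x)\<^sup>2 + 1 / t\<^sup>2) + H * Q * R / t\<^sup>2 + \<bar>\<Lambda>\<bar>" by simp
        have "B * xi1 x \<le> B * (- 2 * (y1 i x)\<^sup>2 + \<bar>\<Lambda>\<bar>)"
          using B by (intro mult_left_mono xi1_le') auto
        also have "\<dots> \<le> - (B * (y1 i x)\<^sup>2) + B * \<bar>\<Lambda>\<bar>" using B by (simp add: algebra_simps)
        finally have 2: "B * xi1 x \<le> - (B * (y1 i x)\<^sup>2) + B * \<bar>\<Lambda>\<bar>" .
        have "B * \<bar>\<Lambda>\<bar> + \<bar>\<Lambda>\<bar> \<le> (B * \<bar>\<Lambda>\<bar> + \<bar>\<Lambda>\<bar>) / t\<^sup>2"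
        proof -
          have "t\<^sup>2 \<le> 1" using t T by (simp add: power_le_one)
          then have "(B * \<bar>\<Lambda>\<bar> + \<bar>\<Lambda>\<bar>) * t\<^sup>2 \<le> (B * \<bar>\<Lambda>\<bar> + \<bar>\<Lambda>\<bar>) * 1" using B by (intro mult_left_mono) auto
          then show ?thesis using t by (simp add: pos_le_divide_eq)
        qed
        moreover have "L = B / t\<^sup>2 + H * Q * R / t\<^sup>2 + (B * \<bar>\<Lambda>\<bar> + \<bar>\<Lambda>\<bar>) / t\<^sup>2"
          by (simp add: L_def N_def add_divide_distrib)
        moreover have "B * ((y1 i x)\<^sup>2 + 1 / t\<^sup>2) = B * (y1 i x)\<^sup>2 + B / t\<^sup>2" by (simp add: distrib_left)
        ultimately show ?thesis using 1 2 by linarith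
      qed
      ultimately show "\<exists>z. ((\<lambda>x. e * y1 i x + B * \<xi> x - L * x) has_real_derivative z) (at x) \<and> z \<le> 0"
        by blast
    qed (use s in auto)
    have xs: "t * \<bar>\<xi> r\<bar> \<le> B" if "r \<in> {t..2*t}" for r
    proof -
      have "t * \<bar>\<xi> r\<bar> \<le> r * \<bar>\<xi> r\<bar>" using that by (intro mult_right_mono) auto
      also have "\<dots> \<le> B" using B(2)[of r] that t T by (simp add: abs_mult)
      finally show ?thesis .
    qed
    have u1: "t * (L * (s - t)) \<le> N"
    proof -
      have "t * (L * (s - t)) \<le> t * (L * t)"
        using s t N by (intro mult_left_mono) (auto simp: L_def)
      then show ?thesis using t by (simp add: L_def power2_eq_square)
    qed
    have u2: "t * (B * (\<xi> t - \<xi> s)) \<le> 2 * B * B"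
    proof -
      have "t * (\<xi> t - \<xi> s) \<le> t * (\<bar>\<xi> t\<bar> + \<bar>\<xi> s\<bar>)" using t by (intro mult_left_mono) auto
      also have "\<dots> \<le> 2 * B" using xs[of t] xs[of s] s t by (simp add: distrib_left)
      finally have "B * (t * (\<xi> t - \<xi> s)) \<le> B * (2 * B)" using B by (intro mult_left_mono) auto
      then show ?thesis by (simp add: mult_ac)
    qed
    have "t * (e * y1 i s) \<le> t * (e * y1 i t) + t * (B * (\<xi> t - \<xi> s)) + t * (L * (s - t))"
      if "\<bar>e\<bar> = 1" for e
      using mult_left_mono[OF step[OF that], of t] t by (simp add: algebra_simps)
    from this[of 1] this[of "-1"] u1 u2 s(2)
    show ?thesis by (simp add: abs_le_iff)
  qed
  show ?thesis
  proof (intro exI[of _ "A + 2 * B * B + N"] conjI allI impI bound)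
    show "A + 2 * B * B + N > 0" using A B N by (simp add: add_pos_pos)
  qed
qed

lemma M_bound:
  "\<exists>C. \<forall>t. 0 < t \<longrightarrow> t \<le> T / 8 \<longrightarrow>
    t\<^sup>2 * ((\<xi> t)\<^sup>2 + (\<Sum>i\<in>UNIV. d i * (y1 i t)\<^sup>2) + R_diag (X t)) \<le> C"
proof -
  obtain R where R: "R > 0" "\<And>t. 0 < t \<Longrightarrow> t \<le> T / 4 \<Longrightarrow> t\<^sup>2 * R_diag (X t) \<le> R" using R_diag_bound by blast
  obtain B where B: "B > 0" "\<And>t. 0 < t \<Longrightarrow> t \<le> T / 2 \<Longrightarrow> \<bar>t * \<xi> t\<bar> \<le> B" using xi_bound by blast
  obtain V where V: "V > 0" "\<And>t i. 0 < t \<Longrightarrow> t \<le> T / 8 \<Longrightarrow> \<bar>t * y1 i t\<bar> \<le> V" using y1_bound by blast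
  have sq: "x\<^sup>2 \<le> c\<^sup>2" if "\<bar>x\<bar> \<le> c" for x c :: real
    using that by (simp add: abs_le_square_iff[symmetric])
  show ?thesis
  proof (intro exI allI impI)
    fix t assume t: "0 < t" "t \<le> T / 8"
    have "t\<^sup>2 * ((\<xi> t)\<^sup>2 + (\<Sum>i\<in>UNIV. d i * (y1 i t)\<^sup>2) + R_diag (X t)) =
       (t * \<xi> t)\<^sup>2 + (\<Sum>i\<in>UNIV. d i * (t * y1 i t)\<^sup>2) + t\<^sup>2 * R_diag (X t)"
      by (simp add: distrib_left sum_distrib_left power_mult_distrib mult_ac)
    also have "\<dots> \<le> B\<^sup>2 + (\<Sum>i\<in>UNIV. d i * V\<^sup>2) + R"
      using t T by (intro add_mono sum_mono mult_left_mono sq V B R) auto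
    finally show "t\<^sup>2 * ((\<xi> t)\<^sup>2 + (\<Sum>i\<in>UNIV. d i * (y1 i t)\<^sup>2) + R_diag (X t))
      \<le> B\<^sup>2 + (\<Sum>i\<in>UNIV. d i * V\<^sup>2) + R" .
  qed
qed

end

section \<open>The Lie bracket in a chart\<close>

text \<open>The mean value theorem in direction \<open>v\<close> is applied to the increment of
  \<open>f\<close> in direction \<open>w\<close>. Only the partial derivative in direction
  \<open>v\<close> has to be differentiable, and only at \<open>p\<close>.\<close>

lemma second_difference:
  fixes f :: "'a::real_normed_vector \<Rightarrow> real"
  assumes S: "open S" "p \<in> S"
    and f: "\<And>x. x \<in> S \<Longrightarrow> (f has_derivative f' x) (at x)"
    and D: "((\<lambda>x. f' x v) has_derivative D) (at p)"
    and e: "0 < e"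
  shows "\<exists>\<delta>>0. \<forall>s. 0 < s \<longrightarrow> s < \<delta> \<longrightarrow>
    \<bar>f (p + s *\<^sub>R v + s *\<^sub>R w) - f (p + s *\<^sub>R v) - f (p + s *\<^sub>R w) + f p - s\<^sup>2 * D w\<bar> \<le> e * s\<^sup>2"
proof -
  define c where "c = 2 * norm v + norm w + 1"
  have c: "c > 0" by (simp add: c_def add_nonneg_pos)
  obtain r where r: "r > 0" "ball p r \<subseteq> S" using S open_contains_ball by blast
  have lin: "bounded_linear D" using D by (rule has_derivative_bounded_linear)
  obtain r' where r': "r' > 0"
    "\<And>x. norm (x - p) < r' \<Longrightarrow> norm (f' x v - f' p v - D (x - p)) \<le> e / c * norm (x - p)"
    using D[unfolded has_derivative_at_alt] e c by (meson divide_pos_pos)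
  define \<delta> where "\<delta> = min r r' / c"
  show ?thesis
  proof (intro exI[of _ \<delta>] conjI allI impI)
    show "\<delta> > 0" using r r' c by (simp add: \<delta>_def)
    fix s assume s: "0 < s" "s < \<delta>"
    then have sc: "s * c < min r r'" using c by (simp add: \<delta>_def pos_less_divide_eq)
    have small: "norm (\<theta> *\<^sub>R v + \<sigma> *\<^sub>R w) \<le> s * (norm v + norm w)" "norm (\<theta> *\<^sub>R v + \<sigma> *\<^sub>R w) < min r r'"
      if "0 \<le> \<theta>" "\<theta> \<le> s" "0 \<le> \<sigma>" "\<sigma> \<le> s" for \<theta> \<sigma>
    proof -
      have "norm (\<theta> *\<^sub>R v + \<sigma> *\<^sub>R w) \<le> \<theta> * norm v + \<sigma> * norm w"
        using norm_triangle_ineq[of "\<theta> *\<^sub>R v" "\<sigma> *\<^sub>R w"] that by simp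
      also have "\<dots> \<le> s * norm v + s * norm w" using that by (intro add_mono mult_right_mono) auto
      finally show 1: "norm (\<theta> *\<^sub>R v + \<sigma> *\<^sub>R w) \<le> s * (norm v + norm w)" by (simp add: distrib_left)
      have "s * (norm v + norm w) \<le> s * c" using s by (intro mult_left_mono) (auto simp: c_def)
      then show "norm (\<theta> *\<^sub>R v + \<sigma> *\<^sub>R w) < min r r'" using 1 sc by linarith
    qed
    have inS: "p + \<theta> *\<^sub>R v + \<sigma> *\<^sub>R w \<in> S" if "0 \<le> \<theta>" "\<theta> \<le> s" "0 \<le> \<sigma>" "\<sigma> \<le> s" for \<theta> \<sigma>
    proof -
      have "dist p (p + \<theta> *\<^sub>R v + \<sigma> *\<^sub>R w) < r"
        using small(2)[OF that] norm_minus_cancel[of "\<theta> *\<^sub>R v + \<sigma> *\<^sub>R w"] by (simp add: dist_norm algebra_simps)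
      then show ?thesis using r(2) by auto
    qed
    define g where "g \<theta> = f (p + \<theta> *\<^sub>R v + s *\<^sub>R w) - f (p + \<theta> *\<^sub>R v)" for \<theta>
    define g1 where "g1 \<theta> = f' (p + \<theta> *\<^sub>R v + s *\<^sub>R w) v - f' (p + \<theta> *\<^sub>R v) v" for \<theta>
    have der: "(g has_real_derivative g1 \<theta>) (at \<theta>)" if \<theta>: "0 \<le> \<theta>" "\<theta> \<le> s" for \<theta>
    proof -
      have one: "((\<lambda>\<theta>. f (p + \<theta> *\<^sub>R v + q)) has_real_derivative f' (p + \<theta> *\<^sub>R v + q) v) (at \<theta>)"
        if "p + \<theta> *\<^sub>R v + q \<in> S" for q
      proof -
        have "((\<lambda>\<theta>. p + \<theta> *\<^sub>R v + q) has_derivative (\<lambda>h. h *\<^sub>R v)) (at \<theta>)"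
          by (auto intro!: derivative_eq_intros)
        from has_derivative_compose[OF this f[OF that]]
        have "((\<lambda>\<theta>. f (p + \<theta> *\<^sub>R v + q)) has_derivative (\<lambda>h. f' (p + \<theta> *\<^sub>R v + q) (h *\<^sub>R v))) (at \<theta>)" .
        moreover have "f' (p + \<theta> *\<^sub>R v + q) (h *\<^sub>R v) = f' (p + \<theta> *\<^sub>R v + q) v * h" for h
          using linear_scale[OF has_derivative_linear[OF f[OF that]]] by simp
        ultimately show ?thesis by (simp add: has_field_derivative_def)
      qed
      show ?thesis unfolding g_def g1_def
        using one[of "s *\<^sub>R w"] one[of 0] inS[OF \<theta>, of s] inS[OF \<theta>, of 0] s
        by (intro DERIV_diff) auto
    qed
    obtain \<theta> where \<theta>: "0 < \<theta>" "\<theta> < s" "g s - g 0 = (s - 0) * g1 \<theta>"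
      using MVT2[OF s(1), of g g1] der by auto
    define h where "h = \<theta> *\<^sub>R v + s *\<^sub>R w"
    define k where "k = \<theta> *\<^sub>R v + 0 *\<^sub>R w"
    have h: "norm h \<le> s * (norm v + norm w)" "norm h < r'" and k: "norm k \<le> s * norm v" "norm k < r'"
      using small[of \<theta> s] small[of \<theta> 0] \<theta> s
      by (auto simp: h_def k_def intro!: mult_right_mono)
    have "norm (f' (p + h) v - f' p v - D h) \<le> e / c * norm h" using r'(2)[of "p + h"] h by simp
    moreover have "norm (f' (p + k) v - f' p v - D k) \<le> e / c * norm k" using r'(2)[of "p + k"] k by simp
    moreover have "D h - D k = s * D w"
      unfolding h_def k_def using lin by (simp add: linear_simps)
    moreover have "g1 \<theta> = f' (p + h) v - f' (p + k) v" by (simp add: g1_def h_def k_def add.assoc)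
    ultimately have "\<bar>g1 \<theta> - s * D w\<bar> \<le> e / c * norm h + e / c * norm k" by simp
    also have "\<dots> = e / c * (norm h + norm k)" by (simp add: distrib_left)
    also have "\<dots> \<le> e / c * (s * c)"
    proof (intro mult_left_mono)
      have "norm h + norm k \<le> s * (2 * norm v + norm w)" using h k by (simp add: distrib_left)
      also have "\<dots> \<le> s * c" using s by (intro mult_left_mono) (auto simp: c_def)
      finally show "norm h + norm k \<le> s * c" .
    qed (use e c in auto)
    also have "\<dots> = e * s" using c by simp
    finally have "s * \<bar>g1 \<theta> - s * D w\<bar> \<le> s * (e * s)" using s by (intro mult_left_mono) auto
    moreover have "s * \<bar>g1 \<theta> - s * D w\<bar> = \<bar>g s - g 0 - s\<^sup>2 * D w\<bar>"
    proof -
      have "g s - g 0 - s\<^sup>2 * D w = s * (g1 \<theta> - s * D w)"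
        using \<theta> by (simp add: right_diff_distrib power2_eq_square)
      then show ?thesis using s by (simp add: abs_mult)
    qed
    ultimately show "\<bar>f (p + s *\<^sub>R v + s *\<^sub>R w) - f (p + s *\<^sub>R v) - f (p + s *\<^sub>R w) + f p - s\<^sup>2 * D w\<bar> \<le> e * s\<^sup>2"
      by (simp add: g_def power2_eq_square mult_ac algebra_simps)
  qed
qed

text \<open>The second difference does not depend on the order of \<open>v\<close> and
  \<open>w\<close>, and divided by s^2 it tends to both \<open>D w\<close> and
  \<open>E v\<close>.\<close>

lemma second_derivative_symmetric_real:
  fixes f :: "'a::real_normed_vector \<Rightarrow> real"
  assumes S: "open S" "p \<in> S"
    and f: "\<And>x. x \<in> S \<Longrightarrow> (f has_derivative f' x) (at x)"
    and D: "((\<lambda>x. f' x v) has_derivative D) (at p)"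
    and E: "((\<lambda>x. f' x w) has_derivative E) (at p)"
  shows "D w = E v"
proof -
  have "\<bar>D w - E v\<bar> \<le> 2 * e" if "0 < e" for e
  proof -
    obtain \<delta> where \<delta>: "\<delta> > 0" "\<And>s. 0 < s \<Longrightarrow> s < \<delta> \<Longrightarrow>
      \<bar>f (p + s *\<^sub>R v + s *\<^sub>R w) - f (p + s *\<^sub>R v) - f (p + s *\<^sub>R w) + f p - s\<^sup>2 * D w\<bar> \<le> e * s\<^sup>2"
      using second_difference[OF S f D \<open>0 < e\<close>, of w] by auto
    obtain \<delta>' where \<delta>': "\<delta>' > 0" "\<And>s. 0 < s \<Longrightarrow> s < \<delta>' \<Longrightarrow>
      \<bar>f (p + s *\<^sub>R w + s *\<^sub>R v) - f (p + s *\<^sub>R w) - f (p + s *\<^sub>R v) + f p - s\<^sup>2 * E v\<bar> \<le> e * s\<^sup>2"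
      using second_difference[OF S f E \<open>0 < e\<close>, of v] by auto
    define s where "s = min \<delta> \<delta>' / 2"
    have "0 < min \<delta> \<delta>'" "min \<delta> \<delta>' \<le> \<delta>" "min \<delta> \<delta>' \<le> \<delta>'" using \<delta>(1) \<delta>'(1) by auto
    then have s: "0 < s" "s < \<delta>" "s < \<delta>'" by (auto simp: s_def)
    have eq: "p + s *\<^sub>R w + s *\<^sub>R v = p + s *\<^sub>R v + s *\<^sub>R w" by simp
    have "\<bar>s\<^sup>2 * D w - s\<^sup>2 * E v\<bar> \<le> 2 * (e * s\<^sup>2)"
      using \<delta>(2)[OF s(1,2)] \<delta>'(2)[OF s(1,3)] unfolding eq by linarith
    moreover have "\<bar>s\<^sup>2 * D w - s\<^sup>2 * E v\<bar> = s\<^sup>2 * \<bar>D w - E v\<bar>"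
      unfolding right_diff_distrib[symmetric] abs_mult by simp
    ultimately have "s\<^sup>2 * \<bar>D w - E v\<bar> \<le> s\<^sup>2 * (2 * e)" by (simp add: mult_ac)
    then show ?thesis using s by simp
  qed
  from this[of "e / 2" for e] have "\<bar>D w - E v\<bar> \<le> 0 + e" if "0 < e" for e using that by simp
  then have "\<bar>D w - E v\<bar> \<le> 0" by (rule field_le_epsilon)
  then show ?thesis by simp
qed

lemma second_derivative_symmetric:
  fixes f :: "'a::real_normed_vector \<Rightarrow> 'b::euclidean_space"
  assumes S: "open S" "p \<in> S"
    and f: "\<And>x. x \<in> S \<Longrightarrow> (f has_derivative f' x) (at x)"
    and D: "((\<lambda>x. f' x v) has_derivative D) (at p)"
    and E: "((\<lambda>x. f' x w) has_derivative E) (at p)"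
  shows "D w = E v"
proof (rule euclidean_eqI)
  fix b :: 'b
  show "D w \<bullet> b = E v \<bullet> b"
    by (rule second_derivative_symmetric_real[OF S, of "\<lambda>x. f x \<bullet> b" "\<lambda>x h. f' x h \<bullet> b"])
       (auto intro!: has_derivative_inner_left f D E)
qed

text \<open>A Lie group seen in a chart around the identity \<open>e\<close>, with \<open>m\<close>
  and \<open>i\<close> the product and the inverse. Both are considered only on open sets where the
  results stay in the chart.\<close>

locale local_group =
  fixes m :: "'e::euclidean_space \<times> 'e \<Rightarrow> 'e" and i :: "'e \<Rightarrow> 'e" and e :: 'e
    and W2 :: "('e \<times> 'e) set" and W1 :: "'e set"
  assumes W2: "open W2" and W1: "open W1" "e \<in> W1"
    and m_C2: "Ck_on (Suc (Suc 0)) W2 m"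
    and i_diff: "i differentiable (at e)"
    and dom: "x \<in> W1 \<Longrightarrow> (x, e) \<in> W2" "x \<in> W1 \<Longrightarrow> (e, x) \<in> W2" "x \<in> W1 \<Longrightarrow> (x, i x) \<in> W2"
    and right_id: "x \<in> W1 \<Longrightarrow> m (x, e) = x"
    and left_id: "x \<in> W1 \<Longrightarrow> m (e, x) = x"
    and i_e: "i e = e"
    and right_inv: "x \<in> W1 \<Longrightarrow> m (x, i x) = e"
begin

definition Dm :: "'e \<times> 'e \<Rightarrow> 'e \<times> 'e \<Rightarrow> 'e" where
  "Dm p = frechet_derivative m (at p)"

definition D2 :: "'e \<times> 'e \<Rightarrow> 'e \<times> 'e \<Rightarrow> 'e" where
  "D2 w = frechet_derivative (\<lambda>p. Dm p w) (at (e, e))"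

text \<open>The derivative at \<open>e\<close> of conjugation by \<open>x\<close>, that is the
  adjoint action: first the derivative of left multiplication by \<open>x\<close>, then that of
  right multiplication by the inverse.\<close>

definition conj_deriv :: "'e \<Rightarrow> 'e \<Rightarrow> 'e" where
  "conj_deriv x Z = Dm (x, i x) (Dm (x, e) (0, Z), 0)"

text \<open>The Lie bracket as the antisymmetrized mixed second derivative of the multiplication at
  the identity.\<close>

definition brac :: "'e \<Rightarrow> 'e \<Rightarrow> 'e" where
  "brac Y Z = D2 (0, Z) (Y, 0) - D2 (Z, 0) (0, Y)"

lemma ee: "(e, e) \<in> W2" using dom(1)[OF W1(2)] .

lemma Dm: "p \<in> W2 \<Longrightarrow> (m has_derivative Dm p) (at p)"
  using m_C2 by (auto simp: Dm_def frechet_derivative_works)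

lemma D2: "((\<lambda>p. Dm p w) has_derivative D2 w) (at (e, e))"
proof -
  have "(\<lambda>p. Dm p w) differentiable (at (e, e))"
    using m_C2 ee by (cases w) (auto simp: Dm_def)
  then show ?thesis by (simp add: D2_def frechet_derivative_works)
qed

lemma Dm_linear: "p \<in> W2 \<Longrightarrow> linear (Dm p)"
  using Dm has_derivative_linear by blast

lemma D2_linear: "linear (D2 w)"
  using D2 has_derivative_linear by blast

lemma Dm_fst:
  assumes "x \<in> W1" shows "Dm (x, e) (v, 0) = v"
proof -
  have "((\<lambda>x. m (x, e)) has_derivative (\<lambda>h. Dm (x, e) (h, 0))) (at x)"
    by (rule has_derivative_compose[of "\<lambda>x. (x, e)" "\<lambda>h. (h, 0)" x UNIV m, OF _ Dm[OF dom(1)[OF assms]]])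
       (auto intro!: derivative_eq_intros)
  moreover have "((\<lambda>x. m (x, e)) has_derivative (\<lambda>h. h)) (at x)"
    by (rule has_derivative_transform_within_open[OF has_derivative_ident W1(1) assms]) (simp add: right_id)
  ultimately show ?thesis using has_derivative_unique by metis
qed

lemma Dm_snd: "Dm (e, e) (0, v) = v"
proof -
  have "((\<lambda>x. m (e, x)) has_derivative (\<lambda>h. Dm (e, e) (0, h))) (at e)"
    by (rule has_derivative_compose[of "\<lambda>x. (e, x)" "\<lambda>h. (0, h)" e UNIV m, OF _ Dm[OF ee]])
       (auto intro!: derivative_eq_intros)
  moreover have "((\<lambda>x. m (e, x)) has_derivative (\<lambda>h. h)) (at e)"
    by (rule has_derivative_transform_within_open[OF has_derivative_ident W1]) (simp add: left_id)
  ultimately show ?thesis using has_derivative_unique by metis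
qed

lemma Dm_e: "Dm (e, e) (v, w) = v + w"
  using linear_add[OF Dm_linear[OF ee], of "(v, 0)" "(0, w)"] Dm_fst[OF W1(2)] Dm_snd by simp

text \<open>Differentiate x x^-1 = e at the identity, where the derivative of the product is
  addition.\<close>

lemma i_deriv: "(i has_derivative uminus) (at e)"
proof -
  obtain i' where i': "(i has_derivative i') (at e)" using i_diff by (auto simp: differentiable_def)
  have "((\<lambda>x. m (x, i x)) has_derivative (\<lambda>h. Dm (e, e) (h, i' h))) (at e)"
    by (rule has_derivative_compose[of "\<lambda>x. (x, i x)" "\<lambda>h. (h, i' h)" e UNIV m])
       (auto intro!: derivative_eq_intros i' simp: i_e Dm[OF ee])
  moreover have "((\<lambda>x. m (x, i x)) has_derivative (\<lambda>h. 0)) (at e)"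
    by (rule has_derivative_transform_within_open[OF has_derivative_const W1]) (simp add: right_inv)
  ultimately have "(\<lambda>h. Dm (e, e) (h, i' h)) = (\<lambda>h. 0)" by (rule has_derivative_unique)
  then have "i' h = - h" for h
    using Dm_e[of h "i' h"] by (metis add_eq_0_iff)
  then have "i' = uminus" by auto
  then show ?thesis using i' by simp
qed

lemma D2_sym: "D2 w v = D2 v w"
  by (rule second_derivative_symmetric[OF W2 ee, of m Dm]) (auto intro: Dm D2)

text \<open>The product with the identity on the right is the identity map, whose first derivative
  is constant.\<close>

lemma D2_fst_fst: "D2 (b, 0) (h, 0) = 0"
proof -
  have "((\<lambda>x. Dm (x, e) (b, 0)) has_derivative (\<lambda>h. D2 (b, 0) (h, 0))) (at e)"
    by (rule has_derivative_compose[of "\<lambda>x. (x, e)" "\<lambda>h. (h, 0)" e UNIV "\<lambda>p. Dm p (b, 0)", OF _ D2])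
       (auto intro!: derivative_eq_intros)
  moreover have "((\<lambda>x. Dm (x, e) (b, 0)) has_derivative (\<lambda>h. 0)) (at e)"
    by (rule has_derivative_transform_within_open[OF has_derivative_const W1]) (simp add: Dm_fst)
  ultimately have "(\<lambda>h. D2 (b, 0) (h, 0)) = (\<lambda>h. 0)" by (rule has_derivative_unique)
  then show ?thesis by metis
qed

lemma D2_fst_diff: "D2 (b, 0) (h, - h) = - D2 (b, 0) (0, h)"
proof -
  have "D2 (b, 0) (h, - h) = D2 (b, 0) (h, 0) - D2 (b, 0) (0, h)"
    using linear_diff[OF D2_linear[of "(b, 0)"], of "(h, 0)" "(0, h)"] by simp
  then show ?thesis by (simp add: D2_fst_fst)
qed

lemma conj_deriv_e: "conj_deriv e Z = Z"
  by (simp add: conj_deriv_def i_e Dm_e)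

lemma conj_deriv_linear: "x \<in> W1 \<Longrightarrow> linear (conj_deriv x)"
  unfolding conj_deriv_def
  by (intro linearI) (simp_all add: linear_add[OF Dm_linear] linear_scale[OF Dm_linear] dom
      flip: linear_add[OF Dm_linear] linear_scale[OF Dm_linear])

text \<open>\<open>D2\<close> differentiates \<open>Dm\<close> with a fixed vector, whereas here the
  vector moves with \<open>x\<close>. Expanding it in \<open>Basis\<close> gives sums of products of
  differentiable functions. Since the inverse has derivative -1, \<open>D2_fst_diff\<close> leaves
  exactly the two mixed terms of \<open>brac\<close>.\<close>

lemma conj_deriv_derivative: "((\<lambda>x. conj_deriv x Z) has_derivative (\<lambda>Y. brac Y Z)) (at e)"
proof -
  let ?r = "\<lambda>x. Dm (x, e) (0, Z)"
  let ?q = "\<lambda>b x. Dm (x, i x) (b, 0)"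
  have r: "(?r has_derivative (\<lambda>h. D2 (0, Z) (h, 0))) (at e)"
    by (rule has_derivative_compose[of "\<lambda>x. (x, e)" "\<lambda>h. (h, 0)" e UNIV "\<lambda>p. Dm p (0, Z)", OF _ D2])
       (auto intro!: derivative_eq_intros)
  have q: "(?q b has_derivative (\<lambda>h. D2 (b, 0) (h, - h))) (at e)" for b
    by (rule has_derivative_compose[of "\<lambda>x. (x, i x)" "\<lambda>h. (h, - h)" e UNIV "\<lambda>p. Dm p (b, 0)"])
       (auto intro!: derivative_eq_intros i_deriv simp: i_e D2)
  have expand: "L (v, 0) = (\<Sum>b\<in>Basis. (v \<bullet> b) *\<^sub>R L (b, 0))" if "linear L" for L :: "'e \<times> 'e \<Rightarrow> 'e" and v
  proof -
    have "linear (\<lambda>v. L (v, 0))"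
      using linear_compose[OF _ that, of "\<lambda>v. (v, 0)"] by (simp add: o_def linear_iff)
    from linear_sum[OF this, of "\<lambda>b. (v \<bullet> b) *\<^sub>R b" Basis]
    show ?thesis using linear_scale[OF \<open>linear (\<lambda>v. L (v, 0))\<close>] by (simp add: euclidean_representation)
  qed
  have "((\<lambda>x. \<Sum>b\<in>Basis. (?r x \<bullet> b) *\<^sub>R ?q b x) has_derivative
      (\<lambda>h. \<Sum>b\<in>Basis. (?r e \<bullet> b) *\<^sub>R D2 (b, 0) (h, - h) + (D2 (0, Z) (h, 0) \<bullet> b) *\<^sub>R ?q b e)) (at e)"
    by (intro has_derivative_sum has_derivative_scaleR has_derivative_inner_left r q)
  moreover have "(\<lambda>h. \<Sum>b\<in>Basis. (?r e \<bullet> b) *\<^sub>R D2 (b, 0) (h, - h) + (D2 (0, Z) (h, 0) \<bullet> b) *\<^sub>R ?q b e) =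
      (\<lambda>Y. brac Y Z)"
  proof
    fix h
    have "(\<Sum>b\<in>Basis. (Z \<bullet> b) *\<^sub>R D2 (b, 0) (0, h)) = D2 (Z, 0) (0, h)"
      using expand[OF D2_linear[of "(0, h)"], of Z] by (simp add: D2_sym[of "(0, h)"])
    then show "(\<Sum>b\<in>Basis. (?r e \<bullet> b) *\<^sub>R D2 (b, 0) (h, - h) + (D2 (0, Z) (h, 0) \<bullet> b) *\<^sub>R ?q b e) = brac h Z"
      by (simp add: sum.distrib Dm_e i_e D2_fst_diff sum_subtractf euclidean_representation brac_def)
  qed
  ultimately have "((\<lambda>x. \<Sum>b\<in>Basis. (?r x \<bullet> b) *\<^sub>R ?q b x) has_derivative (\<lambda>Y. brac Y Z)) (at e)" by simp
  then show ?thesis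
  proof (rule has_derivative_transform_within_open[OF _ W1])
    fix x assume "x \<in> W1"
    then show "(\<Sum>b\<in>Basis. (?r x \<bullet> b) *\<^sub>R ?q b x) = conj_deriv x Z"
      unfolding conj_deriv_def using expand[OF Dm_linear[OF dom(3)]] by simp
  qed
qed

lemma brac_antisym: "brac Y Z = - brac Z Y"
  by (simp add: brac_def D2_sym[of "(Z, 0)"] D2_sym[of "(Y, 0)"])

text \<open>By symmetry of second derivatives \<open>Z\<close> can be moved to the direction of
  differentiation, where linearity is automatic.\<close>

lemma brac_linear: "linear (brac Y)"
proof -
  have *: "brac Y Z = D2 (Y, 0) (0, Z) - D2 (0, Y) (Z, 0)" for Z
    by (simp add: brac_def D2_sym)
  show ?thesis
  proof (rule linearI)
    fix v w
    show "brac Y (v + w) = brac Y v + brac Y w"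
      using linear_add[OF D2_linear[of "(Y, 0)"], of "(0, v)" "(0, w)"]
        linear_add[OF D2_linear[of "(0, Y)"], of "(v, 0)" "(w, 0)"] by (simp add: *)
  next
    fix c v
    show "brac Y (c *\<^sub>R v) = c *\<^sub>R brac Y v"
      using linear_scale[OF D2_linear[of "(Y, 0)"], of c "(0, v)"]
        linear_scale[OF D2_linear[of "(0, Y)"], of c "(v, 0)"] by (simp add: * scaleR_diff_right)
  qed
qed

lemma conj_curve:
  assumes x: "x \<in> W1"
  shows "((\<lambda>s. m (m (x, e + s *\<^sub>R Z), i x)) has_vector_derivative conj_deriv x Z) (at 0)"
proof -
  have 1: "((\<lambda>s. m (x, e + s *\<^sub>R Z)) has_derivative (\<lambda>h. Dm (x, e) (0, h *\<^sub>R Z))) (at 0)"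
    by (rule has_derivative_compose[of "\<lambda>s. (x, e + s *\<^sub>R Z)" "\<lambda>h. (0, h *\<^sub>R Z)" 0 UNIV m])
       (auto intro!: derivative_eq_intros simp: Dm dom x)
  have "((\<lambda>s. m (m (x, e + s *\<^sub>R Z), i x)) has_derivative (\<lambda>h. Dm (x, i x) (Dm (x, e) (0, h *\<^sub>R Z), 0))) (at 0)"
    by (rule has_derivative_compose[of "\<lambda>s. (m (x, e + s *\<^sub>R Z), i x)" "\<lambda>h. (Dm (x, e) (0, h *\<^sub>R Z), 0)" 0 UNIV m])
       (auto intro!: derivative_eq_intros 1 simp: Dm dom x right_id)
  moreover have "Dm (x, i x) (Dm (x, e) (0, h *\<^sub>R Z), 0) = h *\<^sub>R conj_deriv x Z" for h
    using linear_scale[OF conj_deriv_linear[OF x]] by (simp add: conj_deriv_def)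
  ultimately show ?thesis by (simp add: has_vector_derivative_def)
qed

end

section \<open>Transfer to a chart of the Lie group\<close>

locale lie_group_chart = lie_group G X A
  for G :: "'g monoid" (structure) and X :: "'g topology" and A :: "('g, 'e::euclidean_space) chart set" +
  fixes \<kappa> :: "('g, 'e) chart"
  assumes chart_in: "\<kappa> \<in> A" and one_in: "\<one> \<in> fst \<kappa>"
begin

abbreviation "U \<equiv> fst \<kappa>"
abbreviation "\<phi> \<equiv> snd \<kappa>"
abbreviation "\<psi> \<equiv> chart_inv \<kappa>"
abbreviation "V \<equiv> \<phi> ` U"
abbreviation "e0 \<equiv> \<phi> \<one>"

text \<open>The case expression on pairs repeats the form used in \<open>mult_smooth\<close>, so
  that smoothness carries over by unfolding.\<close>

definition cmult :: "'e \<times> 'e \<Rightarrow> 'e" where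
  "cmult p = \<phi> ((\<lambda>(x, y). \<psi> x \<otimes> \<psi> y) p)"

definition cinv :: "'e \<Rightarrow> 'e" where
  "cinv x = \<phi> (inv (\<psi> x))"

definition dom2 :: "('e \<times> 'e) set" where
  "dom2 = {p \<in> V \<times> V. (\<lambda>(x, y). \<psi> x \<otimes> \<psi> y) p \<in> U}"

definition dom1 :: "'e set" where
  "dom1 = {x \<in> V. inv (\<psi> x) \<in> U}"

lemma openU: "openin X U" and openV: "open V"
  and homeo: "homeomorphic_map (subtopology X U) (top_of_set V) \<phi>"
  using chart[of U \<phi>] chart_in by auto

lemma U_carrier: "U \<subseteq> carrier G"
  using openin_subset[OF openU] topspace_eq by simp

lemma inj_phi: "inj_on \<phi> U"
  using homeomorphic_imp_injective_map[OF homeo] U_carrier topspace_eq by (simp add: Int_absorb1)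

lemma chi_phi [simp]: "g \<in> U \<Longrightarrow> \<psi> (\<phi> g) = g"
  using inj_phi by (simp add: chart_inv_def)

lemma phi_chi [simp]: "x \<in> V \<Longrightarrow> \<phi> (\<psi> x) = x"
  by (simp add: chart_inv_def f_inv_into_f)

lemma chi_in: "x \<in> V \<Longrightarrow> \<psi> x \<in> U"
  by (simp add: chart_inv_def inv_into_into)

lemma chi_carrier: "x \<in> V \<Longrightarrow> \<psi> x \<in> carrier G"
  using chi_in U_carrier by blast

lemma smooth_into_open:
  assumes "smooth_into X A S f"
  shows "open {x \<in> S. f x \<in> U}" "Ck_on k {x \<in> S. f x \<in> U} (\<lambda>x. \<phi> (f x))"
proof -
  have S: "open S" and f: "continuous_map (top_of_set S) X f"
    and sm: "\<forall>(U, \<phi>)\<in>A. smooth_on {x \<in> S. f x \<in> U} (\<lambda>x. \<phi> (f x))"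
    using assms by (auto simp: smooth_into_def)
  have "openin (top_of_set S) {x \<in> topspace (top_of_set S). f x \<in> U}"
    using openin_continuous_map_preimage[OF f openU] .
  then show "open {x \<in> S. f x \<in> U}" using openin_open_eq[OF S] by simp
  show "Ck_on k {x \<in> S. f x \<in> U} (\<lambda>x. \<phi> (f x))"
    using sm chart_in by (auto simp: smooth_on_def split_beta)
qed

sublocale loc: local_group cmult cinv e0 dom2 dom1
proof
  note mult = mult_smooth[OF chart_in chart_in]
  note inverse = inverse_smooth[OF chart_in]
  show "open dom2" using smooth_into_open(1)[OF mult] by (simp add: dom2_def)
  show "Ck_on (Suc (Suc 0)) dom2 cmult"
    using smooth_into_open(2)[OF mult, of "Suc (Suc 0)"] unfolding dom2_def cmult_def .
  show "open dom1" using smooth_into_open(1)[OF inverse] by (simp add: dom1_def)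
  show o1: "e0 \<in> dom1" using one_in by (simp add: dom1_def)
  show "cinv differentiable (at e0)"
  proof -
    have "Ck_on (Suc 0) dom1 cinv"
      using smooth_into_open(2)[OF inverse, of "Suc 0"] unfolding dom1_def cinv_def[abs_def] .
    then show ?thesis using o1 by simp
  qed
  show "cinv e0 = e0" using one_in by (simp add: cinv_def)
  fix x assume x: "x \<in> dom1"
  then have xV: "x \<in> V" and inv: "inv (\<psi> x) \<in> U" by (auto simp: dom1_def)
  have c: "\<psi> x \<in> carrier G" by (rule chi_carrier[OF xV])
  show "(x, e0) \<in> dom2" "(e0, x) \<in> dom2" "(x, cinv x) \<in> dom2"
    using xV inv one_in c by (auto simp: dom2_def cinv_def chi_in)
  show "cmult (x, e0) = x" "cmult (e0, x) = x" "cmult (x, cinv x) = e0"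
    using xV inv one_in c by (auto simp: cmult_def cinv_def)
qed

lemma ray_0: "ray G \<kappa> Z 0 = \<one>"
  using one_in by (simp add: ray_def)

text \<open>For small s all partial products stay in the chart domain, so the conjugated curve of
  \<open>Ad\<close> agrees near 0 with a composition of \<open>cmult\<close> and
  \<open>cinv\<close>. Its value at 0 is the identity, which makes the left translation in
  \<open>log_vel\<close> trivial.\<close>

lemma Ad_chart:
  assumes x: "x \<in> dom1"
  shows "Ad G \<kappa> (\<psi> x) Z = loc.conj_deriv x Z"
proof -
  have xV: "x \<in> V" and inv: "inv (\<psi> x) \<in> U" using x by (auto simp: dom1_def)
  have c: "\<psi> x \<in> carrier G" by (rule chi_carrier[OF xV])
  define cc where "cc s = \<psi> x \<otimes> ray G \<kappa> Z s \<otimes> inv (\<psi> x)" for s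
  have cc0: "cc 0 = \<one>" using c by (simp add: cc_def ray_0)
  let ?f = "\<lambda>s. cmult (cmult (x, e0 + s *\<^sub>R Z), cinv x)"
  have 1: "\<forall>\<^sub>F s in at 0. (x, e0 + s *\<^sub>R Z) \<in> dom2"
  proof (rule topological_tendstoD[OF _ loc.W2])
    show "((\<lambda>s. (x, e0 + s *\<^sub>R Z)) \<longlongrightarrow> (x, e0)) (at 0)"
      by (auto intro!: tendsto_eq_intros)
    show "(x, e0) \<in> dom2" by (rule loc.dom[OF x])
  qed
  have 2: "\<forall>\<^sub>F s in at 0. (cmult (x, e0 + s *\<^sub>R Z), cinv x) \<in> dom2"
  proof (rule topological_tendstoD[OF _ loc.W2])
    have "isCont cmult (x, e0)" using loc.Dm[OF loc.dom(1)[OF x]] by (rule has_derivative_continuous)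
    then have "((\<lambda>s. cmult (x, e0 + s *\<^sub>R Z)) \<longlongrightarrow> cmult (x, e0)) (at 0)"
      by (rule isCont_tendsto_compose) (auto intro!: tendsto_eq_intros)
    then show "((\<lambda>s. (cmult (x, e0 + s *\<^sub>R Z), cinv x)) \<longlongrightarrow> (x, cinv x)) (at 0)"
      by (intro tendsto_Pair tendsto_const) (simp add: loc.right_id[OF x])
    show "(x, cinv x) \<in> dom2" by (rule loc.dom[OF x])
  qed
  have eq: "\<forall>\<^sub>F s in at 0. ?f s = \<phi> (inv (cc 0) \<otimes> cc s)"
    using 1 2
  proof eventually_elim
    case (elim s)
    then have sV: "e0 + s *\<^sub>R Z \<in> V" and prod: "\<psi> x \<otimes> \<psi> (e0 + s *\<^sub>R Z) \<in> U"
      by (auto simp: dom2_def)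
    have "cc s \<in> carrier G" using c chi_carrier[OF sV] by (simp add: cc_def ray_def)
    then have "\<phi> (inv (cc 0) \<otimes> cc s) = \<phi> (cc s)" by (simp add: cc0)
    then show ?case using prod inv by (simp add: cmult_def cinv_def cc_def[of s] ray_def)
  qed
  have at0: "?f 0 = \<phi> (inv (cc 0) \<otimes> cc 0)"
    using x by (simp add: cc0 loc.right_id loc.right_inv)
  have "\<forall>\<^sub>F s in nhds 0. s \<in> UNIV \<longrightarrow> ?f s = \<phi> (inv (cc 0) \<otimes> cc s)"
    using eq at0 by (simp add: eventually_nhds_conv_at)
  then have "(?f has_vector_derivative loc.conj_deriv x Z) (at 0 within UNIV) \<longleftrightarrow>
      ((\<lambda>s. \<phi> (inv (cc 0) \<otimes> cc s)) has_vector_derivative loc.conj_deriv x Z) (at 0 within UNIV)"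
    by (intro has_vector_derivative_cong_ev) (use at0 in auto)
  then have "((\<lambda>s. \<phi> (inv (cc 0) \<otimes> cc s)) has_vector_derivative loc.conj_deriv x Z) (at 0)"
    using loc.conj_curve[OF x] by simp
  then show ?thesis
    unfolding Ad_def log_vel_def cc_def[abs_def] by (rule vector_derivative_at)
qed

lemma ray_near_one: "\<forall>\<^sub>F s in nhds 0. e0 + s *\<^sub>R Y \<in> dom1"
proof -
  have "open ((\<lambda>s. e0 + s *\<^sub>R Y) -` dom1)" by (intro open_vimage loc.W1 continuous_intros)
  from eventually_nhds_in_open[OF this, of 0] show ?thesis using loc.W1(2) by simp
qed

lemma Ad_ray_derivative: "((\<lambda>s. Ad G \<kappa> (ray G \<kappa> Y s) Z) has_vector_derivative loc.brac Y Z) (at 0)"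
proof -
  have "((\<lambda>s. e0 + s *\<^sub>R Y) has_derivative (\<lambda>s. s *\<^sub>R Y)) (at 0)"
    by (auto intro!: derivative_eq_intros)
  then have "((\<lambda>s. loc.conj_deriv (e0 + s *\<^sub>R Y) Z) has_derivative (\<lambda>s. loc.brac (s *\<^sub>R Y) Z)) (at 0)"
    by (rule has_derivative_compose) (simp add: loc.conj_deriv_derivative)
  moreover have "loc.brac (s *\<^sub>R Y) Z = s *\<^sub>R loc.brac Y Z" for s
    using linear_scale[OF loc.brac_linear] loc.brac_antisym[of _ Z] by (metis scaleR_minus_right)
  ultimately have "((\<lambda>s. loc.conj_deriv (e0 + s *\<^sub>R Y) Z) has_vector_derivative loc.brac Y Z) (at 0 within UNIV)"
    by (simp add: has_vector_derivative_def)
  moreover have "\<forall>\<^sub>F s in nhds 0. s \<in> UNIV \<longrightarrow> loc.conj_deriv (e0 + s *\<^sub>R Y) Z = Ad G \<kappa> (ray G \<kappa> Y s) Z"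
    using ray_near_one[of Y] by eventually_elim (simp add: ray_def Ad_chart)
  then have "((\<lambda>s. loc.conj_deriv (e0 + s *\<^sub>R Y) Z) has_vector_derivative loc.brac Y Z) (at 0 within UNIV) \<longleftrightarrow>
      ((\<lambda>s. Ad G \<kappa> (ray G \<kappa> Y s) Z) has_vector_derivative loc.brac Y Z) (at 0 within UNIV)"
    by (intro has_vector_derivative_cong_ev)
       (use Ad_chart[OF loc.W1(2)] in \<open>auto simp: ray_def\<close>)
  ultimately show ?thesis by simp
qed

lemma bracket_eq: "bracket G \<kappa> Y Z = loc.brac Y Z"
  unfolding bracket_def by (rule vector_derivative_at[OF Ad_ray_derivative])

lemma bracket_antisym: "bracket G \<kappa> Y Z = - bracket G \<kappa> Z Y"
  unfolding bracket_eq by (rule loc.brac_antisym)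

lemma bracket_linear: "linear (bracket G \<kappa> Y)"
  using loc.brac_linear by (simp add: bracket_eq[abs_def])

text \<open>Differentiate the invariance of \<open>Q\<close> under the adjoint action along a ray
  through the identity.\<close>

lemma bracket_skew:
  assumes Q: "ad_invariant_inner_product G \<kappa> Q"
  shows "Q (bracket G \<kappa> Y v) w = - Q v (bracket G \<kappa> Y w)"
proof -
  interpret bounded_bilinear Q
    using Q by (simp add: ad_invariant_inner_product_def bilinear_conv_bounded_bilinear)
  let ?Ad = "\<lambda>v s. Ad G \<kappa> (ray G \<kappa> Y s) v"
  have "((\<lambda>s. Q (?Ad v s) (?Ad w s)) has_vector_derivative
      Q (?Ad v 0) (loc.brac Y w) + Q (loc.brac Y v) (?Ad w 0)) (at 0)"
    by (rule has_vector_derivative[OF Ad_ray_derivative Ad_ray_derivative])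
  moreover have Ad0: "?Ad v 0 = v" for v
    using Ad_chart[OF loc.W1(2), of v] one_in by (simp add: ray_0 loc.conj_deriv_e)
  ultimately have 1: "((\<lambda>s. Q (?Ad v s) (?Ad w s)) has_vector_derivative
      Q v (loc.brac Y w) + Q (loc.brac Y v) w) (at 0 within UNIV)" by simp
  \<comment> \<open>The ray is a curve in the group only while it stays in the chart, so invariance
    is available only near 0.\<close>
  have "\<forall>\<^sub>F s in nhds 0. s \<in> UNIV \<longrightarrow> Q (?Ad v s) (?Ad w s) = Q v w"
    using ray_near_one[of Y]
  proof eventually_elim
    case (elim s)
    then have "ray G \<kappa> Y s \<in> carrier G" by (auto simp: ray_def dom1_def intro: chi_carrier)
    then show ?case using Q by (simp add: ad_invariant_inner_product_def)
  qed
  then have "((\<lambda>s. Q (?Ad v s) (?Ad w s)) has_vector_derivative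
      Q v (loc.brac Y w) + Q (loc.brac Y v) w) (at 0 within UNIV) \<longleftrightarrow>
    ((\<lambda>s. Q v w) has_vector_derivative Q v (loc.brac Y w) + Q (loc.brac Y v) w) (at 0 within UNIV)"
    by (intro has_vector_derivative_cong_ev) (auto simp: Ad0)
  with 1 have "((\<lambda>s. Q v w) has_vector_derivative Q v (loc.brac Y w) + Q (loc.brac Y v) w) (at 0)" by simp
  moreover have "((\<lambda>s. Q v w) has_vector_derivative 0) (at 0)" by simp
  ultimately have "Q v (loc.brac Y w) + Q (loc.brac Y v) w = 0" using vector_derivative_unique_at by blast
  then show ?thesis by (simp add: bracket_eq eq_neg_iff_add_eq_0 add.commute)
qed

end

section \<open>Orthonormal bases for an inner product other than the standard one\<close>

locale inner_form =
  fixes Q :: "'e::euclidean_space \<Rightarrow> 'e \<Rightarrow> real"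
  assumes bilin: "bilinear Q" and sym: "Q v w = Q w v" and pos: "v \<noteq> 0 \<Longrightarrow> Q v v > 0"
begin

sublocale bb: bounded_bilinear Q
  using bilin by (simp add: bilinear_conv_bounded_bilinear)

definition orthonormal :: "'e set \<Rightarrow> bool" where
  "orthonormal F \<longleftrightarrow> (\<forall>a\<in>F. \<forall>b\<in>F. Q a b = (if a = b then 1 else 0))"

lemma coeff:
  assumes "orthonormal F" "finite F" "e \<in> F"
  shows "Q (\<Sum>b\<in>F. c b *\<^sub>R b) e = c e"
proof -
  have "Q (\<Sum>b\<in>F. c b *\<^sub>R b) e = (\<Sum>b\<in>F. c b * Q b e)"
    by (simp add: bb.sum_left bb.scaleR_left)
  also have "\<dots> = (\<Sum>b\<in>F. if b = e then c b else 0)"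
    using assms by (intro sum.cong) (auto simp: orthonormal_def)
  finally show ?thesis using assms by simp
qed

lemma orthonormal_independent:
  assumes F: "orthonormal F"
  shows "independent F"
  unfolding real_vector.independent_explicit_module
proof (intro allI impI)
  fix t u v assume t: "finite t" "t \<subseteq> F" "(\<Sum>v\<in>t. u v *\<^sub>R v) = 0" "v \<in> t"
  have "orthonormal t" using F t(2) unfolding orthonormal_def by blast
  from coeff[OF this t(1,4), of u] show "u v = 0" by (simp add: t(3) bb.zero_left)
qed

text \<open>An orthonormal set of greatest size containing \<open>F0\<close> represents every
  vector; otherwise the normalized remainder of its expansion could be added.\<close>

lemma orthonormal_extension:
  assumes F0: "orthonormal F0"
  shows "\<exists>F. F0 \<subseteq> F \<and> orthonormal F \<and> finite F \<and> (\<forall>v. v = (\<Sum>e\<in>F. Q v e *\<^sub>R e))"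
proof -
  let ?P = "\<lambda>F. F0 \<subseteq> F \<and> orthonormal F"
  have bound: "finite F \<and> card F \<le> DIM('e)" if "orthonormal F" for F
    using independent_bound[OF orthonormal_independent[OF that]] .
  have "\<exists>F. ?P F \<and> (\<forall>F'. ?P F' \<longrightarrow> card F' \<le> card F)"
    by (rule ex_has_greatest_nat[of ?P F0 card "DIM('e) + 1"]) (use F0 bound in \<open>auto simp: less_Suc_eq_le\<close>)
  then obtain F where F: "F0 \<subseteq> F" "orthonormal F" and max: "\<And>F'. ?P F' \<Longrightarrow> card F' \<le> card F" by blast
  have fin: "finite F" using bound F by blast
  have "v = (\<Sum>e\<in>F. Q v e *\<^sub>R e)" for v
  proof (rule ccontr)
    define w where "w = v - (\<Sum>e\<in>F. Q v e *\<^sub>R e)"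
    assume "v \<noteq> (\<Sum>e\<in>F. Q v e *\<^sub>R e)"
    then have w: "Q w w > 0" by (intro pos) (simp add: w_def)
    have we: "Q w e = 0" if "e \<in> F" for e
      unfolding w_def using coeff[OF F(2) fin that, of "Q v"] by (simp add: bb.diff_left)
    define n where "n = (1 / sqrt (Q w w)) *\<^sub>R w"
    have nn: "Q n n = 1" using w by (simp add: n_def bb.scaleR_left bb.scaleR_right)
    have ne: "Q n e = 0" "Q e n = 0" if "e \<in> F" for e
      using we[OF that] sym[of e n] by (simp_all add: n_def bb.scaleR_left)
    have "n \<notin> F" using ne(1)[of n] nn by auto
    moreover have "orthonormal (insert n F)"
      using F(2) nn ne \<open>n \<notin> F\<close> by (auto simp: orthonormal_def)
    ultimately show False using max[of "insert n F"] F(1) fin by auto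
  qed
  then show ?thesis using F fin by blast
qed

context
  fixes F assumes F: "orthonormal F" "finite F" "\<And>v. v = (\<Sum>e\<in>F. Q v e *\<^sub>R e)"
begin

lemma parseval: "Q v v = (\<Sum>e\<in>F. (Q v e)\<^sup>2)"
proof -
  have "Q v v = Q v (\<Sum>e\<in>F. Q v e *\<^sub>R e)" using F(3)[of v] by simp
  then show ?thesis by (simp add: bb.sum_right bb.scaleR_right power2_eq_square)
qed

text \<open>The trace is independent of the basis. This is needed because
  \<open>killing_form\<close> uses the standard basis, while the structure constants use bases
  orthonormal for \<open>Q\<close>.\<close>

lemma trace_orthonormal:
  assumes f: "linear f"
  shows "(\<Sum>b\<in>Basis. f b \<bullet> b) = (\<Sum>e\<in>F. Q (f e) e)"
proof -
  have "(\<Sum>b\<in>Basis. f b \<bullet> b) = (\<Sum>b\<in>Basis. \<Sum>e\<in>F. Q (f b) e * (e \<bullet> b))"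
  proof (rule sum.cong[OF refl])
    fix b
    have "f b \<bullet> b = (\<Sum>e\<in>F. Q (f b) e *\<^sub>R e) \<bullet> b" using F(3)[of "f b"] by simp
    then show "f b \<bullet> b = (\<Sum>e\<in>F. Q (f b) e * (e \<bullet> b))" by (simp add: inner_sum_left)
  qed
  also have "\<dots> = (\<Sum>e\<in>F. \<Sum>b\<in>Basis. Q (f b) e * (e \<bullet> b))" by (rule sum.swap)
  also have "\<dots> = (\<Sum>e\<in>F. Q (f e) e)"
  proof (rule sum.cong[OF refl])
    fix e
    have "f e = f (\<Sum>b\<in>Basis. (e \<bullet> b) *\<^sub>R b)" by (simp add: euclidean_representation)
    also have "\<dots> = (\<Sum>b\<in>Basis. (e \<bullet> b) *\<^sub>R f b)" by (simp add: linear_sum[OF f] linear_scale[OF f])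
    finally have "Q (f e) e = (\<Sum>b\<in>Basis. (e \<bullet> b) * Q (f b) e)"
      by (simp add: bb.sum_left bb.scaleR_left)
    then show "(\<Sum>b\<in>Basis. Q (f b) e * (e \<bullet> b)) = Q (f e) e" by (simp add: mult.commute)
  qed
  finally show ?thesis .
qed

end

end

section \<open>Properties of the structure constants\<close>

context lie_group_chart
begin

lemma inner_form: "ad_invariant_inner_product G \<kappa> Q \<Longrightarrow> inner_form Q"
  by unfold_locales (auto simp: ad_invariant_inner_product_def)

text \<open>Antisymmetry of the bracket and skewness of ad make Q([a,b],c)^2 invariant under all
  permutations. The sum over a full orthonormal basis is the negative Killing form, while \<gamma>
  only sums over vectors of the \<mm>_i; this gives the inequality for \<beta>.\<close>

lemma structure_constants_struct_const:
  fixes \<mm> E :: "'i::finite \<Rightarrow> 'e set"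
  assumes Q: "ad_invariant_inner_product G \<kappa> Q"
    and orth: "\<And>i j Y Z. i \<noteq> j \<Longrightarrow> Y \<in> \<mm> i \<Longrightarrow> Z \<in> \<mm> j \<Longrightarrow> Q Y Z = 0"
    and d: "\<And>i. d i = dim (\<mm> i)" "\<And>i. d i \<ge> 2"
    and beta: "\<And>i Y Z. Y \<in> \<mm> i \<Longrightarrow> Z \<in> \<mm> i \<Longrightarrow> killing_form G \<kappa> Y Z = - \<beta> i * Q Y Z"
    and E: "\<And>i. Q_orthonormal_basis Q (\<mm> i) (E i)"
  shows "structure_constants d \<beta> (struct_const G \<kappa> Q E)"
proof -
  interpret inner_form Q by (rule inner_form[OF Q])
  let ?br = "bracket G \<kappa>"
  note skew = bracket_skew[OF Q]
  have Eon: "orthonormal (E i)" and span: "span (E i) = \<mm> i" for i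
    using E[of i] by (auto simp: Q_orthonormal_basis_def orthonormal_def)
  have Em: "v \<in> \<mm> i" if "v \<in> E i" for v i
    using span_base[OF that] span by simp
  have finE: "finite (E i)" for i
    using independent_bound[OF orthonormal_independent[OF Eon]] by blast
  have card: "card (E i) = d i" for i
    using dim_span_eq_card_independent[OF orthonormal_independent[OF Eon]] d span by simp
  have dpos: "real (d i) > 0" for i using d(2)[of i] by simp
  define q where "q a b c = (Q (?br a b) c)\<^sup>2" for a b c
  have q12: "q a b c = q b a c" for a b c
    unfolding q_def by (subst bracket_antisym) (simp add: bb.minus_left)
  have q23: "q a b c = q a c b" for a b c
    unfolding q_def skew[of a b c] using sym[of b] by simp
  have sc: "d i * struct_const G \<kappa> Q E i k l = (\<Sum>a\<in>E i. \<Sum>b\<in>E k. \<Sum>c\<in>E l. q a b c)" for i k l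
    using dpos[of i] by (simp add: struct_const_def card q_def)
  let ?E = "\<Union>i. E i"
  have disj: "E i \<inter> E j = {}" if "i \<noteq> j" for i j
  proof -
    have "v \<notin> E j" if v: "v \<in> E i" for v
    proof
      assume "v \<in> E j"
      then have "Q v v = 0" using orth[OF \<open>i \<noteq> j\<close> Em Em, of v v] v by simp
      moreover have "Q v v = 1" using Eon[of i] v by (auto simp: orthonormal_def)
      ultimately show False by simp
    qed
    then show ?thesis by blast
  qed
  have E_on: "orthonormal ?E"
    unfolding orthonormal_def
  proof (intro ballI)
    fix a b assume "a \<in> ?E" "b \<in> ?E"
    then obtain i j where ij: "a \<in> E i" "b \<in> E j" by blast
    show "Q a b = (if a = b then 1 else 0)"
    proof (cases "i = j")
      case True
      then show ?thesis using ij Eon[of j] by (auto simp: orthonormal_def)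
    next
      case False
      then have "a \<noteq> b" using disj ij by blast
      moreover have "Q a b = 0" using orth[OF False Em Em] ij by simp
      ultimately show ?thesis by simp
    qed
  qed
  obtain F where F: "?E \<subseteq> F" "orthonormal F" "finite F" and rep: "\<forall>v. v = (\<Sum>e\<in>F. Q v e *\<^sub>R e)"
    using orthonormal_extension[OF E_on] by blast
  have rep: "v = (\<Sum>e\<in>F. Q v e *\<^sub>R e)" for v using rep by blast
  have killing: "killing_form G \<kappa> a a = - (\<Sum>b\<in>F. \<Sum>c\<in>F. q a b c)" for a
  proof -
    have lin: "linear (\<lambda>b. ?br a (?br a b))"
      using linear_compose[OF bracket_linear bracket_linear, of a a] by (simp add: o_def)
    have "killing_form G \<kappa> a a = (\<Sum>e\<in>F. Q (?br a (?br a e)) e)"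
      unfolding killing_form_def by (rule trace_orthonormal[OF F(2,3) rep lin])
    also have "\<dots> = (\<Sum>e\<in>F. - (\<Sum>c\<in>F. q a e c))"
    proof (rule sum.cong[OF refl])
      fix e
      have "Q (?br a (?br a e)) e = - Q (?br a e) (?br a e)" by (rule skew)
      also have "\<dots> = - (\<Sum>c\<in>F. q a e c)" unfolding q_def using parseval[OF F(2,3) rep] by simp
      finally show "Q (?br a (?br a e)) e = - (\<Sum>c\<in>F. q a e c)" .
    qed
    finally show ?thesis by (simp add: sum_negf)
  qed
  have union: "(\<Sum>b\<in>?E. f b) = (\<Sum>k\<in>UNIV. \<Sum>b\<in>E k. f b)" for f :: "'e \<Rightarrow> real"
    by (rule sum.UNION_disjoint) (use finE disj in auto)
  have qnn: "q a b c \<ge> 0" for a b c by (simp add: q_def)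
  have finU: "finite ?E" using finE by auto
  show ?thesis
  proof
    fix i k l
    show "d i \<ge> 2" by (rule d)
    show "struct_const G \<kappa> Q E i k l \<ge> 0"
      unfolding struct_const_def by (intro divide_nonneg_nonneg sum_nonneg) auto
    show "d i * struct_const G \<kappa> Q E i k l = d k * struct_const G \<kappa> Q E k i l"
      unfolding sc by (subst sum.swap) (simp add: q12)
    have "(\<Sum>a\<in>E i. \<Sum>b\<in>E k. \<Sum>c\<in>E l. q a b c) = (\<Sum>a\<in>E i. \<Sum>c\<in>E l. \<Sum>b\<in>E k. q a c b)"
      by (rule sum.cong[OF refl], subst sum.swap, simp only: q23)
    then have "d i * struct_const G \<kappa> Q E i k l = d i * struct_const G \<kappa> Q E i l k" unfolding sc .
    then show "struct_const G \<kappa> Q E i k l = struct_const G \<kappa> Q E i l k" using dpos[of i] by simp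
    have "d i * (\<Sum>k\<in>UNIV. \<Sum>l\<in>UNIV. struct_const G \<kappa> Q E i k l)
        = (\<Sum>k\<in>UNIV. \<Sum>l\<in>UNIV. \<Sum>a\<in>E i. \<Sum>b\<in>E k. \<Sum>c\<in>E l. q a b c)"
      by (simp add: sum_distrib_left sc)
    also have "\<dots> = (\<Sum>k\<in>UNIV. \<Sum>a\<in>E i. \<Sum>l\<in>UNIV. \<Sum>b\<in>E k. \<Sum>c\<in>E l. q a b c)"
      by (rule sum.cong[OF refl], rule sum.swap)
    also have "\<dots> = (\<Sum>a\<in>E i. \<Sum>k\<in>UNIV. \<Sum>l\<in>UNIV. \<Sum>b\<in>E k. \<Sum>c\<in>E l. q a b c)"
      by (rule sum.swap)
    also have "\<dots> = (\<Sum>a\<in>E i. \<Sum>k\<in>UNIV. \<Sum>b\<in>E k. \<Sum>l\<in>UNIV. \<Sum>c\<in>E l. q a b c)"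
      by (rule sum.cong[OF refl], rule sum.cong[OF refl], rule sum.swap)
    also have "\<dots> = (\<Sum>a\<in>E i. \<Sum>b\<in>?E. \<Sum>c\<in>?E. q a b c)" by (simp only: union)
    also have "\<dots> \<le> (\<Sum>a\<in>E i. \<beta> i)"
    proof (rule sum_mono)
      fix a assume a: "a \<in> E i"
      \<comment> \<open>Extending both sums from the bases of the \<mm>_i to \<open>F\<close> adds
        nonnegative terms only.\<close>
      have "(\<Sum>b\<in>?E. \<Sum>c\<in>?E. q a b c) \<le> (\<Sum>b\<in>?E. \<Sum>c\<in>F. q a b c)"
        by (intro sum_mono sum_mono2 F qnn)
      also have "\<dots> \<le> (\<Sum>b\<in>F. \<Sum>c\<in>F. q a b c)"
        by (intro sum_mono2 F sum_nonneg qnn)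
      also have "\<dots> = - killing_form G \<kappa> a a" by (simp add: killing)
      also have "\<dots> = \<beta> i * Q a a" using beta[OF Em Em, OF a a] by simp
      also have "Q a a = 1" using Eon[of i] a by (auto simp: orthonormal_def)
      finally show "(\<Sum>b\<in>?E. \<Sum>c\<in>?E. q a b c) \<le> \<beta> i" by simp
    qed
    also have "\<dots> = d i * \<beta> i" by (simp add: card)
    finally show "(\<Sum>k\<in>UNIV. \<Sum>l\<in>UNIV. struct_const G \<kappa> Q E i k l) \<le> \<beta> i"
      using dpos[of i] by simp
  qed
qed

end

section \<open>Singular solutions\<close>

text \<open>The derivatives witnessing smoothness are identified with \<open>derivative_on\<close>
  by uniqueness of limits. At the endpoint T this needs that the one-sided filter is
  nontrivial.\<close>

lemma smooth_on_interval_derivatives: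
  fixes f :: "real \<Rightarrow> 'b::real_normed_vector"
  assumes f: "smooth_on_interval {0<..T} f"
  shows "\<And>t. t \<in> {0<..T} \<Longrightarrow>
      (f has_vector_derivative derivative_on {0<..T} f t) (at t within {0<..T})"
    and "\<And>t. t \<in> {0<..T} \<Longrightarrow> (derivative_on {0<..T} f has_vector_derivative
      derivative_on {0<..T} (derivative_on {0<..T} f) t) (at t within {0<..T})"
proof -
  let ?J = "{0<..T}"
  obtain D where D0: "\<And>t. t \<in> ?J \<Longrightarrow> D 0 t = f t"
    and D: "\<And>k t. t \<in> ?J \<Longrightarrow> (D k has_vector_derivative D (Suc k) t) (at t within ?J)"
    using f unfolding smooth_on_interval_def by blast
  have nontrivial: "at t within ?J \<noteq> bot" if t: "t \<in> ?J" for t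
  proof -
    have "t islimpt {0<..<t}" using t by (intro islimpt_greaterThanLessThan2) simp
    then have "t islimpt ?J" by (rule islimpt_subset) (use t in auto)
    then show ?thesis by (simp add: trivial_limit_within)
  qed
  have f1: "(f has_vector_derivative D 1 t) (at t within ?J)" if t: "t \<in> ?J" for t
    using D[OF t, of 0] by (intro has_vector_derivative_transform[OF t, of f "D 0"]) (auto simp: D0)
  have eq1: "derivative_on ?J f t = D 1 t" if t: "t \<in> ?J" for t
    by (rule vector_derivative_within[OF nontrivial[OF t] f1[OF t]])
  have f2: "(derivative_on ?J f has_vector_derivative D 2 t) (at t within ?J)" if t: "t \<in> ?J" for t
    using D[OF t, of 1]
    by (intro has_vector_derivative_transform[OF t, of "derivative_on ?J f" "D 1"])
       (auto simp: eq1 numeral_2_eq_2)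
  have eq2: "derivative_on ?J (derivative_on ?J f) t = D 2 t" if t: "t \<in> ?J" for t
    by (rule vector_derivative_within[OF nontrivial[OF t] f2[OF t]])
  show "(f has_vector_derivative derivative_on ?J f t) (at t within ?J)" if "t \<in> ?J" for t
    using f1[OF that] eq1[OF that] by simp
  show "(derivative_on ?J f has_vector_derivative derivative_on ?J (derivative_on ?J f) t) (at t within ?J)"
    if "t \<in> ?J" for t
    using f2[OF that] eq2[OF that] by simp
qed

text \<open>The flow estimates live on the open interval and bound the product on (0, T/8]. The
  rest, including the endpoint T, is compact, and the product is continuous on it.\<close>

lemma (in structure_constants) M_fun_bounded:
  assumes h: "h > 0" and m: "m > 0" and T: "0 < T" "T < 1"
    and sol: "ode_solution {0<..T} d (r_fun \<beta> \<gamma>) h m lam y \<xi>"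
  shows "bdd_above ((\<lambda>t. M_fun {0<..T} d (R_fun \<beta> \<gamma>) y \<xi> t * t) ` {0<..T})"
proof -
  let ?J = "{0<..T}"
  let ?M = "M_fun ?J d (R_fun \<beta> \<gamma>) y \<xi>"
  define v where "v t = derivative_on ?J y t" for t
  have smooth: "smooth_on_interval ?J y" "smooth_on_interval ?J \<xi>"
    and eq_xi: "\<And>t. t \<in> ?J \<Longrightarrow> derivative_on ?J \<xi> t =
        - tr d (\<chi> i. (v t $ i)\<^sup>2) - m * (tr d (v t) - \<xi> t)\<^sup>2 - h\<^sup>2 * lam"
    and eq_y: "\<And>t. t \<in> ?J \<Longrightarrow> derivative_on ?J v t =
        - \<xi> t *\<^sub>R v t + h\<^sup>2 *\<^sub>R r_fun \<beta> \<gamma> (y t) - (h\<^sup>2 * lam) *\<^sub>R (\<chi> i. 1)"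
    using sol by (auto simp: ode_solution_def Let_def v_def[abs_def])
  have y': "(y has_vector_derivative v t) (at t within ?J)" if "t \<in> ?J" for t
    unfolding v_def by (rule smooth_on_interval_derivatives(1)[OF smooth(1) that])
  have v': "(v has_vector_derivative derivative_on ?J v t) (at t within ?J)" if "t \<in> ?J" for t
    unfolding v_def[abs_def] by (rule smooth_on_interval_derivatives(2)[OF smooth(1) that])
  note xi' = smooth_on_interval_derivatives(1)[OF smooth(2)]
  have at: "at t within ?J = at t" if "0 < t" "t < T" for t
    using that by (intro at_within_open_subset[of t "{0<..<T}"]) auto
  interpret flow: quasi_einstein_flow d \<beta> \<gamma> "\<lambda>i t. y t $ i" "\<lambda>i t. v t $ i" \<xi> T "h\<^sup>2" "h\<^sup>2 * lam" m
  proof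
    show "0 < T" "T \<le> 1" "0 < h\<^sup>2" "0 < m" using T h m by auto
    fix t i assume t: "0 < t" "t < T"
    then have tJ: "t \<in> ?J" by simp
    show "((\<lambda>t. y t $ i) has_real_derivative v t $ i) (at t)"
      using bounded_linear.has_vector_derivative[OF bounded_linear_vec_nth y'[OF tJ], of i]
      by (simp add: at[OF t] has_real_derivative_iff_has_vector_derivative)
    have "derivative_on ?J v t $ i =
        - \<xi> t * v t $ i + h\<^sup>2 * ric (\<lambda>j. exp (2 * y t $ j)) i - h\<^sup>2 * lam"
      by (simp add: eq_y[OF tJ] r_fun_eq_ric)
    then show "((\<lambda>t. v t $ i) has_real_derivative
        - \<xi> t * v t $ i + h\<^sup>2 * ric (\<lambda>j. exp (2 * y t $ j)) i - h\<^sup>2 * lam) (at t)"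
      using bounded_linear.has_vector_derivative[OF bounded_linear_vec_nth v'[OF tJ], of i]
      by (simp add: at[OF t] has_real_derivative_iff_has_vector_derivative)
  next
    fix t assume t: "0 < t" "t < T"
    then have tJ: "t \<in> ?J" by simp
    show "(\<xi> has_real_derivative - (\<Sum>i\<in>UNIV. d i * (v t $ i)\<^sup>2)
        - m * ((\<Sum>i\<in>UNIV. d i * v t $ i) - \<xi> t)\<^sup>2 - h\<^sup>2 * lam) (at t)"
      using xi'[OF tJ] unfolding eq_xi[OF tJ]
      by (simp add: at[OF t] has_real_derivative_iff_has_vector_derivative tr_def)
  qed
  have M_eq: "?M t = sqrt ((\<xi> t)\<^sup>2 + (\<Sum>i\<in>UNIV. d i * (v t $ i)\<^sup>2) + R_fun \<beta> \<gamma> (y t))" for t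
    by (simp add: M_fun_def v_def)
  obtain C where C: "\<And>t. 0 < t \<Longrightarrow> t \<le> T / 8 \<Longrightarrow>
      t\<^sup>2 * ((\<xi> t)\<^sup>2 + (\<Sum>i\<in>UNIV. d i * (v t $ i)\<^sup>2) + R_diag (\<lambda>j. exp (2 * y t $ j))) \<le> C"
    using flow.M_bound by blast
  have near_zero: "?M t * t \<le> sqrt C" if t: "0 < t" "t \<le> T / 8" for t
  proof -
    have "?M t * t = sqrt (t\<^sup>2 * ((\<xi> t)\<^sup>2 + (\<Sum>i\<in>UNIV. d i * (v t $ i)\<^sup>2) + R_fun \<beta> \<gamma> (y t)))"
      using t by (simp add: M_eq real_sqrt_mult)
    also have "\<dots> \<le> sqrt C" unfolding R_fun_eq_R_diag real_sqrt_le_iff by (rule C[OF t])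
    finally show ?thesis .
  qed
  have cont: "continuous_on ?J y" "continuous_on ?J v" "continuous_on ?J \<xi>"
    unfolding continuous_on_eq_continuous_within
    using y' v' xi' has_vector_derivative_continuous by blast+
  have "continuous_on ?J (\<lambda>t. ?M t * t)"
    unfolding M_eq R_fun_def by (intro continuous_intros cont)
  then have "continuous_on {T / 8..T} (\<lambda>t. ?M t * t)"
    by (rule continuous_on_subset) (use T in auto)
  then have "compact ((\<lambda>t. ?M t * t) ` {T / 8..T})" by (rule compact_continuous_image) simp
  then have "bdd_above ((\<lambda>t. ?M t * t) ` {T / 8..T})"
    by (intro bounded_imp_bdd_above compact_imp_bounded)
  moreover have "bdd_above ((\<lambda>t. ?M t * t) ` {0<..T / 8})"
    using near_zero by (intro bdd_aboveI2[of _ _ "sqrt C"]) auto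
  moreover have "{0<..T} = {0<..T / 8} \<union> {T / 8..T}" using T by auto
  ultimately show ?thesis by (simp add: image_Un)
qed

theorem theorem2p5:
  fixes G :: "'g monoid" and X :: "'g topology"
    and A :: "('g, 'e::euclidean_space) chart set" and \<kappa> :: "('g, 'e) chart"
    and H :: "'g set" and Q :: "'e \<Rightarrow> 'e \<Rightarrow> real"
    and \<mm> E :: "'i::finite \<Rightarrow> 'e set" and d :: "'i \<Rightarrow> nat"
    and \<beta> :: "'i \<Rightarrow> real" and \<gamma> :: "'i \<Rightarrow> 'i \<Rightarrow> 'i \<Rightarrow> real"
    and lam h m T :: real
    and y :: "real \<Rightarrow> real ^ 'i" and u \<xi> :: "real \<Rightarrow> real"
  assumes "lie_group G X A" and "compact_space X"
    and "\<kappa> \<in> A" and "\<one>\<^bsub>G\<^esub> \<in> fst \<kappa>"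
    and "subgroup H G" and "closedin X H"
    and "connected_space (coset_space G X H)"
    and "simply_connected_space (coset_space G X H)"
    and "ad_invariant_inner_product G \<kappa> Q"
    and "\<And>i. Ad_irreducible G \<kappa> H (\<mm> i)"
    and "\<And>i j Y Z. i \<noteq> j \<Longrightarrow> Y \<in> \<mm> i \<Longrightarrow> Z \<in> \<mm> j \<Longrightarrow> Q Y Z = 0"
    and "span (\<Union>i. \<mm> i) = Q_complement Q (lie_subalgebra G X A \<kappa> H)"
    and monotypic: "\<And>i j. i \<noteq> j \<Longrightarrow> \<not> Ad_isomorphic G \<kappa> H (\<mm> i) (\<mm> j)"
    and "\<And>i. d i = dim (\<mm> i)" and "\<And>i. d i \<ge> 2"
    and beta: "\<And>i Y Z. Y \<in> \<mm> i \<Longrightarrow> Z \<in> \<mm> i \<Longrightarrow> killing_form G \<kappa> Y Z = - \<beta> i * Q Y Z"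
    and "\<And>i. Q_orthonormal_basis Q (\<mm> i) (E i)"
    and gamma: "\<gamma> = struct_const G \<kappa> Q E"
    and "h > 0" and "m > 0" and "0 < T" and "T < 1"
    and "smooth_on_interval {0<..T} y" and "smooth_on_interval {0<..T} u"
    and "DIM('c::euclidean_space) = (\<Sum>i\<in>UNIV. d i)"
    and quasi_einstein_metric: "\<And>U (\<sigma> :: 'c \<Rightarrow> 'g). coset_coordinates G X A \<kappa> H U \<sigma> \<Longrightarrow>
          quasi_einstein (U \<times> {0<..T}) (cohom1_metric G \<kappa> Q \<mm> h y \<sigma>) (\<lambda>(x, t). u t) m lam"
    and xi: "\<And>t. t \<in> {0<..T} \<Longrightarrow>
          \<xi> t = tr d (derivative_on {0<..T} y t) - derivative_on {0<..T} u t"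
    and associated_solution: "ode_solution {0<..T} d (r_fun \<beta> \<gamma>) h m lam y \<xi>"
    and singular: "\<not> smoothly_extendable T y \<xi>"
  shows "bdd_above ((\<lambda>t. M_fun {0<..T} d (R_fun \<beta> \<gamma>) y \<xi> t * t) ` {0<..T})"
proof -
  interpret lie_group G X A by fact
  interpret lie_group_chart G X A \<kappa> by unfold_locales fact+
  have "structure_constants d \<beta> \<gamma>"
    unfolding gamma using assms by (intro structure_constants_struct_const) auto
  then show ?thesis
    using assms by (intro structure_constants.M_fun_bounded)
qed

end
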